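(* Let $d>2$ be even and $p$ an odd prime such that $p\nmid d(d-1)$. For $x\in\mathbb{F}_p^{\times}$ we have $$\sum_{t\in\mathbb{F}_p}\phi(1-t)\;{_{d-2}G}_{d-2}\left[\begin{array}{c}\frac1d,\ \frac2d,\ \ldots,\ \frac{\frac d2-1}{d},\ \frac{\frac d2+1}{d},\ \ldots,\ \frac{d-1}{d}\\ \frac1{d-1},\ \frac2{d-1},\ \ldots,\ \frac{d-3}{d-1},\ \frac{d-2}{d-1}\end{array}\Big|\ xt\right]=-\,{_{d-1}G}_{d-1}\left[\begin{array}{cccc}\frac1d,&\frac2d,&\ldots,&\frac{d-1}{d}\\ 0,&\frac1{d-1},&\ldots,&\frac{d-2}{d-1}\end{array}\Big|\ x\right].$$ Here, on the left-hand side, the $d-2$ upper parameters are the numbers $h/d$ with $1\le h\le d-1$, $h\neq\frac d2$, and the $d-2$ lower parameters are $h/(d-1)$ with $1\le h\le d-2$.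
   Context: $\phi$ is the quadratic character on $\mathbb{F}_p$, with $\phi(0)=0$. McCarthy's $p$-adic hypergeometric series: $\Gamma_p:\mathbb{Z}_p\to\mathbb{Z}_p^\times$ is the $p$-adic gamma function, i.e. the unique continuous function with $\Gamma_p(0)=1$ and $\Gamma_p(n)=(-1)^n\prod_{0<j<n,\,p\nmid j}j$ for positive integers $n$. $\omega:\mathbb{F}_p^\times\to\mathbb{Z}_p^\times$ is the Teichmüller character ($\omega(a)$ is the $(p-1)$-th root of unity with $\omega(a)\equiv a \pmod p$) and $\overline{\omega}$ its inverse; all characters, including the trivial one $\overline\omega^0$, are extended to $\mathbb{F}_p$ by the value $0$ at $0$. $\lfloor x\rfloor$ is the floor and $\langle x\rangle=x-\lfloor x\rfloor$ the fractional part of $x\in\mathbb{Q}$. For an odd prime $p$, $t\in\mathbb{F}_p$, $n\ge 1$ and $a_i,b_i\in\mathbb{Q}\cap\mathbb{Z}_p$ ($1\le i\le n$), $${_nG}_n\left[\begin{array}{cccc}a_1,&a_2,&\ldots,&a_n\\ b_1,&b_2,&\ldots,&b_n\end{array}\Big|\ t\right]:=\frac{-1}{p-1}\sum_{j=0}^{p-2}(-1)^{jn}\,\overline{\omega}^j(t)\prod_{i=1}^n(-p)^{-\lfloor\langle a_i\rangle-\frac{j}{p-1}\rfloor-\lfloor\langle -b_i\rangle+\frac{j}{p-1}\rfloor}\frac{\Gamma_p(\langle a_i-\frac{j}{p-1}\rangle)}{\Gamma_p(\langle a_i\rangle)}\frac{\Gamma_p(\langle -b_i+\frac{j}{p-1}\rangle)}{\Gamma_p(\langle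 -b_i\rangle)}.$$ *)

theory Defs
  imports
    "HOL-Analysis.Analysis"
    "HOL-Computational_Algebra.Polynomial_Factorial"
    "HOL-Number_Theory.Quadratic_Reciprocity"
    "Berlekamp_Zassenhaus.Finite_Field"
begin

text \<open>
  The prime \<open>p\<close> is carried by a type \<open>'p\<close> of class \<^class>\<open>prime_card\<close>: \<open>p = CARD('p)\<close>, and the
  field with \<open>p\<close> elements is \<^typ>\<open>'p mod_ring\<close>.
\<close>

text \<open>
  The inverse limit of the rings of integers modulo \<open>p ^ n\<close>: a \<open>p\<close>-adic integer is the compatible
  sequence of its least nonnegative residues modulo \<open>p ^ n\<close>, \<open>n = 0, 1, 2, \<dots>\<close>
\<close>

typedef (overloaded) 'p padic_int =
  "{f :: nat \<Rightarrow> int. \<forall>n. f n mod int CARD('p::prime_card) ^ n = f n \<and>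
                         f (Suc n) mod int CARD('p) ^ n = f n}"
  morphisms padic_residue Abs_padic_int
  by (rule exI[of _ "\<lambda>_. 0"]) simp

setup_lifting type_definition_padic_int

lemma mod_power_Suc_mod: "(a mod (q::int) ^ Suc n) mod q ^ n = a mod q ^ n"
  by (simp add: mod_mod_cancel)

lemma padic_residue_mod [simp]:
  "padic_residue (x :: 'p::prime_card padic_int) n mod int CARD('p) ^ n = padic_residue x n"
  using padic_residue[of x] by simp

lemma padic_residue_Suc_mod:
  "padic_residue (x :: 'p::prime_card padic_int) (Suc n) mod int CARD('p) ^ n = padic_residue x n"
  using padic_residue[of x] by simp

lemma padic_residue_mod_le:
  assumes "m \<le> n"
  shows "padic_residue (x :: 'p::prime_card padic_int) n mod int CARD('p) ^ m = padic_residue x m"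
  using assms
proof (induction n rule: dec_induct)
  case (step n)
  have "padic_residue x (Suc n) mod int CARD('p) ^ m
      = padic_residue x (Suc n) mod int CARD('p) ^ n mod int CARD('p) ^ m"
    using step by (simp add: mod_mod_cancel le_imp_power_dvd)
  then show ?case using step by (simp add: padic_residue_Suc_mod)
qed simp

lemma padic_residue_0 [simp]: "padic_residue (x :: 'p::prime_card padic_int) 0 = 0"
  using padic_residue_mod[of x 0] by simp

instantiation padic_int :: (prime_card) comm_ring_1
begin

lift_definition zero_padic_int :: "'a padic_int" is "\<lambda>_. 0" by simp

lift_definition one_padic_int :: "'a padic_int" is "\<lambda>n. 1 mod int CARD('a) ^ n"
  by (simp add: mod_power_Suc_mod del: power_Suc)

lift_definition plus_padic_int :: "'a padic_int \<Rightarrow> 'a padic_int \<Rightarrow> 'a padic_int"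
  is "\<lambda>f g n. (f n + g n) mod int CARD('a) ^ n"
  unfolding mod_power_Suc_mod by (auto intro: mod_add_cong)

lift_definition minus_padic_int :: "'a padic_int \<Rightarrow> 'a padic_int \<Rightarrow> 'a padic_int"
  is "\<lambda>f g n. (f n - g n) mod int CARD('a) ^ n"
  unfolding mod_power_Suc_mod by (auto intro: mod_diff_cong)

lift_definition times_padic_int :: "'a padic_int \<Rightarrow> 'a padic_int \<Rightarrow> 'a padic_int"
  is "\<lambda>f g n. (f n * g n) mod int CARD('a) ^ n"
  unfolding mod_power_Suc_mod by (auto intro: mod_mult_cong)

lift_definition uminus_padic_int :: "'a padic_int \<Rightarrow> 'a padic_int"
  is "\<lambda>f n. (- f n) mod int CARD('a) ^ n"
  unfolding mod_power_Suc_mod by (auto intro: mod_minus_cong)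

instance
proof
  fix a b c :: "'a padic_int"
  show "a + b + c = a + (b + c)" by transfer (simp add: fun_eq_iff mod_simps add.assoc)
  show "a + b = b + a" by transfer (simp add: fun_eq_iff add.commute)
  show "0 + a = a" by transfer simp
  show "- a + a = 0" by transfer (simp add: fun_eq_iff mod_simps)
  show "a - b = a + - b" by transfer (simp add: fun_eq_iff mod_simps)
  show "a * b * c = a * (b * c)" by transfer (simp add: fun_eq_iff mod_simps mult.assoc)
  show "a * b = b * a" by transfer (simp add: fun_eq_iff mult.commute)
  show "1 * a = a" by transfer (simp add: fun_eq_iff mod_simps)
  show "(a + b) * c = a * c + b * c" by transfer (simp add: fun_eq_iff mod_simps distrib_right)
  show "(0::'a padic_int) \<noteq> 1"
  proof
    assume "(0::'a padic_int) = 1"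
    then have "padic_residue (0::'a padic_int) 1 = padic_residue 1 1" by simp
    then show False
      using nontriv[where 'a='a] by (simp add: zero_padic_int.rep_eq one_padic_int.rep_eq)
  qed
qed

end

lemma padic_int_eq_iff: "x = y \<longleftrightarrow> (\<forall>n. padic_residue x n = padic_residue y n)"
  by (metis padic_residue_inject ext)

instance padic_int :: (prime_card) idom
proof
  fix x y :: "'a padic_int"
  let ?p = "int CARD('a)"
  assume "x \<noteq> 0" "y \<noteq> 0"
  then obtain m n where mn: "padic_residue x m \<noteq> 0" "padic_residue y n \<noteq> 0"
    by (auto simp: padic_int_eq_iff zero_padic_int.rep_eq)
  have p: "prime_elem ?p" using prime_card_int[where 'a='a] by simp
  have ndvd: "\<not> ?p ^ k dvd padic_residue z (m + n)"
    if "padic_residue z k \<noteq> 0" "k \<le> m + n" for k and z :: "'a padic_int"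
    using that padic_residue_mod_le[of k "m + n" z] by (metis dvd_imp_mod_0)
  have nx: "\<not> ?p ^ m dvd padic_residue x (m + n)" and ny: "\<not> ?p ^ n dvd padic_residue y (m + n)"
    using ndvd mn by simp_all
  then have nz: "padic_residue x (m + n) \<noteq> 0" "padic_residue y (m + n) \<noteq> 0" by auto
  have "multiplicity ?p (padic_residue x (m + n)) < m" "multiplicity ?p (padic_residue y (m + n)) < n"
    using multiplicity_dvd'[of m ?p "padic_residue x (m + n)"]
          multiplicity_dvd'[of n ?p "padic_residue y (m + n)"] nx ny by linarith+
  then have "multiplicity ?p (padic_residue x (m + n) * padic_residue y (m + n)) < m + n"
    using prime_elem_multiplicity_mult_distrib[OF p nz] by simp
  then have "\<not> ?p ^ (m + n) dvd padic_residue x (m + n) * padic_residue y (m + n)"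
    using p nz by (subst power_dvd_iff_le_multiplicity) auto
  then have "padic_residue (x * y) (m + n) \<noteq> 0"
    by (simp add: times_padic_int.rep_eq dvd_eq_mod_eq_0)
  then show "x * y \<noteq> 0" by (auto simp: zero_padic_int.rep_eq)
qed

text \<open>
  The \<open>p\<close>-adic distance \<open>p ^ (- v (x - y))\<close>. Since residues modulo \<open>p ^ 0\<close> always agree, the
  valuation \<open>v (x - y)\<close> is the least \<open>n\<close> such that \<open>x\<close> and \<open>y\<close> differ modulo \<open>p ^ (n + 1)\<close>.
\<close>

instantiation padic_int :: (prime_card) metric_space
begin

definition dist_padic_int :: "'a padic_int \<Rightarrow> 'a padic_int \<Rightarrow> real" where
  "dist_padic_int x y = (if x = y then 0
     else inverse (real CARD('a)) ^ (LEAST n. padic_residue x (Suc n) \<noteq> padic_residue y (Suc n)))"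

definition uniformity_padic_int :: "('a padic_int \<times> 'a padic_int) filter" where
  "uniformity_padic_int = (INF e\<in>{0<..}. principal {(x, y). dist x y < e})"

definition open_padic_int :: "'a padic_int set \<Rightarrow> bool" where
  "open_padic_int U \<longleftrightarrow> (\<forall>x\<in>U. \<forall>\<^sub>F (x', y) in uniformity. x' = x \<longrightarrow> y \<in> U)"

instance
proof
  fix x y z :: "'a padic_int"
  define q where "q = inverse (real CARD('a))"
  have q: "0 < q" "q \<le> 1"
    using nontriv[where 'a='a] by (simp_all add: q_def inverse_le_1_iff)
  define D where "D = (\<lambda>(x :: 'a padic_int) (y :: 'a padic_int) n.
    padic_residue x (Suc n) \<noteq> padic_residue y (Suc n))"
  have dist: "dist u v = (if u = v then 0 else q ^ (LEAST n. D u v n))" for u v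
    by (simp add: dist_padic_int_def q_def D_def)
  have nonneg: "0 \<le> dist u v" for u v :: "'a padic_int"
    using q(1) by (simp add: dist)
  show "dist x y = 0 \<longleftrightarrow> x = y" using q by (simp add: dist)
  show "dist x y \<le> dist x z + dist y z"
  proof -
    consider "x = y" | "x = z" | "y = z" | "x \<noteq> y" "x \<noteq> z" "y \<noteq> z" by blast
    then show ?thesis
    proof cases
      case 1
      then show ?thesis using nonneg[of x z] by (simp add: dist)
    next
      case 2
      have "D x y = D y x" by (rule ext) (auto simp: D_def)
      then have "dist x y = dist y x" by (simp only: dist eq_commute[of x y])
      then show ?thesis using 2 nonneg[of x z] by simp
    next
      case 3
      then show ?thesis using nonneg[of z z] by simp
    next
      case 4
      define n where "n = (LEAST n. D x y n)"
      have "\<exists>m. padic_residue x m \<noteq> padic_residue y m" using 4 padic_int_eq_iff by blast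
      then obtain m where m: "padic_residue x m \<noteq> padic_residue y m" by blast
      then have "m \<noteq> 0" by (rule contrapos_nn) simp
      then obtain k where "m = Suc k" using not0_implies_Suc by blast
      then have "D x y k" using m by (simp add: D_def)
      then have "D x y n" unfolding n_def by (rule LeastI)
      then have "D x z n \<or> D y z n" unfolding D_def by argo
      then have "(LEAST n. D x z n) \<le> n \<or> (LEAST n. D y z n) \<le> n"
        using Least_le[of "D x z" n] Least_le[of "D y z" n] by blast
      then have "q ^ n \<le> q ^ (LEAST n. D x z n) \<or> q ^ n \<le> q ^ (LEAST n. D y z n)"
        using q by (meson power_decreasing less_imp_le)
      then have "q ^ n \<le> dist x z \<or> q ^ n \<le> dist y z" using 4 by (simp only: dist if_False)
      moreover have "dist x y = q ^ n" using 4 by (simp only: dist if_False n_def)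
      ultimately show ?thesis using nonneg[of x z] nonneg[of y z] by linarith
    qed
  qed
qed (rule uniformity_padic_int_def open_padic_int_def)+

end

definition padic_reduce :: "'p::prime_card padic_int \<Rightarrow> 'p mod_ring" where
  "padic_reduce z = of_int (padic_residue z 1)"

text \<open>
  The rational numbers that are \<open>p\<close>-adic integers, that is, whose denominator is prime to \<open>p\<close>, as
  elements of the ring of \<open>p\<close>-adic integers; the value at other rational numbers is irrelevant.
\<close>

definition padic_int_of_rat :: "rat \<Rightarrow> 'p::prime_card padic_int" where
  "padic_int_of_rat r = (THE z. of_int (snd (quotient_of r)) * z = of_int (fst (quotient_of r)))"

type_synonym 'p padic = "'p padic_int fract"

definition quadratic_char :: "'p::prime_card mod_ring \<Rightarrow> int" where
  "quadratic_char a = Legendre (to_int_mod_ring a) (int CARD('p))"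

definition teichmuller :: "'p::prime_card mod_ring \<Rightarrow> 'p padic_int" where
  "teichmuller a = (THE z. z ^ (CARD('p) - 1) = 1 \<and> padic_reduce z = a)"

text \<open>
  The \<open>j\<close>-th power of the inverse of the Teichmueller character, extended by \<open>0\<close> at \<open>0\<close> for every
  \<open>j\<close>, including \<open>j = 0\<close>.
\<close>

definition inv_teichmuller_power :: "nat \<Rightarrow> 'p::prime_card mod_ring \<Rightarrow> 'p padic" where
  "inv_teichmuller_power j t =
     (if t = 0 then 0 else inverse (to_fract (teichmuller t)) ^ j)"

definition padic_gamma :: "'p::prime_card padic_int \<Rightarrow> 'p padic_int" where
  "padic_gamma = (THE f. continuous_on UNIV f \<and> (\<forall>x. f x dvd 1) \<and> f 0 = 1 \<and>
     (\<forall>n>0. f (of_nat n) = (- 1) ^ n * (\<Prod>j | 0 < j \<and> j < n \<and> \<not> CARD('p) dvd j. of_nat j)))"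

definition padic_gamma_rat :: "rat \<Rightarrow> 'p::prime_card padic" where
  "padic_gamma_rat r = to_fract (padic_gamma (padic_int_of_rat r))"

text \<open>
  The parameter lists have the common length \<open>n\<close>; list positions are counted from \<open>0\<close>.
\<close>

definition mccarthy_G :: "rat list \<Rightarrow> rat list \<Rightarrow> 'p::prime_card mod_ring \<Rightarrow> 'p padic" where
  "mccarthy_G as bs t = (let p = CARD('p); n = length as in
     (- 1) / of_nat (p - 1) *
     (\<Sum>j = 0..p - 2. (- 1) ^ (j * n) * inv_teichmuller_power j t *
       (\<Prod>i<n. let a = as ! i; b = bs ! i; u = (of_nat j / of_nat (p - 1) :: rat) in
         (- of_nat p) powi (- \<lfloor>frac a - u\<rfloor> - \<lfloor>frac (- b) + u\<rfloor>)
         * (padic_gamma_rat (frac (a - u)) / padic_gamma_rat (frac a))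
         * (padic_gamma_rat (frac (- b + u)) / padic_gamma_rat (frac (- b))))))"

end

theory Submission
  imports Defs "HOL-Number_Theory.Residue_Primitive_Roots"
    "HOL-Computational_Algebra.Formal_Power_Series"
begin

text \<open>
  The left-hand side is, term by term in \<open>j\<close>, the right-hand side once the Jacobi sum
  \<open>\<Sum>\<^sub>t \<phi>(1 - t) \<omega>(t)\<^sup>-\<^sup>j\<close> is known in terms of \<open>\<Gamma>\<^sub>p\<close>, which is the Gross--Koblitz formula for
  Jacobi sums over the prime field. That formula is proved here inside the field of \<open>p\<close>-adic numbers,
  with no root of \<open>X\<^sup>p\<^sup>-\<^sup>1 + p\<close> and no root of unity of order \<open>p\<close>. Let \<open>b\<^sub>n\<close> be the coefficients of
  Dwork's series \<open>exp(Y + Y\<^sup>p/p)\<close>, \<open>0 \<le> a \<le> p - 2\<close> and \<open>x = a/(p - 1)\<close>.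

  Firstly, \<open>\<Sum>\<^sub>k p\<^sup>k b\<^bsub>a+pk\<^esub> x(x + 1)\<dots>(x + k - 1) = \<Gamma>\<^sub>p(x)\<close>: for \<open>x = -m\<close> the sum is
  \<open>(-p)\<^sup>m m!/(a + pm)!\<close>, which is a value of \<open>1/\<Gamma>\<^sub>p\<close> up to sign, and \<open>-a(1 + p + \<dots> + p\<^sup>n)\<close> tends
  to \<open>x\<close>. The iterated differences of \<open>m \<mapsto> (-p)\<^sup>m m!/(a + pm)!\<close> are divisible by growing powers of
  \<open>p\<close>, which bounds the \<open>b\<^sub>n\<close> and makes all the series converge.

  Secondly, the left-hand side of this identity is \<open>1 - p\<close> times \<open>S\<^sub>a = \<Sum>\<^sub>m (-p)\<^sup>m b\<^bsub>a+(p-1)m\<^esub>\<close>. Here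
  \<open>S\<^sub>a\<close> is the trace of Dwork's operator \<open>\<alpha>\<close> on power series, the other sum is its eigenvalue on the
  one-dimensional cokernel of a differential operator \<open>D\<close>, and \<open>\<alpha> D = p D \<alpha>\<close>.

  Thirdly, the analogue of \<open>S\<^sub>c\<close> for the series \<open>exp(v(Y + Y\<^sup>p/p))\<close> is \<open>\<omega>(v)\<^sup>c S\<^sub>c\<close>, because it is
  locally constant in \<open>v\<close>. Multiplying the series for \<open>1\<close> and for a root of unity \<open>u\<close>
  gives the one for \<open>1 + u\<close>, so that \<open>S\<^sub>a S\<^sub>b\<close> is \<open>S\<^bsub>a+b\<^esub>\<close> times a Jacobi sum.
\<close>

section \<open>The ring of \<open>p\<close>-adic integers\<close>

lemma padic_residue_of_nat [simp]:
  "padic_residue (of_nat k :: 'p::prime_card padic_int) n = int k mod int CARD('p) ^ n"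
  by (induction k) (simp_all add: zero_padic_int.rep_eq plus_padic_int.rep_eq one_padic_int.rep_eq mod_simps)

lemma padic_residue_of_int [simp]:
  "padic_residue (of_int k :: 'p::prime_card padic_int) n = k mod int CARD('p) ^ n"
proof -
  obtain a b where "k = int a - int b" by (rule int_diff_cases)
  then show ?thesis by (simp add: minus_padic_int.rep_eq mod_simps)
qed

text \<open>Naturals with equal residues agree because \<open>p ^ (m + n)\<close> exceeds both.
  Characteristic 0 passes to the fraction field, where the exponential series divides by
  factorials.\<close>

instance padic_int :: (prime_card) ring_char_0
proof
  show "inj (of_nat :: nat \<Rightarrow> 'a padic_int)"
  proof (rule injI)
    fix m n :: nat assume eq: "(of_nat m :: 'a padic_int) = of_nat n"
    define k where "k = m + n"
    have lt: "k < CARD('a) ^ k" using nontriv[where 'a='a] by (simp add: power_gt_expt)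
    have "int m mod int CARD('a) ^ k = int n mod int CARD('a) ^ k"
      by (metis eq padic_residue_of_nat)
    then have "m mod CARD('a) ^ k = n mod CARD('a) ^ k"
      by (metis of_nat_eq_iff of_nat_mod of_nat_power)
    moreover have "m < CARD('a) ^ k" "n < CARD('a) ^ k" using lt by (auto simp: k_def)
    ultimately show "m = n" by simp
  qed
qed

lemma to_fract_of_nat [simp]: "to_fract (of_nat n) = of_nat n"
  by (induction n) simp_all

lemma to_fract_of_int [simp]: "to_fract (of_int n) = of_int n"
  by (cases n rule: int_diff_cases) simp

lemma to_fract_power [simp]: "to_fract (x ^ n) = to_fract x ^ n"
  by (induction n) simp_all

instance fract :: ("{idom, ring_char_0}") field_char_0
proof
  show "inj (of_nat :: nat \<Rightarrow> 'a fract)"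
  proof (rule injI)
    fix m n :: nat assume "(of_nat m :: 'a fract) = of_nat n"
    then have "to_fract (of_nat m :: 'a) = to_fract (of_nat n)" by simp
    then show "m = n" by (simp only: to_fract_eq_iff of_nat_eq_iff)
  qed
qed

lemma padic_int_of_compatible_residues:
  fixes g :: "nat \<Rightarrow> int"
  assumes "\<And>n. [g (Suc n) = g n] (mod int CARD('p::prime_card) ^ n)"
  obtains z :: "'p::prime_card padic_int" where "\<And>n. padic_residue z n = g n mod int CARD('p) ^ n"
proof
  let ?f = "\<lambda>n. g n mod int CARD('p) ^ n"
  have "?f (Suc n) mod int CARD('p) ^ n = ?f n" for n
    using assms[of n] by (simp add: mod_power_Suc_mod cong_def del: power_Suc)
  then show "padic_residue (Abs_padic_int ?f :: 'p padic_int) n = ?f n" for n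
    by (subst Abs_padic_int_inverse) auto
qed

text \<open>A zero residue modulo \<open>p ^ n\<close> makes all later residues divisible by
  \<open>p ^ n\<close>; their quotients form a compatible sequence, which is the cofactor.\<close>

lemma prime_power_dvd_padic_iff:
  fixes x :: "'p::prime_card padic_int"
  shows "of_nat CARD('p) ^ n dvd x \<longleftrightarrow> padic_residue x n = 0"
proof
  assume "of_nat CARD('p) ^ n dvd x"
  then obtain y where "x = of_nat (CARD('p) ^ n) * y" by (auto simp: dvd_def)
  then show "padic_residue x n = 0"
    by (simp add: times_padic_int.rep_eq del: of_nat_power) simp
next
  let ?p = "int CARD('p)"
  assume x: "padic_residue x n = 0"
  have pos: "?p > 0" by simp
  have "[padic_residue x (n + Suc k) div ?p ^ n = padic_residue x (n + k) div ?p ^ n] (mod ?p ^ k)" for k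
  proof -
    have "padic_residue x (n + Suc k) mod ?p ^ (n + k) = padic_residue x (n + k)"
      by (simp add: padic_residue_mod_le)
    then obtain t where "padic_residue x (n + Suc k) = padic_residue x (n + k) + ?p ^ (n + k) * t"
      by (metis mult_div_mod_eq add.commute)
    then have "padic_residue x (n + Suc k) div ?p ^ n = padic_residue x (n + k) div ?p ^ n + ?p ^ k * t"
      using pos by (simp add: power_add mult.assoc)
    then show ?thesis by (simp add: cong_def)
  qed
  then obtain w :: "'p padic_int"
    where w: "\<And>k. padic_residue w k = (padic_residue x (n + k) div ?p ^ n) mod ?p ^ k"
    using padic_int_of_compatible_residues[of "\<lambda>k. padic_residue x (n + k) div ?p ^ n"] by auto
  have "padic_residue (of_nat (CARD('p) ^ n) * w) m = padic_residue x m" for m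
  proof -
    have "padic_residue x (n + m) mod ?p ^ n = 0"
      using x padic_residue_mod_le[of n "n + m" x] by simp
    then have "?p ^ n * (padic_residue x (n + m) div ?p ^ n) = padic_residue x (n + m)" by auto
    then show ?thesis
      using padic_residue_mod_le[of m "n + m" x]
      by (simp add: times_padic_int.rep_eq w mod_simps del: of_nat_power) simp
  qed
  then have "x = of_nat CARD('p) ^ n * w" by (simp add: padic_int_eq_iff)
  then show "of_nat CARD('p) ^ n dvd x" by simp
qed

lemma prime_power_dvd_padic_diff_iff:
  fixes x :: "'p::prime_card padic_int"
  shows "of_nat CARD('p) ^ n dvd x - y \<longleftrightarrow> padic_residue x n = padic_residue y n"
proof -
  have "(padic_residue x n - padic_residue y n) mod int CARD('p) ^ n = 0 \<longleftrightarrow>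
    padic_residue x n mod int CARD('p) ^ n = padic_residue y n mod int CARD('p) ^ n"
    by (metis dvd_eq_mod_eq_0 mod_eq_dvd_iff)
  then show ?thesis by (simp add: prime_power_dvd_padic_iff minus_padic_int.rep_eq)
qed

lemma padic_int_eqI:
  fixes x :: "'p::prime_card padic_int"
  assumes "\<And>n. of_nat CARD('p) ^ n dvd x - y"
  shows "x = y"
  using assms by (simp add: prime_power_dvd_padic_diff_iff padic_int_eq_iff)

lemma prime_power_dvd_padic_of_int_iff:
  "of_nat CARD('p) ^ n dvd (of_int k :: 'p::prime_card padic_int) \<longleftrightarrow> int CARD('p) ^ n dvd k"
  by (simp add: prime_power_dvd_padic_iff dvd_eq_mod_eq_0)

text \<open>Inverses modulo every \<open>p ^ n\<close> exist, and their uniqueness modulo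
  \<open>p ^ n\<close> makes them compatible.\<close>

lemma padic_unitI:
  fixes x :: "'p::prime_card padic_int"
  assumes "\<not> of_nat CARD('p) dvd x"
  shows "x dvd 1"
proof -
  let ?p = "int CARD('p)"
  have p: "prime ?p" by (rule prime_card_int)
  have x: "padic_residue x 1 \<noteq> 0" using assms prime_power_dvd_padic_iff[of 1 x] by simp
  have cop: "coprime (padic_residue x n) (?p ^ n)" for n
  proof (cases "n = 0")
    case False
    then have "padic_residue x n mod ?p = padic_residue x 1"
      using padic_residue_mod_le[of 1 n x] by simp
    then have "\<not> ?p dvd padic_residue x n" using x by auto
    then show ?thesis using p by (metis coprime_commute coprime_power_right_iff prime_imp_coprime)
  qed simp
  then have "\<exists>y. [padic_residue x n * y = 1] (mod ?p ^ n)" for n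
    by (metis cong_solve_coprime_int)
  then obtain g where g: "\<And>n. [padic_residue x n * g n = 1] (mod ?p ^ n)" by metis
  have "[g (Suc n) = g n] (mod ?p ^ n)" for n
  proof -
    have "[padic_residue x (Suc n) * g (Suc n) = 1] (mod ?p ^ n)"
      using g[of "Suc n"] by (rule cong_dvd_modulus) simp
    moreover have "[padic_residue x (Suc n) = padic_residue x n] (mod ?p ^ n)"
      by (simp add: cong_def padic_residue_Suc_mod)
    ultimately have "[padic_residue x n * g (Suc n) = padic_residue x n * g n] (mod ?p ^ n)"
      using g[of n] by (metis cong_scalar_right cong_sym cong_trans)
    then show ?thesis using cop by (simp add: cong_mult_lcancel)
  qed
  then obtain z :: "'p padic_int" where z: "\<And>n. padic_residue z n = g n mod ?p ^ n"
    using padic_int_of_compatible_residues by metis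
  have "padic_residue (x * z) n = padic_residue (1 :: 'p padic_int) n" for n
    using g[of n] by (simp add: times_padic_int.rep_eq one_padic_int.rep_eq z cong_def mod_simps)
  then have "x * z = 1" by (simp add: padic_int_eq_iff)
  then show ?thesis by (metis dvd_triv_left)
qed

text \<open>A nonzero distance is \<open>q ^ v\<close>, where \<open>q\<close> is the inverse of the
  prime and \<open>v\<close> the valuation of the difference. A strict inequality with
  \<open>q ^ n\<close> thus means \<open>v > n\<close>, hence the exponent
  \<open>Suc n\<close>.\<close>

lemma dist_padic_less_iff:
  fixes x :: "'p::prime_card padic_int"
  shows "dist x y < inverse (real CARD('p)) ^ n \<longleftrightarrow> of_nat CARD('p) ^ Suc n dvd x - y"
proof (cases "x = y")
  case True
  then show ?thesis by (simp add: prime_power_dvd_padic_diff_iff del: power_Suc)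
next
  case False
  define D where "D = (\<lambda>n. padic_residue x (Suc n) \<noteq> padic_residue y (Suc n))"
  have p: "1 < real CARD('p)" using nontriv[where 'a='p] by simp
  then have q: "0 < inverse (real CARD('p))" "inverse (real CARD('p)) < 1"
    by (auto simp: inverse_less_1_iff)
  obtain m where m: "padic_residue x m \<noteq> padic_residue y m" using False padic_int_eq_iff by blast
  then have "m \<noteq> 0" by (rule contrapos_nn) simp
  then have "D (m - 1)" using m by (simp add: D_def)
  then have ex: "\<exists>n. D n" by blast
  have mono: "D b" if "D a" "a \<le> b" for a b
    using that padic_residue_mod_le[of "Suc a" "Suc b" x] padic_residue_mod_le[of "Suc a" "Suc b" y]
    by (auto simp: D_def simp del: power_Suc)
  have "dist x y = inverse (real CARD('p)) ^ (LEAST n. D n)"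
    using False by (simp add: dist_padic_int_def D_def)
  then have "dist x y < inverse (real CARD('p)) ^ n \<longleftrightarrow> n < (LEAST n. D n)"
    using q by (simp add: power_strict_decreasing_iff)
  also have "\<dots> \<longleftrightarrow> \<not> D n"
    using mono ex by (metis LeastI_ex not_less_Least leI linorder_not_less)
  finally show ?thesis by (simp add: D_def prime_power_dvd_padic_diff_iff del: power_Suc)
qed

text \<open>The topology enters only through the defining property of \<open>padic_gamma\<close>;
  this form replaces it by divisibility.\<close>

lemma continuous_on_padic_iff:
  fixes f :: "'p::prime_card padic_int \<Rightarrow> 'p padic_int"
  shows "continuous_on UNIV f \<longleftrightarrow>
    (\<forall>x n. \<exists>m. \<forall>y. of_nat CARD('p) ^ m dvd y - x \<longrightarrow> of_nat CARD('p) ^ n dvd f y - f x)"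
proof -
  define q where "q = inverse (real CARD('p))"
  have p: "1 < real CARD('p)" using nontriv[where 'a='p] by simp
  then have q: "0 < q" "q < 1" by (auto simp: q_def inverse_less_1_iff)
  note dist = dist_padic_less_iff[where 'p='p, folded q_def]
  show ?thesis unfolding continuous_on_iff
  proof safe
    fix x :: "'p padic_int" and n
    assume "\<forall>x\<in>UNIV. \<forall>e>0. \<exists>d>0. \<forall>x'\<in>UNIV. dist x' x < d \<longrightarrow> dist (f x') (f x) < e"
    then obtain d where d: "d > 0" "\<And>x'. dist x' x < d \<Longrightarrow> dist (f x') (f x) < q ^ n"
      using q by (metis UNIV_I zero_less_power)
    obtain m where m: "q ^ m < d" using real_arch_pow_inv d(1) q(2) by blast
    have "of_nat CARD('p) ^ n dvd f y - f x" if "of_nat CARD('p) ^ Suc m dvd y - x" for y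
    proof -
      have "dist y x < q ^ m" using that dist by blast
      then have "dist (f y) (f x) < q ^ n" using d(2) m by simp
      then show ?thesis unfolding dist by (metis dvd_mult_right power_Suc)
    qed
    then show "\<exists>m. \<forall>y. of_nat CARD('p) ^ m dvd y - x \<longrightarrow> of_nat CARD('p) ^ n dvd f y - f x" by blast
  next
    fix x :: "'p padic_int" and e :: real
    assume *: "\<forall>x n. \<exists>m. \<forall>y. of_nat CARD('p) ^ m dvd y - x \<longrightarrow> of_nat CARD('p) ^ n dvd f y - f x"
      and "e > 0"
    obtain n where n: "q ^ n < e" using real_arch_pow_inv \<open>e > 0\<close> q(2) by blast
    obtain m where m: "\<And>y. of_nat CARD('p) ^ m dvd y - x \<Longrightarrow> of_nat CARD('p) ^ Suc n dvd f y - f x"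
      using * by blast
    have "dist (f y) (f x) < e" if "dist y x < q ^ m" for y
    proof -
      have "of_nat CARD('p) ^ m dvd y - x" using that unfolding dist by (metis dvd_mult_right power_Suc)
      then have "dist (f y) (f x) < q ^ n" using m dist by blast
      then show ?thesis using n by simp
    qed
    then show "\<exists>d>0. \<forall>x'\<in>UNIV. dist x' x < d \<longrightarrow> dist (f x') (f x) < e"
      using q(1) by (metis zero_less_power)
  qed
qed

section \<open>The \<open>p\<close>-adic gamma function\<close>

text \<open>The factor at \<open>j = 0\<close> is -1, because every number divides 0. It completes
  the sign for positive \<open>n\<close>, while the empty product gives the value 1 at 0, so one
  recurrence covers all arguments.\<close>

definition padic_gamma_nat :: "nat \<Rightarrow> nat \<Rightarrow> int" where
  "padic_gamma_nat p n = (\<Prod>j<n. - (if p dvd j then 1 else int j))"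

lemma padic_gamma_nat_0 [simp]: "padic_gamma_nat p 0 = 1"
  by (simp add: padic_gamma_nat_def)

lemma padic_gamma_nat_Suc:
  "padic_gamma_nat p (Suc n) = - (if p dvd n then 1 else int n) * padic_gamma_nat p n"
  by (simp add: padic_gamma_nat_def)

lemma padic_gamma_nat_eq_prod_units:
  assumes "n > 0"
  shows "padic_gamma_nat p n = (- 1) ^ n * (\<Prod>j | 0 < j \<and> j < n \<and> \<not> p dvd j. int j)"
  using assms
proof (induction n rule: nat_induct_non_zero)
  case 1
  have "{j. 0 < j \<and> j < 1 \<and> \<not> p dvd j} = {}" by auto
  then show ?case by (simp only: prod.empty) (simp add: padic_gamma_nat_def)
next
  case (Suc n)
  have "{j. 0 < j \<and> j < Suc n \<and> \<not> p dvd j} =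
    (if p dvd n then {} else {n}) \<union> {j. 0 < j \<and> j < n \<and> \<not> p dvd j}"
    using Suc.hyps by (auto simp: less_Suc_eq)
  then show ?case by (simp add: padic_gamma_nat_Suc Suc.IH)
qed

text \<open>Wilson's theorem for prime powers. The units are the \<open>t\<close> powers of a
  primitive root \<open>g\<close>, so their product is \<open>g\<close> to the power
  \<open>t (t - 1) / 2\<close>. Here \<open>g ^ (t div 2)\<close> is -1 and \<open>t - 1\<close> is
  odd.\<close>

lemma prod_units_mod_prime_power:
  assumes p: "prime p" "odd p" and r: "r > 0"
  shows "[(\<Prod>j | j < p ^ r \<and> \<not> p dvd j. int j) = - 1] (mod int p ^ r)"
proof -
  define m where "m = p ^ r"
  define t where "t = totient m"
  obtain g where g: "residue_primroot m g"
    using residue_primroot_odd_prime_power_exists[OF p] r unfolding m_def by metis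
  have p2: "p > 2" using p prime_gt_1_nat[of p] by (cases "p = 2") auto
  have pm: "p \<le> m" using p r unfolding m_def using power_increasing[of 1 r p] by (simp add: prime_gt_0_nat Suc_leI)
  then have m: "m > 2" using p2 by simp
  have ordg: "ord m g = t" using g by (auto simp: residue_primroot_def t_def)
  have t: "even t" "t > 0" using totient_even[of m] m by (auto simp: t_def)
  have set: "{j. j < p ^ r \<and> \<not> p dvd j} = totatives m"
  proof (rule Set.set_eqI)
    fix j
    have iff: "coprime j m \<longleftrightarrow> \<not> p dvd j"
    proof
      assume "coprime j m"
      then have "coprime p j" using r by (simp add: m_def coprime_commute)
      then show "\<not> p dvd j" using p(1) by (metis coprime_absorb_left not_prime_unit)
    next
      assume "\<not> p dvd j"
      then have "coprime p j" using prime_imp_coprime[OF p(1)] by blast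
      then show "coprime j m" by (simp add: m_def coprime_commute)
    qed
    show "j \<in> {j. j < p ^ r \<and> \<not> p dvd j} \<longleftrightarrow> j \<in> totatives m"
    proof (cases "p dvd j")
      case True
      then show ?thesis using iff by (simp add: totatives_def)
    next
      case False
      then have "j \<noteq> m" "0 < j" using r by (auto simp: m_def intro: Nat.gr0I)
      then show ?thesis using iff False le_eq_less_or_eq[of j m] by (simp add: totatives_def flip: m_def)
    qed
  qed
  have "(\<Prod>j\<in>totatives m. int j) = (\<Prod>i<t. int (g ^ i mod m))"
    using prod.reindex_bij_betw[OF residue_primroot_is_generator[OF _ g], of int] m by (simp add: t_def)
  also have "[\<dots> = (\<Prod>i<t. int g ^ i)] (mod int m)"
    by (rule cong_prod) (simp add: cong_def of_nat_mod)
  also have "(\<Prod>i<t. int g ^ i) = int g ^ (\<Sum>i<t. i)"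
    by (simp add: power_sum)
  also have "(\<Sum>i<t. i) = (t div 2) * (t - 1)"
    using Sum_Ico_nat[of 0 t] t by (auto simp: lessThan_atLeast0 elim!: evenE)
  also have "int g ^ \<dots> = (int g ^ (t div 2)) ^ (t - 1)" by (simp add: power_mult)
  also have "[\<dots> = (- 1) ^ (t - 1)] (mod int m)"
  proof (rule cong_pow)
    define y where "y = int g ^ (t div 2)"
    have "[g ^ (t div 2) * g ^ (t div 2) = 1] (mod m)"
      using ord[of g m] t unfolding ordg by (simp add: power_add[symmetric] mult_2[symmetric])
    then have "[y * y = 1] (mod int m)"
      by (metis cong_int_iff of_nat_1 of_nat_mult of_nat_power y_def)
    then have 1: "int p ^ r dvd (y - 1) * (y + 1)"
      by (simp add: cong_iff_dvd_diff m_def algebra_simps)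
    have "\<not> [g ^ (t div 2) = 1] (mod m)" using ord_minimal[of "t div 2" m g] t ordg by auto
    then have "\<not> [y = 1] (mod int m)"
      by (metis cong_int_iff of_nat_1 of_nat_power y_def)
    then have 2: "\<not> int p ^ r dvd y - 1" by (simp add: cong_iff_dvd_diff m_def)
    have pp: "prime (int p)" using p by simp
    \<comment> \<open>\<open>p\<close> cannot divide both \<open>y - 1\<close> and
      \<open>y + 1\<close>, whose difference is 2, so the whole power \<open>p ^ r\<close> divides
      one of them.\<close>
    have "int p dvd y + 1"
    proof (rule ccontr)
      assume "\<not> int p dvd y + 1"
      then have "coprime (int p ^ r) (y + 1)" using pp by (simp add: prime_imp_coprime)
      then have "int p ^ r dvd y - 1" using 1 by (simp only: coprime_dvd_mult_left_iff)
      then show False using 2 by simp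
    qed
    moreover have "\<not> int p dvd 2" using p2 by (auto dest: zdvd_imp_le)
    ultimately have "\<not> int p dvd y - 1" using dvd_diff[of "int p" "y + 1" "y - 1"] by auto
    then have "coprime (int p ^ r) (y - 1)" using pp by (simp add: prime_imp_coprime)
    then have "int p ^ r dvd y + 1" using 1 by (simp only: coprime_dvd_mult_right_iff)
    then show "[int g ^ (t div 2) = - 1] (mod int m)" by (simp add: cong_iff_dvd_diff m_def y_def)
  qed
  also have "(- 1) ^ (t - 1) = (- 1 :: int)" using t by (auto elim!: evenE)
  finally show ?thesis by (simp add: set m_def)
qed

lemma padic_gamma_nat_coprime: "prime p \<Longrightarrow> coprime (padic_gamma_nat p n) (int p)"
proof (induction n)
  case (Suc n)
  have "coprime (int n) (int p)" if "\<not> p dvd n"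
    using that Suc.prems by (metis coprime_commute coprime_int_iff prime_imp_coprime)
  then show ?case using Suc by (simp add: padic_gamma_nat_Suc)
qed simp

text \<open>A shift by \<open>p ^ r\<close> leaves the class unchanged: at 0 this is Wilson's
  theorem, with -1 turned into 1 by an odd number of signs, and the recurrence carries it to all
  arguments.\<close>

lemma padic_gamma_nat_cong:
  assumes p: "prime p" "odd p" and mn: "[m = n] (mod p ^ r)"
  shows "[padic_gamma_nat p m = padic_gamma_nat p n] (mod int p ^ r)"
proof (cases "r = 0")
  case False
  define q where "q = p ^ r"
  have q: "odd q" "q > 0" using p by (auto simp: q_def prime_gt_0_nat)
  have pq: "p dvd q" using False by (simp add: q_def)
  have period: "[padic_gamma_nat p (n + q) = padic_gamma_nat p n] (mod int q)" for n
  proof (induction n)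
    case 0
    have "{j. 0 < j \<and> j < q \<and> \<not> p dvd j} = {j. j < p ^ r \<and> \<not> p dvd j}"
      by (auto simp: q_def intro: gr0I)
    then have "padic_gamma_nat p q = - (\<Prod>j | j < p ^ r \<and> \<not> p dvd j. int j)"
      using q by (simp add: padic_gamma_nat_eq_prod_units)
    also have "[\<dots> = - (- 1)] (mod int q)"
      using prod_units_mod_prime_power[OF p, of r] False unfolding cong_minus_minus_iff by (simp add: q_def)
    finally show ?case by simp
  next
    case (Suc n)
    have "p dvd n + q \<longleftrightarrow> p dvd n" using pq by (simp add: dvd_add_left_iff)
    then have "[- (if p dvd n + q then 1 else int (n + q)) = - (if p dvd n then 1 else int n)] (mod int q)"
      by (simp add: cong_minus_minus_iff) (simp add: cong_def)
    then have "[padic_gamma_nat p (Suc (n + q)) = padic_gamma_nat p (Suc n)] (mod int q)"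
      unfolding padic_gamma_nat_Suc using Suc.IH by (rule cong_mult)
    then show ?case by simp
  qed
  have "[padic_gamma_nat p (n + k * q) = padic_gamma_nat p n] (mod int q)" for n k
  proof (induction k)
    case (Suc k)
    have "[padic_gamma_nat p (n + k * q + q) = padic_gamma_nat p (n + k * q)] (mod int q)"
      by (rule period)
    with Suc show ?case by (metis (no_types, lifting) add.assoc add.commute cong_trans mult_Suc)
  qed simp
  then have *: "[padic_gamma_nat p n = padic_gamma_nat p (n mod q)] (mod int q)" for n
    by (metis mod_mult_div_eq mult.commute)
  show ?thesis using *[of m] *[of n] mn cong_trans cong_sym
    unfolding q_def[symmetric] cong_def[of m n] by (metis of_nat_power q_def)
qed simp

lemma prime_dvd_padic_of_nat_iff:
  "of_nat CARD('p) dvd (of_nat k :: 'p::prime_card padic_int) \<longleftrightarrow> CARD('p) dvd k"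
proof -
  have "of_nat CARD('p) dvd (of_nat k :: 'p padic_int) \<longleftrightarrow> int CARD('p) dvd int k"
    using prime_power_dvd_padic_of_int_iff[of 1 "int k", where 'p='p] by simp
  then show ?thesis by (simp only: int_dvd_int_iff)
qed

lemma dvd_diff_swap: "(a :: 'a::comm_ring_1) dvd x - y \<longleftrightarrow> a dvd y - x"
  by (metis dvd_minus_iff minus_diff_eq)

lemma padic_int_approx_nat:
  fixes x :: "'p::prime_card padic_int"
  obtains m where "m > 0" "of_nat CARD('p) ^ n dvd x - of_nat m"
proof
  let ?m = "nat (padic_residue x n) + CARD('p) ^ n"
  have nn: "padic_residue x n \<ge> 0" by (metis padic_residue_mod pos_mod_sign zero_less_card_finite of_nat_0_less_iff zero_less_power)
  show "?m > 0" by simp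
  show "of_nat CARD('p) ^ n dvd x - of_nat ?m"
    unfolding prime_power_dvd_padic_diff_iff padic_residue_of_nat using nn by simp
qed

text \<open>Evaluating \<open>padic_gamma_nat\<close> at the residues of \<open>x\<close> gives
  compatible residues, hence a function with the required properties. Two such functions agree on
  the naturals, which are dense, so the definite description denotes this one.\<close>

lemma padic_gamma_props:
  fixes x y :: "'p::prime_card padic_int"
  assumes odd: "odd CARD('p)"
  shows padic_gamma_of_nat: "padic_gamma (of_nat n :: 'p padic_int) = of_int (padic_gamma_nat CARD('p) n)"
    and padic_gamma_dvd_diff:
      "of_nat CARD('p) ^ n dvd x - y \<Longrightarrow> of_nat CARD('p) ^ n dvd padic_gamma x - padic_gamma y"
    and padic_gamma_unit: "padic_gamma x dvd 1"
proof -
  let ?p = "CARD('p)"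
  have p: "prime ?p" by (rule prime_card)
  define P where "P = (\<lambda>f :: 'p padic_int \<Rightarrow> 'p padic_int. continuous_on UNIV f \<and> (\<forall>x. f x dvd 1) \<and> f 0 = 1 \<and>
     (\<forall>n>0. f (of_nat n) = (- 1) ^ n * (\<Prod>j | 0 < j \<and> j < n \<and> \<not> CARD('p) dvd j. of_nat j)))"
  have Pval: "f (of_nat n) = of_int (padic_gamma_nat ?p n)" if "P f" for f n
    using that padic_gamma_nat_eq_prod_units[of n ?p] unfolding P_def by (cases "n = 0") auto
  have uniq: "f = g" if f: "P f" and g: "P g" for f g
  proof (rule ext, rule padic_int_eqI)
    fix x :: "'p padic_int" and n
    have "continuous_on UNIV f" "continuous_on UNIV g" using f g by (auto simp: P_def)
    then obtain k l where
      k: "\<And>y. of_nat ?p ^ k dvd y - x \<Longrightarrow> of_nat ?p ^ n dvd f y - f x" and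
      l: "\<And>y. of_nat ?p ^ l dvd y - x \<Longrightarrow> of_nat ?p ^ n dvd g y - g x"
      unfolding continuous_on_padic_iff by metis
    obtain m where m: "of_nat ?p ^ max k l dvd x - of_nat m" using padic_int_approx_nat by blast
    then have m: "of_nat ?p ^ max k l dvd of_nat m - x" by (subst dvd_diff_swap)
    have "of_nat ?p ^ n dvd f (of_nat m) - f x"
      by (rule k) (rule dvd_trans[OF _ m], simp add: le_imp_power_dvd)
    moreover have "of_nat ?p ^ n dvd g (of_nat m) - g x"
      by (rule l) (rule dvd_trans[OF _ m], simp add: le_imp_power_dvd)
    ultimately have "of_nat ?p ^ n dvd (g (of_nat m) - g x) - (f (of_nat m) - f x)" by (simp add: dvd_diff)
    then show "of_nat ?p ^ n dvd f x - g x" using Pval[OF f] Pval[OF g] by simp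
  qed
  define g where "g = (\<lambda>(x :: 'p padic_int) n. padic_gamma_nat ?p (nat (padic_residue x n)))"
  have nn: "padic_residue x n \<ge> 0" for x :: "'p padic_int" and n
    by (metis padic_residue_mod pos_mod_sign zero_less_card_finite of_nat_0_less_iff zero_less_power)
  have "[g x (Suc n) = g x n] (mod int ?p ^ n)" for x n
  proof -
    have "[padic_residue x (Suc n) = padic_residue x n] (mod int (?p ^ n))"
      by (simp add: cong_def padic_residue_Suc_mod)
    then have "[nat (padic_residue x (Suc n)) = nat (padic_residue x n)] (mod ?p ^ n)"
      using nn[of x n] nn[of x "Suc n"] by (metis cong_int_iff int_nat_eq)
    then show ?thesis unfolding g_def by (rule padic_gamma_nat_cong[OF p odd])
  qed
  then have "\<exists>z :: 'p padic_int. \<forall>n. padic_residue z n = g x n mod int ?p ^ n" for x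
    using padic_int_of_compatible_residues[of "g x"] by metis
  then obtain G :: "'p padic_int \<Rightarrow> 'p padic_int" where G: "\<And>x n. padic_residue (G x) n = g x n mod int ?p ^ n"
    by metis
  have G_lip: "of_nat ?p ^ n dvd G x - G y" if "of_nat ?p ^ n dvd x - y" for x y n
    using that by (simp add: prime_power_dvd_padic_diff_iff G g_def)
  have G_nat: "G (of_nat n) = of_int (padic_gamma_nat ?p n)" for n
  proof -
    have "[nat (int n mod int ?p ^ k) = n] (mod ?p ^ k)" for k
      by (metis cong_def mod_mod_trivial nat_int of_nat_mod of_nat_power)
    then have "[padic_gamma_nat ?p (nat (int n mod int ?p ^ k)) = padic_gamma_nat ?p n] (mod int ?p ^ k)" for k
      by (rule padic_gamma_nat_cong[OF p odd])
    then show ?thesis by (simp add: padic_int_eq_iff G g_def cong_def)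
  qed
  have "P G" unfolding P_def
  proof (intro conjI allI impI)
    show "continuous_on UNIV G" unfolding continuous_on_padic_iff using G_lip by blast
    show "G x dvd 1" for x
    proof (rule padic_unitI)
      obtain m where m: "of_nat ?p ^ 1 dvd x - of_nat m" using padic_int_approx_nat by blast
      have "\<not> int ?p dvd padic_gamma_nat ?p m"
        using padic_gamma_nat_coprime[OF p, of m] p by (metis coprime_commute coprime_absorb_left not_prime_unit prime_card_int)
      then have "\<not> of_nat ?p dvd (of_int (padic_gamma_nat ?p m) :: 'p padic_int)"
        using prime_power_dvd_padic_of_int_iff[of 1, where 'p='p] by simp
      then show "\<not> of_nat ?p dvd G x"
        using G_lip[OF m] G_nat[of m] by (metis dvd_diff_left_iff power_one_right dvd_minus_iff minus_diff_eq)
    qed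
    show "G 0 = 1" using G_nat[of 0] by simp
    show "G (of_nat n) = (- 1) ^ n * (\<Prod>j | 0 < j \<and> j < n \<and> \<not> ?p dvd j. of_nat j)" if "n > 0" for n
      using that by (simp add: G_nat padic_gamma_nat_eq_prod_units)
  qed
  moreover have "padic_gamma = (THE f. P f)" unfolding padic_gamma_def P_def ..
  ultimately have "padic_gamma = G" using uniq by (metis the_equality)
  with G_nat G_lip \<open>P G\<close>
  show "padic_gamma (of_nat n :: 'p padic_int) = of_int (padic_gamma_nat CARD('p) n)"
    and "of_nat CARD('p) ^ n dvd x - y \<Longrightarrow> of_nat CARD('p) ^ n dvd padic_gamma x - padic_gamma y"
    and "padic_gamma x dvd 1"
    by (auto simp: P_def)
qed

lemma padic_gamma_0 [simp]: "odd CARD('p) \<Longrightarrow> padic_gamma (0 :: 'p::prime_card padic_int) = 1"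
  using padic_gamma_of_nat[of 0, where 'p='p] by simp

lemma padic_gamma_plus1:
  fixes x :: "'p::prime_card padic_int"
  assumes odd: "odd CARD('p)"
  shows "padic_gamma (x + 1) = - (if of_nat CARD('p) dvd x then 1 else x) * padic_gamma x"
proof (rule padic_int_eqI)
  fix n
  let ?p = "of_nat CARD('p) :: 'p padic_int"
  \<comment> \<open>The precision is at least 1, so that \<open>p\<close> divides \<open>x\<close>
    exactly when it divides \<open>m\<close>.\<close>
  obtain m where m: "?p ^ Suc n dvd x - of_nat m" using padic_int_approx_nat by blast
  then have m1: "?p dvd x - of_nat m" and mn: "?p ^ n dvd x - of_nat m"
    by (metis dvd_mult_left power_Suc, metis dvd_mult_right power_Suc)
  define h where "h = (\<lambda>x. - (if ?p dvd x then 1 else x))"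
  have "?p dvd of_nat m \<longleftrightarrow> CARD('p) dvd m"
    by (rule prime_dvd_padic_of_nat_iff)
  then have h_nat: "padic_gamma (of_nat m + 1) = h (of_nat m) * padic_gamma (of_nat m)"
    using padic_gamma_of_nat[OF odd, of m] padic_gamma_of_nat[OF odd, of "Suc m"]
    by (simp add: h_def padic_gamma_nat_Suc add.commute)
  have "?p dvd x \<longleftrightarrow> ?p dvd of_nat m" using m1 by (metis dvd_diff_left_iff dvd_minus_iff minus_diff_eq)
  then have h: "?p ^ n dvd h x - h (of_nat m)"
    using mn by (auto simp: h_def dvd_diff_swap[of _ "of_nat m"])
  have "?p ^ n dvd padic_gamma (x + 1) - padic_gamma (of_nat m + 1)"
    by (rule padic_gamma_dvd_diff[OF odd]) (use mn in simp)
  moreover have "?p ^ n dvd h x * (padic_gamma x - padic_gamma (of_nat m))"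
    using padic_gamma_dvd_diff[OF odd mn] by (rule dvd_mult)
  moreover have "?p ^ n dvd (h x - h (of_nat m)) * padic_gamma (of_nat m)" using h by (rule dvd_mult2)
  ultimately have "?p ^ n dvd padic_gamma (x + 1) - padic_gamma (of_nat m + 1) -
    (h x * (padic_gamma x - padic_gamma (of_nat m)) + (h x - h (of_nat m)) * padic_gamma (of_nat m))"
    by (rule dvd_diff[OF _ dvd_add])
  then show "?p ^ n dvd padic_gamma (x + 1) - - (if ?p dvd x then 1 else x) * padic_gamma x"
    unfolding h_nat h_def[symmetric] by (simp add: algebra_simps h_def)
qed

text \<open>From \<open>k\<close> to \<open>k + 1\<close> the functional equations change the
  product by -1 if \<open>p\<close> does not divide \<open>k + 1\<close>, and not at all otherwise.
  The exponent is one more than the number of integers from 1 to \<open>k\<close> prime to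
  \<open>p\<close>.\<close>

lemma padic_gamma_reflection_nat:
  assumes odd: "odd CARD('p::prime_card)"
  shows "padic_gamma (- of_nat k) * padic_gamma (of_nat k + 1) = (- 1 :: 'p padic_int) ^ Suc (k - k div CARD('p))"
proof (induction k)
  case 0
  show ?case using odd padic_gamma_plus1[OF odd, of 0] by simp
next
  case (Suc k)
  let ?p = "of_nat CARD('p) :: 'p padic_int"
  let ?n = "of_nat (Suc k) :: 'p padic_int"
  have dvd: "?p dvd ?n \<longleftrightarrow> CARD('p) dvd Suc k"
    by (rule prime_dvd_padic_of_nat_iff)
  have eq: "- ?n + 1 = - of_nat k" by simp
  have 1: "padic_gamma (- of_nat k) = - (if CARD('p) dvd Suc k then 1 else - ?n) * padic_gamma (- ?n)"
    using padic_gamma_plus1[OF odd, of "- ?n"] by (simp only: eq dvd_minus_iff dvd)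
  have 2: "padic_gamma (?n + 1) = - (if CARD('p) dvd Suc k then 1 else ?n) * padic_gamma (of_nat k + 1)"
    using padic_gamma_plus1[OF odd, of ?n] dvd by (simp add: add.commute)
  have nz: "?n \<noteq> 0" by (simp only: of_nat_eq_0_iff)
  have le: "k div CARD('p) \<le> k" by simp
  show ?case
  proof (cases "CARD('p) dvd Suc k")
    case True
    then have "Suc k - Suc k div CARD('p) = k - k div CARD('p)"
      by (simp add: div_Suc dvd_eq_mod_eq_0)
    then show ?thesis using Suc.IH 1 2 True by simp
  next
    case False
    then have "Suc k - Suc k div CARD('p) = Suc (k - k div CARD('p))"
      using le by (simp add: div_Suc dvd_eq_mod_eq_0 Suc_diff_le)
    moreover have "?n * (padic_gamma (- ?n) * padic_gamma (?n + 1)) = ?n * - (padic_gamma (- of_nat k) * padic_gamma (of_nat k + 1))"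
    proof -
      have "n * (A * B) = n * - (C * D)" if "C = n * A" "B = - n * D" for n A B C D :: "'p padic_int"
        using that by (simp add: algebra_simps)
      then show ?thesis using 1 2 False by (simp only: if_False minus_minus)
    qed
    then have "padic_gamma (- ?n) * padic_gamma (?n + 1) = - (padic_gamma (- of_nat k) * padic_gamma (of_nat k + 1))"
      using nz by (metis mult_left_cancel)
    ultimately show ?thesis using Suc.IH by simp
  qed
qed

section \<open>The Teichmueller character\<close>

lemma dvd_power_diff: "(a :: 'a::comm_ring_1) dvd x - y \<Longrightarrow> a dvd x ^ n - y ^ n"
  by (subst power_diff_sumr2) (rule dvd_mult2)

text \<open>The cofactor of \<open>x - y\<close> in \<open>x ^ q - y ^ q\<close> is congruent to
  \<open>q * y ^ (q - 1)\<close> modulo \<open>q\<close>, so the power map gains one factor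
  \<open>q\<close>.\<close>

lemma power_prime_dvd_diff_step:
  fixes x y :: "'a::comm_ring_1"
  assumes "of_nat q dvd x - y" "of_nat q ^ n dvd x - y"
  shows "of_nat q ^ Suc n dvd x ^ q - y ^ q"
proof -
  have pow: "of_nat q dvd x ^ i - y ^ i" for i
    using assms(1) by (rule dvd_power_diff)
  have "of_nat q dvd (\<Sum>i<q. y ^ (q - Suc i) * x ^ i - y ^ (q - Suc i) * y ^ i)"
    unfolding right_diff_distrib[symmetric] by (intro dvd_sum dvd_mult pow)
  also have "(\<Sum>i<q. y ^ (q - Suc i) * x ^ i - y ^ (q - Suc i) * y ^ i) =
      (\<Sum>i<q. y ^ (q - Suc i) * x ^ i) - (\<Sum>i<q. y ^ (q - 1))"
    by (simp add: sum_subtractf flip: power_add)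
  finally have "of_nat q dvd (\<Sum>i<q. y ^ (q - Suc i) * x ^ i)"
    by (simp add: dvd_diff_left_iff)
  then have "of_nat q ^ n * of_nat q dvd (x - y) * (\<Sum>i<q. y ^ (q - Suc i) * x ^ i)"
    using assms(2) by (rule mult_dvd_mono[rotated])
  then show ?thesis by (simp add: power_diff_sumr2 mult.commute)
qed

lemma padic_reduce_eq_iff:
  fixes x y :: "'p::prime_card padic_int"
  shows "padic_reduce x = padic_reduce y \<longleftrightarrow> of_nat CARD('p) dvd x - y"
proof -
  have range: "0 \<le> padic_residue z 1" "padic_residue z 1 < int CARD('p)" for z :: "'p padic_int"
    using padic_residue_mod[of z 1] pos_mod_bound[of "int CARD('p)" "padic_residue z 1"]
      pos_mod_sign[of "int CARD('p)" "padic_residue z 1"] by simp_all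
  have "to_int_mod_ring (padic_reduce z) = padic_residue z 1" for z :: "'p padic_int"
    using range[of z] by (simp add: padic_reduce_def of_int_of_int_mod_ring)
  then have "padic_reduce x = padic_reduce y \<longleftrightarrow> padic_residue x 1 = padic_residue y 1"
    by (metis padic_reduce_def)
  then show ?thesis using prime_power_dvd_padic_diff_iff[of 1 x y] by simp
qed

lemma of_int_mod_card: "(of_int (k mod int CARD('p)) :: 'p::prime_card mod_ring) = of_int k"
proof -
  have "(of_int k :: 'p mod_ring) = of_int (k mod int CARD('p) + int CARD('p) * (k div int CARD('p)))"
    by simp
  then show ?thesis by (simp only: of_int_add of_int_mult of_int_of_nat_eq of_nat_card_eq_0) simp
qed

lemma padic_reduce_add [simp]: "padic_reduce (x + y) = padic_reduce x + padic_reduce y"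
  by (simp add: padic_reduce_def plus_padic_int.rep_eq of_int_mod_card)

lemma padic_reduce_mult [simp]: "padic_reduce (x * y) = padic_reduce x * padic_reduce y"
  by (simp add: padic_reduce_def times_padic_int.rep_eq of_int_mod_card)

lemma padic_reduce_of_int [simp]: "padic_reduce (of_int k) = of_int k"
  by (simp add: padic_reduce_def of_int_mod_card)

lemma padic_reduce_of_nat [simp]: "padic_reduce (of_nat k) = of_nat k"
  using padic_reduce_of_int[of "int k"] by simp

lemma padic_reduce_minus [simp]: "padic_reduce (- x) = - padic_reduce x"
  by (simp add: padic_reduce_def uminus_padic_int.rep_eq of_int_mod_card)

lemma padic_reduce_1 [simp]: "padic_reduce 1 = 1"
  using padic_reduce_of_int[of 1] by simp

lemma padic_reduce_0 [simp]: "padic_reduce 0 = 0"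
  using padic_reduce_of_int[of 0] by simp

lemma padic_reduce_power [simp]: "padic_reduce (x ^ n) = padic_reduce x ^ n"
  by (induction n) simp_all

lemma mod_ring_fermat:
  fixes t :: "'p::prime_card mod_ring"
  assumes "t \<noteq> 0"
  shows "t ^ (CARD('p) - 1) = 1"
proof -
  obtain k where k: "t = of_nat k" using surj_of_nat_mod_ring by blast
  have "\<not> CARD('p) dvd k"
  proof
    assume "CARD('p) dvd k"
    then have "t = 0" unfolding k by (auto simp: dvd_def)
    with assms show False by simp
  qed
  then have "[k ^ (CARD('p) - 1) = 1] (mod CARD('p))"
    using fermat_theorem[OF prime_card] by blast
  then have "[int k ^ (CARD('p) - 1) = 1] (mod int CARD('p))"
    by (metis cong_int_iff of_nat_1 of_nat_power)
  then have "(of_int (int k ^ (CARD('p) - 1)) :: 'p mod_ring) = of_int 1"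
    unfolding cong_def by (metis of_int_mod_card)
  then show ?thesis by (simp add: k)
qed

text \<open>Both elements are fixed by the \<open>p\<close>-th power map, which improves any
  congruence between them by one power of \<open>p\<close>.\<close>

lemma teichmuller_unique:
  fixes x y :: "'p::prime_card padic_int"
  assumes "x ^ (CARD('p) - 1) = 1" "y ^ (CARD('p) - 1) = 1" "padic_reduce x = padic_reduce y"
  shows "x = y"
proof (rule padic_int_eqI)
  fix n
  have pos: "Suc (CARD('p) - 1) = CARD('p)" by simp
  have xp: "x ^ CARD('p) = x" "y ^ CARD('p) = y"
    by (subst pos[symmetric], simp only: power_Suc assms mult_1_right)+
  have 1: "of_nat CARD('p) dvd x - y" using assms(3) padic_reduce_eq_iff by blast
  show "of_nat CARD('p) ^ n dvd x - y"
  proof (induction n)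
    case (Suc n)
    show ?case using power_prime_dvd_diff_step[OF 1 Suc] by (simp only: xp)
  qed simp
qed

text \<open>The root of unity is the limit of \<open>k ^ (p ^ n)\<close> for a natural number
  \<open>k\<close> in the class of \<open>t\<close>. Euler's theorem gives both the compatibility
  and the order of the limit.\<close>

lemma teichmuller_exists:
  fixes t :: "'p::prime_card mod_ring"
  assumes "t \<noteq> 0"
  obtains z where "z ^ (CARD('p) - 1) = 1" "padic_reduce z = t"
proof -
  let ?p = "CARD('p)"
  obtain k where k: "t = of_nat k" using surj_of_nat_mod_ring by blast
  have ndvd: "\<not> ?p dvd k" using assms unfolding k by (auto simp: dvd_def)
  have "coprime ?p k" using ndvd prime_card[where 'a='p] by (simp add: prime_imp_coprime)
  then have cop: "coprime k (?p ^ n)" for n by (simp add: coprime_commute)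
  have euler: "[int k ^ (?p ^ n * (?p - 1)) = 1] (mod int ?p ^ Suc n)" for n
  proof -
    have "totient (?p ^ Suc n) = ?p ^ n * (?p - 1)"
      using totient_prime_power_Suc[OF prime_card[where 'a='p], of n] by simp
    then have "[k ^ (?p ^ n * (?p - 1)) = 1] (mod ?p ^ Suc n)"
      using euler_theorem[OF cop, of "Suc n"] by simp
    then show ?thesis by (metis cong_int_iff of_nat_1 of_nat_power)
  qed
  have euler': "[int k ^ (?p ^ n * (?p - 1)) = 1] (mod int ?p ^ n)" for n
    using euler[of n] by (rule cong_dvd_modulus) simp
  have "[int k ^ ?p ^ Suc n = int k ^ ?p ^ n] (mod int ?p ^ n)" for n
  proof -
    have "?p ^ Suc n = ?p ^ n * (?p - 1) + ?p ^ n" by (simp add: algebra_simps)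
    then have "int k ^ ?p ^ Suc n = int k ^ (?p ^ n * (?p - 1)) * int k ^ ?p ^ n"
      by (simp only: power_add)
    also have "[\<dots> = 1 * int k ^ ?p ^ n] (mod int ?p ^ n)"
      using euler' by (rule cong_scalar_right)
    finally show ?thesis by simp
  qed
  then obtain z :: "'p padic_int" where z: "\<And>n. padic_residue z n = int k ^ ?p ^ n mod int ?p ^ n"
    using padic_int_of_compatible_residues[of "\<lambda>n. int k ^ ?p ^ n"] by blast
  have zn: "of_nat ?p ^ n dvd z - of_int (int k ^ ?p ^ n)" for n
    unfolding prime_power_dvd_padic_diff_iff padic_residue_of_int z ..
  have "z ^ (?p - 1) = 1"
  proof (rule padic_int_eqI)
    fix n
    have "of_nat ?p ^ n dvd z ^ (?p - 1) - of_int (int k ^ ?p ^ n) ^ (?p - 1)"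
      using zn by (rule dvd_power_diff)
    moreover have "of_nat ?p ^ n dvd (of_int (int k ^ ?p ^ n) ^ (?p - 1) - 1 :: 'p padic_int)"
    proof -
      have "int ?p ^ n dvd (int k ^ ?p ^ n) ^ (?p - 1) - 1"
        using euler'[of n] by (simp add: cong_iff_dvd_diff power_mult)
      then show ?thesis
        using prime_power_dvd_padic_of_int_iff[of n "(int k ^ ?p ^ n) ^ (?p - 1) - 1", where 'p='p] by simp
    qed
    ultimately have "of_nat ?p ^ n dvd (z ^ (?p - 1) - of_int (int k ^ ?p ^ n) ^ (?p - 1)) +
      (of_int (int k ^ ?p ^ n) ^ (?p - 1) - 1 :: 'p padic_int)" by (rule dvd_add)
    then show "of_nat ?p ^ n dvd z ^ (?p - 1) - 1" by simp
  qed
  moreover have "padic_reduce z = t"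
  proof -
    have "padic_reduce z = padic_reduce (of_int (int k ^ ?p))"
      unfolding padic_reduce_eq_iff using zn[of 1] by simp
    also have "\<dots> = t ^ ?p" by (simp add: k)
    also have "\<dots> = t ^ Suc (?p - 1)" by simp
    also have "\<dots> = t" by (simp only: power_Suc mod_ring_fermat[OF assms] mult_1_right)
    finally show ?thesis .
  qed
  ultimately show ?thesis by (rule that)
qed

lemma teichmuller_props:
  fixes t :: "'p::prime_card mod_ring"
  assumes "t \<noteq> 0"
  shows teichmuller_power: "teichmuller t ^ (CARD('p) - 1) = 1"
    and padic_reduce_teichmuller: "padic_reduce (teichmuller t) = t"
proof -
  have "\<exists>!z. z ^ (CARD('p) - 1) = 1 \<and> padic_reduce z = t"
    using teichmuller_exists[OF assms] teichmuller_unique by metis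
  from theI'[OF this] show "teichmuller t ^ (CARD('p) - 1) = 1" "padic_reduce (teichmuller t) = t"
    by (auto simp: teichmuller_def)
qed

lemma teichmuller_mult:
  fixes s t :: "'p::prime_card mod_ring"
  assumes "s \<noteq> 0" "t \<noteq> 0"
  shows "teichmuller (s * t) = teichmuller s * teichmuller t"
proof (rule teichmuller_unique)
  have st: "s * t \<noteq> 0" using assms by simp
  show "teichmuller (s * t) ^ (CARD('p) - 1) = 1" by (rule teichmuller_power[OF st])
  show "(teichmuller s * teichmuller t) ^ (CARD('p) - 1) = 1"
    by (simp only: power_mult_distrib teichmuller_power[OF assms(1)] teichmuller_power[OF assms(2)] mult_1_left)
  show "padic_reduce (teichmuller (s * t)) = padic_reduce (teichmuller s * teichmuller t)"
    by (simp only: padic_reduce_mult padic_reduce_teichmuller[OF assms(1)] padic_reduce_teichmuller[OF assms(2)]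
        padic_reduce_teichmuller[OF st])
qed

lemma teichmuller_1 [simp]: "teichmuller (1 :: 'p::prime_card mod_ring) = 1"
proof (rule teichmuller_unique)
  show "teichmuller (1 :: 'p mod_ring) ^ (CARD('p) - 1) = 1" by (rule teichmuller_power) simp
qed (simp_all add: padic_reduce_teichmuller)

lemma teichmuller_minus:
  fixes t :: "'p::prime_card mod_ring"
  assumes "odd CARD('p)" "t \<noteq> 0"
  shows "teichmuller (- t) = - teichmuller t"
proof -
  have "teichmuller (- 1 :: 'p mod_ring) = - 1"
  proof (rule teichmuller_unique)
    show "(- 1 :: 'p padic_int) ^ (CARD('p) - 1) = 1" using assms(1) by simp
    show "teichmuller (- 1 :: 'p mod_ring) ^ (CARD('p) - 1) = 1" by (rule teichmuller_power) simp
  qed (simp add: teichmuller_props)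
  then show ?thesis using teichmuller_mult[of "-1" t] assms(2) by simp
qed

lemma padic_int_of_rat_eqI:
  fixes z :: "'p::prime_card padic_int"
  assumes "b \<noteq> 0" "of_int b * z = of_int a" "r = of_int a / of_int b"
  shows "padic_int_of_rat r = z"
proof -
  obtain n d where nd: "quotient_of r = (n, d)" by (cases "quotient_of r")
  have d: "d > 0" "r = of_int n / of_int d"
    using quotient_of_denom_pos[OF nd] quotient_of_div[OF nd] by auto
  then have "of_int n * of_int b = (of_int a * of_int d :: rat)"
    using assms by (simp add: field_simps)
  then have "(of_int (n * b) :: rat) = of_int (a * d)" by simp
  then have eq: "n * b = a * d" by (simp only: of_int_eq_iff)
  have "of_int b * (of_int d * z) = of_int d * (of_int b * z)" by (simp only: mult.left_commute)
  also have "\<dots> = of_int (a * d)" unfolding assms(2) by (simp add: mult.commute)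
  also have "\<dots> = of_int b * of_int n" unfolding eq[symmetric] by (simp add: mult.commute)
  finally have dz: "of_int d * z = of_int n" using assms(1) by simp
  have "z' = z" if "of_int d * z' = of_int n" for z'
  proof -
    have "of_int d * z' = of_int d * z" using that dz by simp
    then show ?thesis using d(1) by simp
  qed
  with dz show ?thesis
    unfolding padic_int_of_rat_def nd fst_conv snd_conv by (rule the_equality)
qed

section \<open>Valuations and limits\<close>

text \<open>A lower bound for the valuation, real because the growth rates below are fractions. As a
  predicate it lets 0 satisfy every bound.\<close>

definition val_ge :: "real \<Rightarrow> 'p::prime_card padic \<Rightarrow> bool" where
  "val_ge r x \<longleftrightarrow> (\<exists>k z. r \<le> of_int k \<and> x = of_nat CARD('p) powi k * to_fract z)"

lemma val_ge_mono: "val_ge s x \<Longrightarrow> r \<le> s \<Longrightarrow> val_ge r x"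
  unfolding val_ge_def using order_trans by blast

lemma val_ge_0 [simp]: "val_ge r 0"
  unfolding val_ge_def by (rule exI[of _ "\<lceil>r\<rceil>"], rule exI[of _ 0]) (simp add: le_of_int_ceiling)

lemma val_ge_to_fract [simp]: "val_ge 0 (to_fract z)"
  unfolding val_ge_def by (rule exI[of _ 0], rule exI[of _ z]) simp

lemma val_ge_of_nat [simp]: "val_ge 0 (of_nat n)"
  using val_ge_to_fract[of "of_nat n"] by simp

lemma val_ge_of_int [simp]: "val_ge 0 (of_int n)"
  using val_ge_to_fract[of "of_int n"] by simp

lemma val_ge_1 [simp]: "val_ge 0 1"
  using val_ge_to_fract[of 1] by simp

lemma val_ge_mult:
  fixes x y :: "'p::prime_card padic"
  assumes "val_ge r x" "val_ge s y"
  shows "val_ge (r + s) (x * y)"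
proof -
  obtain k z where x: "r \<le> of_int k" "x = of_nat CARD('p) powi k * to_fract z"
    using assms(1) unfolding val_ge_def by blast
  obtain l w where y: "s \<le> of_int l" "y = of_nat CARD('p) powi l * to_fract w"
    using assms(2) unfolding val_ge_def by blast
  have "x * y = of_nat CARD('p) powi (k + l) * to_fract (z * w)"
    by (simp add: x y power_int_add)
  moreover have "r + s \<le> of_int (k + l)" using x y by simp
  ultimately show ?thesis unfolding val_ge_def by blast
qed

lemma val_ge_add:
  fixes x y :: "'p::prime_card padic"
  assumes "val_ge r x" "val_ge r y"
  shows "val_ge r (x + y)"
proof -
  have *: "val_ge r (x + y)" if "r \<le> of_int k" "x = of_nat CARD('p) powi k * to_fract z"
    "y = of_nat CARD('p) powi l * to_fract w" "k \<le> l" for x y :: "'p padic" and k l z w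
  proof -
    define d where "d = nat (l - k)"
    have "l = k + int d" using that by (simp add: d_def)
    then have "x + y = of_nat CARD('p) powi k * to_fract (z + of_nat CARD('p) ^ d * w)"
      by (simp add: that power_int_add algebra_simps)
    with that(1) show ?thesis unfolding val_ge_def by blast
  qed
  obtain k z where x: "r \<le> of_int k" "x = of_nat CARD('p) powi k * to_fract z"
    using assms(1) unfolding val_ge_def by blast
  obtain l w where y: "r \<le> of_int l" "y = of_nat CARD('p) powi l * to_fract w"
    using assms(2) unfolding val_ge_def by blast
  show ?thesis
    using *[OF x y(2)] *[OF y x(2)] by (cases "k \<le> l") (simp_all add: add.commute)
qed

lemma val_ge_mult_int: "val_ge r x \<Longrightarrow> val_ge 0 y \<Longrightarrow> val_ge r (x * y)"
  using val_ge_mult[of r x 0 y] by simp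

lemma val_ge_int_mult: "val_ge 0 x \<Longrightarrow> val_ge r y \<Longrightarrow> val_ge r (x * y)"
  using val_ge_mult[of 0 x r y] by simp

lemma val_ge_minus [simp]: "val_ge r (- x) \<longleftrightarrow> val_ge r (x :: 'a::prime_card padic)"
proof -
  have "val_ge 0 (- 1 :: 'a padic)" using val_ge_of_int[of "- 1"] by simp
  then have "val_ge r (- x)" if "val_ge r x" for x :: "'a padic"
    using val_ge_int_mult[of "- 1" r x] that by simp
  from this[of x] this[of "- x"] show ?thesis by auto
qed

lemma val_ge_diff: "val_ge r x \<Longrightarrow> val_ge r y \<Longrightarrow> val_ge r (x - y)"
  using val_ge_add[of r x "- y"] by simp

lemma val_ge_sum: "(\<And>i. i \<in> A \<Longrightarrow> val_ge r (f i)) \<Longrightarrow> val_ge r (sum f A)"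
  by (induction A rule: infinite_finite_induct) (auto intro: val_ge_add)

lemma val_ge_power: "val_ge r x \<Longrightarrow> val_ge (real n * r) (x ^ n)"
proof (induction n)
  case (Suc n)
  then show ?case using val_ge_mult[of r x "real n * r" "x ^ n"] by (simp add: algebra_simps)
qed simp

lemma val_ge_prime: "val_ge 1 (of_nat CARD('p) :: 'p::prime_card padic)"
  unfolding val_ge_def by (rule exI[of _ 1], rule exI[of _ 1]) simp

lemma val_ge_prime_power: "val_ge (real n) (of_nat CARD('p) ^ n :: 'p::prime_card padic)"
  using val_ge_power[OF val_ge_prime, of n] by simp

lemma val_ge_minus_prime_power: "val_ge (real n) ((- of_nat CARD('p)) ^ n :: 'p::prime_card padic)"
  using val_ge_power[of 1 "- of_nat CARD('p)" n] val_ge_prime[where 'p='p] by simp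

lemma val_ge_inverse_prime_power: "val_ge (- real n) (1 / of_nat CARD('p) ^ n :: 'p::prime_card padic)"
  unfolding val_ge_def
  by (rule exI[of _ "- int n"], rule exI[of _ 1]) (simp add: power_int_minus field_simps)

lemma val_ge_inverse_of_unit: "z dvd 1 \<Longrightarrow> val_ge 0 (1 / to_fract z)"
proof -
  assume "z dvd 1"
  then obtain w where w: "1 = z * w" by (auto simp: dvd_def)
  then have "to_fract z * to_fract w = 1" by (metis to_fract_1 to_fract_mult)
  then have "1 / to_fract z = to_fract w" by (metis divide_eq_eq mult.commute mult_zero_left zero_neq_one)
  then show "val_ge 0 (1 / to_fract z)" by simp
qed

lemma val_ge_to_fract_iff:
  fixes z :: "'p::prime_card padic_int"
  shows "val_ge (real n) (to_fract z) \<longleftrightarrow> of_nat CARD('p) ^ n dvd z"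
proof
  assume "val_ge (real n) (to_fract z)"
  then obtain k w where kw: "real n \<le> of_int k" "to_fract z = of_nat CARD('p) powi k * to_fract w"
    unfolding val_ge_def by blast
  have k: "k = int (nat k)" "n \<le> nat k" using kw(1) by linarith+
  have "to_fract z = of_nat CARD('p) powi int (nat k) * to_fract w" using kw(2) k(1) by simp
  also have "\<dots> = to_fract (of_nat CARD('p) ^ nat k * w)" by (simp only: power_int_of_nat) simp
  finally have "z = of_nat CARD('p) ^ nat k * w" by (simp only: to_fract_eq_iff)
  then show "of_nat CARD('p) ^ n dvd z" using k(2) by (simp add: le_imp_power_dvd dvd_mult2)
next
  assume "of_nat CARD('p) ^ n dvd z"
  then obtain w where "z = of_nat CARD('p) ^ n * w" by (auto simp: dvd_def)
  then show "val_ge (real n) (to_fract z)"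
    using val_ge_mult_int[OF val_ge_prime_power, of "to_fract w" n] by simp
qed

lemma padic_cases:
  fixes x :: "'p::prime_card padic"
  obtains a b where "b \<noteq> 0" "x = to_fract a / to_fract b"
  by (cases x) (auto simp: Fract_conv_to_fract)

lemma val_ge_imp_eq_0:
  fixes x :: "'p::prime_card padic"
  assumes "\<And>n. val_ge (real n) x"
  shows "x = 0"
proof -
  obtain a b where ab: "b \<noteq> 0" "x = to_fract a / to_fract b" by (rule padic_cases)
  have "val_ge (real n) (to_fract a)" for n
    using val_ge_mult_int[OF assms[of n], of "to_fract b"] ab by simp
  then have "a - 0 = 0" by (intro padic_int_eqI) (simp add: val_ge_to_fract_iff)
  then show ?thesis by (simp add: ab)
qed

text \<open>A nonzero denominator is a power of \<open>p\<close> times a unit, because only 0 is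
  divisible by all powers of \<open>p\<close>.\<close>

lemma val_ge_exists:
  fixes x :: "'p::prime_card padic"
  obtains r where "val_ge r x"
proof -
  obtain a b where ab: "b \<noteq> 0" "x = to_fract a / to_fract b" by (rule padic_cases)
  define P where "P = (\<lambda>n. of_nat CARD('p) ^ n dvd b)"
  obtain n where "\<not> P n" using ab(1) padic_int_eqI[of b 0] unfolding P_def by auto
  then have "\<exists>k. P k \<and> \<not> P (Suc k)"
    by (induction n) (auto simp: P_def)
  then obtain k where k: "P k" "\<not> P (Suc k)" by blast
  then obtain u where u: "b = of_nat CARD('p) ^ k * u" by (auto simp: P_def dvd_def)
  have "\<not> of_nat CARD('p) dvd u"
    using k(2) unfolding P_def u by (auto simp: mult.commute[of "of_nat CARD('p)"] intro: mult_dvd_mono)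
  then have "val_ge 0 (1 / to_fract u)" by (intro val_ge_inverse_of_unit padic_unitI)
  then have "val_ge (- real k) (to_fract a * (1 / of_nat CARD('p) ^ k * (1 / to_fract u)))"
    using val_ge_inverse_prime_power by (intro val_ge_int_mult val_ge_mult_int) auto
  also have "to_fract a * (1 / of_nat CARD('p) ^ k * (1 / to_fract u)) = x"
    unfolding ab u by simp
  finally show ?thesis by (rule that)
qed

section \<open>Limits in the field of p-adic numbers\<close>

definition padic_lim :: "(nat \<Rightarrow> 'p::prime_card padic) \<Rightarrow> 'p padic \<Rightarrow> bool" where
  "padic_lim X L \<longleftrightarrow> (\<forall>r. eventually (\<lambda>n. val_ge r (X n - L)) sequentially)"

lemma padic_lim_const [simp]: "padic_lim (\<lambda>_. x) x"
  by (simp add: padic_lim_def)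

lemma padic_lim_unique:
  assumes "padic_lim X L" "padic_lim X M"
  shows "L = M"
proof -
  have "val_ge (real n) (L - M)" for n
  proof -
    have "eventually (\<lambda>k. val_ge (real n) (X k - L) \<and> val_ge (real n) (X k - M)) sequentially"
      using assms unfolding padic_lim_def by (intro eventually_conj) auto
    then obtain k where "val_ge (real n) (X k - L)" "val_ge (real n) (X k - M)"
      by (auto simp: eventually_sequentially)
    then have "val_ge (real n) ((X k - M) - (X k - L))" using val_ge_diff by blast
    then show ?thesis by simp
  qed
  then show ?thesis using val_ge_imp_eq_0 by fastforce
qed

lemma padic_lim_add:
  assumes "padic_lim X L" "padic_lim Y M"
  shows "padic_lim (\<lambda>n. X n + Y n) (L + M)"
  unfolding padic_lim_def
proof
  fix r
  have "eventually (\<lambda>n. val_ge r (X n - L)) sequentially" "eventually (\<lambda>n. val_ge r (Y n - M)) sequentially"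
    using assms by (auto simp: padic_lim_def)
  then show "eventually (\<lambda>n. val_ge r (X n + Y n - (L + M))) sequentially"
  proof eventually_elim
    case (elim n)
    have "X n + Y n - (L + M) = (X n - L) + (Y n - M)" by simp
    with elim show ?case by (metis val_ge_add)
  qed
qed

lemma padic_lim_mult:
  assumes "padic_lim X L" "padic_lim Y M"
  shows "padic_lim (\<lambda>n. X n * Y n) (L * M)"
  unfolding padic_lim_def
proof
  fix r
  obtain a b where ab: "val_ge a L" "val_ge b M" by (meson val_ge_exists)
  have "eventually (\<lambda>n. val_ge (\<bar>r\<bar> + \<bar>b\<bar>) (X n - L)) sequentially"
    "eventually (\<lambda>n. val_ge (\<bar>r\<bar> + \<bar>a\<bar>) (Y n - M)) sequentially"
    using assms by (auto simp: padic_lim_def)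
  then show "eventually (\<lambda>n. val_ge r (X n * Y n - (L * M))) sequentially"
  proof eventually_elim
    case (elim n)
    have eq: "X n * Y n - L * M = (X n - L) * (Y n - M) + (L * (Y n - M) + (X n - L) * M)"
      by (simp add: algebra_simps)
    have "val_ge r ((X n - L) * (Y n - M))" "val_ge r (L * (Y n - M))" "val_ge r ((X n - L) * M)"
      using val_ge_mult[OF elim] val_ge_mult[OF ab(1) elim(2)] val_ge_mult[OF elim(1) ab(2)]
      by (auto elim!: val_ge_mono)
    then show ?case unfolding eq by (intro val_ge_add)
  qed
qed

lemma padic_lim_cmult: "padic_lim X L \<Longrightarrow> padic_lim (\<lambda>n. c * X n) (c * L)"
  by (rule padic_lim_mult[OF padic_lim_const])

lemma padic_lim_minus: "padic_lim X L \<Longrightarrow> padic_lim (\<lambda>n. - X n) (- L)"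
  using padic_lim_cmult[of X L "- 1"] by simp

lemma padic_lim_diff: "padic_lim X L \<Longrightarrow> padic_lim Y M \<Longrightarrow> padic_lim (\<lambda>n. X n - Y n) (L - M)"
  using padic_lim_add[OF _ padic_lim_minus, of X L Y M] by simp

lemma padic_lim_sum: "(\<And>i. i \<in> A \<Longrightarrow> padic_lim (X i) (L i)) \<Longrightarrow> padic_lim (\<lambda>n. \<Sum>i\<in>A. X i n) (\<Sum>i\<in>A. L i)"
  by (induction A rule: infinite_finite_induct) (auto intro: padic_lim_add)

lemma padic_lim_transform: "padic_lim X L \<Longrightarrow> padic_lim (\<lambda>n. X n - Y n) 0 \<Longrightarrow> padic_lim Y L"
  using padic_lim_diff[of X L "\<lambda>n. X n - Y n" 0] by simp

lemma padic_lim_0I: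
  assumes "\<And>n. val_ge (f n) (X n)" "filterlim f at_top sequentially"
  shows "padic_lim X 0"
  unfolding padic_lim_def
proof
  fix r
  have "eventually (\<lambda>n. r \<le> f n) sequentially" using assms(2) by (simp add: filterlim_at_top)
  then show "eventually (\<lambda>n. val_ge r (X n - 0)) sequentially"
    by eventually_elim (use assms(1) val_ge_mono in auto)
qed

lemma padic_lim_Suc: "padic_lim X L \<Longrightarrow> padic_lim (\<lambda>n. X (Suc n)) L"
  unfolding padic_lim_def
  by (auto intro!: eventually_sequentially_Suc[THEN iffD2])

text \<open>The multiples of \<open>p\<close> up to \<open>n\<close> contribute
  \<open>p ^ (n div p)\<close> and a smaller factorial; the other factors form a gamma value up to
  sign.\<close>

lemma fact_eq_padic_gamma_nat:
  assumes "p > 0"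
  shows "fact n = (- 1) ^ Suc n * int p ^ (n div p) * fact (n div p) * padic_gamma_nat p (Suc n)"
proof (induction n)
  case 0
  show ?case by (simp add: padic_gamma_nat_Suc)
next
  case (Suc n)
  show ?case
  proof (cases "p dvd Suc n")
    case True
    then have div: "Suc n div p = Suc (n div p)" by (simp add: div_Suc dvd_eq_mod_eq_0)
    then have "int (Suc n) = int p * int (Suc (n div p))"
      using True by (metis dvd_mult_div_cancel of_nat_mult)
    then have "(fact (Suc n) :: int) = int p * int (Suc (n div p)) * fact n" by simp
    then show ?thesis using True
      by (subst padic_gamma_nat_Suc) (simp add: div Suc.IH)
  next
    case False
    then have div: "Suc n div p = n div p" by (simp add: div_Suc dvd_eq_mod_eq_0)
    have "(fact (Suc n) :: int) = int (Suc n) * fact n" by simp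
    then show ?thesis using False
      by (subst padic_gamma_nat_Suc) (simp add: div Suc.IH algebra_simps)
  qed
qed

lemma padic_gamma_nat_unit: "(of_int (padic_gamma_nat CARD('p) n) :: 'p::prime_card padic_int) dvd 1"
proof (rule padic_unitI)
  have "\<not> int CARD('p) dvd padic_gamma_nat CARD('p) n"
    using padic_gamma_nat_coprime[OF prime_card[where 'a='p], of n] prime_card[where 'a='p]
    by (metis coprime_commute coprime_absorb_left not_prime_unit prime_card_int)
  then show "\<not> of_nat CARD('p) dvd (of_int (padic_gamma_nat CARD('p) n) :: 'p padic_int)"
    using prime_power_dvd_padic_of_int_iff[of 1, where 'p='p] by simp
qed

text \<open>Legendre's bound, by descent from \<open>n\<close> to \<open>n div p\<close> along the
  previous factorization, whose gamma factor is a unit.\<close>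

lemma val_ge_inverse_fact:
  assumes "n > 0"
  shows "val_ge (- (real n - 1) / (real CARD('p) - 1)) (1 / fact n :: 'p::prime_card padic)"
  using assms
proof (induction n rule: less_induct)
  case (less n)
  let ?p = "CARD('p)"
  define m where "m = n div ?p"
  define g where "g = padic_gamma_nat ?p (Suc n)"
  have p: "real ?p > 1" using nontriv[where 'a='p] by simp
  have g: "val_ge 0 (1 / of_int g :: 'p padic)"
    using val_ge_inverse_of_unit[OF padic_gamma_nat_unit[of "Suc n", where 'p='p]] by (simp add: g_def)
  have g0: "(of_int g :: 'p padic) \<noteq> 0"
    using padic_gamma_nat_unit[of "Suc n", where 'p='p] by (auto simp: g_def)
  have "(of_int (fact n) :: 'p padic) = of_int ((- 1) ^ Suc n * int ?p ^ m * fact m * g)"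
    unfolding m_def g_def by (subst fact_eq_padic_gamma_nat[of ?p]) simp_all
  then have "(fact n :: 'p padic) = (- 1) ^ Suc n * of_nat ?p ^ m * fact m * of_int g" by simp
  then have eq: "1 / fact n = (- 1) ^ Suc n * (1 / of_int g) * (1 / of_nat ?p ^ m * (1 / fact m) :: 'p padic)"
    using g0 by (simp add: field_simps flip: power_add)
  have s: "val_ge 0 ((- 1) ^ Suc n * (1 / of_int g) :: 'p padic)"
    using g val_ge_power[of 0 "- 1 :: 'p padic" "Suc n"] by (intro val_ge_mult_int) simp_all
  show ?case
  proof (cases "m = 0")
    case True
    then have "val_ge 0 (1 / fact n :: 'p padic)" unfolding eq using s by (simp add: val_ge_mult_int)
    then show ?thesis by (rule val_ge_mono) (use less.prems p in \<open>simp add: field_simps\<close>)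
  next
    case False
    then have "m < n" using nontriv[where 'a='p] less.prems unfolding m_def by simp
    then have "val_ge (- (real m - 1) / (real ?p - 1)) (1 / fact m :: 'p padic)"
      using False by (intro less.IH) auto
    from val_ge_mult[OF val_ge_inverse_prime_power this, of m]
    have v: "val_ge (- real m + - (real m - 1) / (real ?p - 1)) (1 / fact n :: 'p padic)"
      unfolding eq using val_ge_int_mult[OF s] by blast
    have "real m * real ?p \<le> real n"
      unfolding m_def by (metis div_times_less_eq_dividend of_nat_le_iff of_nat_mult)
    then have "- (real n - 1) / (real ?p - 1) \<le> (1 - real m * real ?p) / (real ?p - 1)"
      using p by (intro divide_right_mono) auto
    also have "\<dots> = - real m + - (real m - 1) / (real ?p - 1)"
      using p by (simp add: field_simps)
    finally have "- (real n - 1) / (real ?p - 1) \<le> - real m + - (real m - 1) / (real ?p - 1)" .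
    with v show ?thesis by (rule val_ge_mono)
  qed
qed

section \<open>Dwork series\<close>

primrec fdiff :: "nat \<Rightarrow> (nat \<Rightarrow> 'a::ab_group_add) \<Rightarrow> nat \<Rightarrow> 'a" where
  "fdiff 0 f = f"
| "fdiff (Suc k) f = fdiff k (\<lambda>m. f (Suc m) - f m)"

lemma fdiff_add: "fdiff k (\<lambda>m. f m + g m) m = fdiff k f m + fdiff k g m"
proof (induction k arbitrary: f g)
  case (Suc k)
  have "(\<lambda>m. f (Suc m) + g (Suc m) - (f m + g m)) = (\<lambda>m. (f (Suc m) - f m) + (g (Suc m) - g m))"
    by (simp add: algebra_simps)
  then show ?case using Suc by simp
qed simp

lemma fdiff_shift: "fdiff k (\<lambda>m. f (Suc m)) m = fdiff k f (Suc m)"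
  by (induction k arbitrary: f) simp_all

lemma fdiff_const: "k > 0 \<Longrightarrow> fdiff k (\<lambda>_. c) m = 0"
proof (induction k arbitrary: c)
  case (Suc k)
  then show ?case by (cases k) simp_all
qed simp

text \<open>By Pascal's rule, differencing a Newton series shifts its coefficients by one
  place.\<close>

lemma fdiff_newton:
  fixes c :: "nat \<Rightarrow> 'a::comm_ring_1"
  shows "fdiff k (\<lambda>m. \<Sum>i\<le>m. of_nat (m choose i) * c i) 0 = c k"
proof (induction k arbitrary: c)
  case (Suc k)
  have "(\<Sum>i\<le>Suc m. of_nat (Suc m choose i) * c i) - (\<Sum>i\<le>m. of_nat (m choose i) * c i) =
      (\<Sum>i\<le>m. of_nat (m choose i) * c (Suc i))" for m
  proof -
    have "(\<Sum>i\<le>Suc m. of_nat (Suc m choose i) * c i) =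
        c 0 + (\<Sum>i\<le>m. of_nat (Suc m choose Suc i) * c (Suc i))"
      by (subst sum.atMost_Suc_shift) simp
    also have "(\<Sum>i\<le>m. of_nat (Suc m choose Suc i) * c (Suc i)) =
        (\<Sum>i\<le>m. of_nat (m choose i) * c (Suc i)) + (\<Sum>i\<le>m. of_nat (m choose Suc i) * c (Suc i))"
      by (simp add: algebra_simps sum.distrib)
    also have "c 0 + ((\<Sum>i\<le>m. of_nat (m choose i) * c (Suc i)) + (\<Sum>i\<le>m. of_nat (m choose Suc i) * c (Suc i))) =
        (\<Sum>i\<le>m. of_nat (m choose i) * c (Suc i)) + (\<Sum>i\<le>Suc m. of_nat (m choose i) * c i)"
      by (subst sum.atMost_Suc_shift) simp
    also have "(\<Sum>i\<le>Suc m. of_nat (m choose i) * c i) = (\<Sum>i\<le>m. of_nat (m choose i) * c i)"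
      by (simp add: binomial_eq_0)
    finally show ?thesis by simp
  qed
  then show ?case using Suc[of "\<lambda>i. c (Suc i)"] by simp
qed simp

text \<open>Leibniz rule: the difference of a product is
  \<open>\<Delta>f(m) g(m + 1) + f(m) \<Delta>g(m)\<close>. The bounds depend on the order of the
  difference, so that factors of different growth can be combined.\<close>

lemma val_ge_fdiff_mult:
  fixes f g :: "nat \<Rightarrow> 'p::prime_card padic"
  assumes "\<And>j m. j \<le> k \<Longrightarrow> val_ge (\<alpha> j) (fdiff j f m)"
    and "\<And>j m. j \<le> k \<Longrightarrow> val_ge (\<beta> j) (fdiff j g m)"
    and "\<And>j. j \<le> k \<Longrightarrow> r \<le> \<alpha> j + \<beta> (k - j)"
  shows "val_ge r (fdiff k (\<lambda>m. f m * g m) m)"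
  using assms
proof (induction k arbitrary: f g \<alpha> \<beta> m)
  case 0
  then show ?case using val_ge_mult[of "\<alpha> 0" "f m" "\<beta> 0" "g m"] val_ge_mono by force
next
  case (Suc k)
  have eq: "f (Suc m) * g (Suc m) - f m * g m = (f (Suc m) - f m) * g (Suc m) + f m * (g (Suc m) - g m)" for m
    by (simp add: algebra_simps)
  have "val_ge r (fdiff k (\<lambda>m. (f (Suc m) - f m) * g (Suc m)) m)"
  proof (rule Suc.IH)
    show "val_ge (\<alpha> (Suc j)) (fdiff j (\<lambda>m. f (Suc m) - f m) m)" if "j \<le> k" for j m
      using Suc.prems(1)[of "Suc j" m] that by simp
    show "val_ge (\<beta> j) (fdiff j (\<lambda>m. g (Suc m)) m)" if "j \<le> k" for j m
      using Suc.prems(2)[of j "Suc m"] that by (simp add: fdiff_shift)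
    show "r \<le> \<alpha> (Suc j) + \<beta> (k - j)" if "j \<le> k" for j
      using Suc.prems(3)[of "Suc j"] that by simp
  qed
  moreover have "val_ge r (fdiff k (\<lambda>m. f m * (g (Suc m) - g m)) m)"
  proof (rule Suc.IH)
    show "val_ge (\<alpha> j) (fdiff j f m)" if "j \<le> k" for j m
      using Suc.prems(1)[of j m] that by simp
    show "val_ge (\<beta> (Suc j)) (fdiff j (\<lambda>m. g (Suc m) - g m) m)" if "j \<le> k" for j m
      using Suc.prems(2)[of "Suc j" m] that by simp
    show "r \<le> \<alpha> j + \<beta> (Suc (k - j))" if "j \<le> k" for j
      using Suc.prems(3)[of j] that by (simp add: Suc_diff_le)
  qed
  ultimately show ?case by (simp add: eq fdiff_add val_ge_add)
qed

lemma val_ge_fdiff_prod: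
  fixes f :: "'i \<Rightarrow> nat \<Rightarrow> 'p::prime_card padic"
  assumes "\<And>i j m. i \<in> A \<Longrightarrow> val_ge (real j) (fdiff j (f i) m)"
  shows "val_ge (real k) (fdiff k (\<lambda>m. \<Prod>i\<in>A. f i m) m)"
  using assms
proof (induction A arbitrary: k m rule: infinite_finite_induct)
  case (insert i A)
  have "val_ge (real k) (fdiff k (\<lambda>m. f i m * (\<Prod>i\<in>A. f i m)) m)"
    by (rule val_ge_fdiff_mult[where \<alpha> = real and \<beta> = real]) (use insert in auto)
  then show ?case using insert by simp
next
  case (infinite A)
  then show ?case by (cases "k = 0") (simp_all add: fdiff_const)
next
  case empty
  show ?case by (cases "k = 0") (simp_all add: fdiff_const)
qed

text \<open>With \<open>Y = \<pi> X\<close> and \<open>\<pi> ^ (p - 1) = - p\<close> this is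
  \<open>\<pi> (X - X ^ p)\<close>, the exponent of Dwork's splitting function; in the variable
  \<open>Y\<close> its coefficients lie in the base field.\<close>

definition dwork_arg :: "'p::prime_card padic fps" where
  "dwork_arg = fps_X + fps_const (1 / of_nat CARD('p)) * fps_X ^ CARD('p)"

definition dwork_exp :: "'p::prime_card padic \<Rightarrow> 'p padic fps" where
  "dwork_exp v = fps_exp v oo dwork_arg"

abbreviation dwork_coeff :: "nat \<Rightarrow> 'p::prime_card padic" where
  "dwork_coeff n \<equiv> fps_nth (dwork_exp 1) n"

lemma dwork_arg_nth_0 [simp]: "fps_nth (dwork_arg :: 'p::prime_card padic fps) 0 = 0"
  by (simp add: dwork_arg_def)

lemma dwork_arg_nth:
  "fps_nth (dwork_arg :: 'p::prime_card padic fps) n =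
    (if n = 1 then 1 else 0) + (if n = CARD('p) then 1 / of_nat CARD('p) else 0)"
  by (simp add: dwork_arg_def fps_X_power_nth)

lemma dwork_arg_mult_nth:
  fixes F :: "'p::prime_card padic fps"
  shows "fps_nth (dwork_arg * F) n = (if n = 0 then 0 else fps_nth F (n - 1)) +
    (if n < CARD('p) then 0 else fps_nth F (n - CARD('p)) / of_nat CARD('p))"
proof -
  have "dwork_arg * F = fps_X * F + fps_const (1 / of_nat CARD('p)) * (fps_X ^ CARD('p) * F)"
    by (simp add: dwork_arg_def algebra_simps)
  then show ?thesis by (simp add: fps_X_power_mult_nth)
qed

lemma dwork_exp_add: "dwork_exp (v + w) = dwork_exp v * dwork_exp w"
  by (simp add: dwork_exp_def fps_exp_add_mult fps_compose_mult_distrib)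

lemma dwork_exp_nth_0 [simp]: "fps_nth (dwork_exp v) 0 = 1"
  by (simp add: dwork_exp_def)

lemma fps_deriv_dwork_arg:
  "fps_deriv (dwork_arg :: 'p::prime_card padic fps) = 1 + fps_X ^ (CARD('p) - 1)"
proof -
  have "fps_const (1 / of_nat CARD('p)) * (of_nat CARD('p) :: 'p padic fps) = 1"
    by (simp add: fps_of_nat[symmetric] del: fps_of_nat)
  then show ?thesis
    by (simp add: dwork_arg_def fps_deriv_power mult.assoc[symmetric])
qed

lemma fps_deriv_dwork_exp:
  fixes v :: "'p::prime_card padic"
  shows "fps_deriv (dwork_exp v) = fps_const v * dwork_exp v * (1 + fps_X ^ (CARD('p) - 1))"
  by (simp add: dwork_exp_def fps_compose_deriv fps_deriv_dwork_arg fps_compose_mult_distrib)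

text \<open>Compare coefficients of \<open>Y ^ (n - 1)\<close> in the differential equation
  \<open>E' = (1 + Y ^ (p - 1)) E\<close>.\<close>

lemma dwork_coeff_rec:
  assumes "n \<ge> CARD('p)"
  shows "of_nat n * dwork_coeff n = dwork_coeff (n - 1) + (dwork_coeff (n - CARD('p)) :: 'p::prime_card padic)"
proof -
  define m where "m = n - 1"
  have n: "n = Suc m" using assms zero_less_card_finite[where 'a='p] unfolding m_def by linarith
  have "fps_nth (fps_deriv (dwork_exp (1 :: 'p padic))) m = fps_nth (dwork_exp 1 + fps_X ^ (CARD('p) - 1) * dwork_exp 1) m"
    by (simp add: fps_deriv_dwork_exp algebra_simps)
  moreover have "m - (CARD('p) - 1) = n - CARD('p)" "\<not> m < CARD('p) - 1" using assms n by auto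
  ultimately show ?thesis by (simp add: fps_X_power_mult_nth n del: of_nat_Suc)
qed

text \<open>If \<open>u ^ p = u\<close>, replacing \<open>Y\<close> by \<open>u Y\<close> multiplies
  \<open>dwork_arg\<close> by \<open>u\<close>.\<close>

lemma dwork_exp_nth_root_of_unity:
  fixes u :: "'p::prime_card padic"
  assumes "u ^ CARD('p) = u"
  shows "fps_nth (dwork_exp u) n = u ^ n * dwork_coeff n"
proof -
  have "dwork_arg oo (fps_const u * fps_X) = fps_const u * dwork_arg"
    unfolding fps_compose_linear using assms by (auto simp: fps_eq_iff dwork_arg_nth)
  then have "dwork_exp 1 oo (fps_const u * fps_X) = fps_exp 1 oo (fps_const u * dwork_arg)"
    unfolding dwork_exp_def by (subst fps_compose_assoc[symmetric]) simp_all
  also have "fps_const u * dwork_arg = (fps_const u * fps_X) oo dwork_arg"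
    by (simp add: fps_compose_mult_distrib)
  also have "fps_exp 1 oo \<dots> = dwork_exp u"
    unfolding dwork_exp_def by (subst fps_compose_assoc) simp_all
  finally have eq: "dwork_exp 1 oo (fps_const u * fps_X) = dwork_exp u" .
  show ?thesis unfolding eq[symmetric] fps_compose_linear by simp
qed

text \<open>The second factor \<open>exp (- Y ^ p / p)\<close> cancels part of the exponent; both
  sides solve \<open>F' = F\<close> with constant term 1.\<close>

lemma fps_exp_eq_dwork_exp_mult:
  "fps_exp 1 = dwork_exp 1 * (fps_exp (- 1 / of_nat CARD('p)) oo fps_X ^ CARD('p) :: 'p::prime_card padic fps)"
proof -
  let ?p = "of_nat CARD('p) :: 'p padic"
  define W where "W = fps_exp (- 1 / ?p) oo fps_X ^ CARD('p)"
  have X0: "fps_nth (fps_X ^ CARD('p) :: 'p padic fps) 0 = 0" by (simp add: fps_X_power_nth)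
  have "fps_deriv W = (fps_const (- 1 / ?p) * fps_exp (- 1 / ?p) oo fps_X ^ CARD('p)) * fps_deriv (fps_X ^ CARD('p))"
    unfolding W_def by (subst fps_compose_deriv[OF X0]) simp
  also have "\<dots> = (fps_const (- 1 / ?p) * W) * (fps_const ?p * fps_X ^ (CARD('p) - 1))"
    unfolding W_def by (subst fps_compose_mult_distrib[OF X0]) (simp add: fps_deriv_power fps_of_nat)
  also have "\<dots> = (fps_const (- 1 / ?p) * fps_const ?p) * (W * fps_X ^ (CARD('p) - 1))"
    by (simp only: mult_ac)
  also have "fps_const (- 1 / ?p) * fps_const ?p = - 1"
    by (simp only: fps_const_mult) simp
  finally have W: "fps_deriv W = - (W * fps_X ^ (CARD('p) - 1))" by simp
  have "fps_deriv (dwork_exp 1 * W) = fps_const 1 * (dwork_exp 1 * W)"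
    by (simp add: W fps_deriv_dwork_exp algebra_simps)
  then have "dwork_exp 1 * W = fps_const (fps_nth (dwork_exp 1 * W) 0) * fps_exp 1"
    by (simp only: fps_exp_unique_ODE)
  then show ?thesis by (simp add: W_def)
qed

lemma fdiff_minus: "fdiff k (\<lambda>m. - f m) m = - fdiff k f m"
proof (induction k arbitrary: f)
  case (Suc k)
  have "(\<lambda>m. - f (Suc m) - - f m) = (\<lambda>m. - (f (Suc m) - f m))" by simp
  then show ?case using Suc by (simp only: fdiff.simps)
qed simp

lemma padic_gamma_nat_add:
  "padic_gamma_nat p (n + k) = padic_gamma_nat p n * (\<Prod>i<k. - (if p dvd n + i then 1 else int (n + i)))"
  by (induction k) (simp_all add: padic_gamma_nat_Suc)

lemma fps_exp_compose_X_power_nth: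
  fixes c :: "'a::field_char_0"
  assumes "q > 0"
  shows "fps_nth (fps_exp c oo fps_X ^ q) n = (if q dvd n then c ^ (n div q) / fact (n div q) else 0)"
proof -
  have "fps_nth (fps_exp c oo fps_X ^ q) n = (\<Sum>i = 0..n. c ^ i / fact i * (if n = q * i then 1 else 0))"
    by (simp add: fps_compose_nth fps_X_power_nth flip: power_mult)
  also have "\<dots> = (if q dvd n then c ^ (n div q) / fact (n div q) else 0)"
  proof (cases "q dvd n")
    case True
    have "(n = q * i) = (i = n div q)" for i using True assms by auto
    then have "(\<Sum>i = 0..n. c ^ i / fact i * (if n = q * i then 1 else 0)) =
        (\<Sum>i = 0..n. if i = n div q then c ^ i / fact i else 0)"
      by (intro sum.cong) auto
    then show ?thesis using True by simp
  next
    case False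
    then show ?thesis by (auto intro!: sum.neutral)
  qed
  finally show ?thesis .
qed

text \<open>Compare coefficients of degree \<open>a + p m\<close> in the factorization of
  \<open>exp Y\<close>. The second factor is a series in \<open>Y ^ p\<close>, so the first
  contributes only degrees congruent to \<open>a\<close>.\<close>

lemma inverse_fact_eq_dwork_sum:
  assumes a: "a < CARD('p)"
  shows "1 / fact (a + CARD('p) * m) = (\<Sum>k\<le>m. dwork_coeff (a + CARD('p) * k) *
    ((- 1 / of_nat CARD('p)) ^ (m - k) / fact (m - k)) :: 'p::prime_card padic)"
proof -
  let ?p = "CARD('p)"
  let ?n = "a + ?p * m"
  define W where "W = (fps_exp (- 1 / of_nat ?p) oo fps_X ^ ?p :: 'p padic fps)"
  have W: "fps_nth W n = (if ?p dvd n then (- 1 / of_nat ?p) ^ (n div ?p) / fact (n div ?p) else 0)" for n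
    unfolding W_def by (rule fps_exp_compose_X_power_nth) simp
  have "1 / fact ?n = fps_nth (fps_exp (1 :: 'p padic)) ?n" by simp
  also have "\<dots> = (\<Sum>i = 0..?n. dwork_coeff i * fps_nth W (?n - i))"
    by (subst fps_exp_eq_dwork_exp_mult) (simp add: fps_mult_nth W_def)
  also have "\<dots> = (\<Sum>i\<in>(\<lambda>k. a + ?p * k) ` {..m}. dwork_coeff i * fps_nth W (?n - i))"
  proof (rule sum.mono_neutral_right)
    show "\<forall>i\<in>{0..?n} - (\<lambda>k. a + ?p * k) ` {..m}. dwork_coeff i * fps_nth W (?n - i) = 0"
    proof
      fix i assume i: "i \<in> {0..?n} - (\<lambda>k. a + ?p * k) ` {..m}"
      have "\<not> ?p dvd ?n - i"
      proof
        assume "?p dvd ?n - i"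
        then obtain l where l: "?n - i = ?p * l" by (auto simp: dvd_def)
        then have *: "a + ?p * m = i + ?p * l" using i by auto
        have "l \<le> m"
        proof (rule ccontr)
          assume "\<not> l \<le> m"
          then have "?p * Suc m \<le> ?p * l" by (intro mult_le_mono2) simp
          then show False using * a by simp
        qed
        then have "i = a + ?p * (m - l)" using * by (simp add: diff_mult_distrib2)
        then show False using i by auto
      qed
      then show "dwork_coeff i * fps_nth W (?n - i) = 0" by (simp add: W)
    qed
  qed auto
  also have "\<dots> = (\<Sum>k\<le>m. dwork_coeff (a + ?p * k) * fps_nth W (?n - (a + ?p * k)))"
    by (subst sum.reindex) (auto simp: inj_on_def)
  also have "\<dots> = (\<Sum>k\<le>m. dwork_coeff (a + ?p * k) * ((- 1 / of_nat ?p) ^ (m - k) / fact (m - k)))"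
  proof (rule sum.cong[OF refl])
    fix k
    have "?n - (a + ?p * k) = ?p * (m - k)" by (simp add: diff_mult_distrib2)
    then show "dwork_coeff (a + ?p * k) * fps_nth W (?n - (a + ?p * k)) =
      dwork_coeff (a + ?p * k) * ((- 1 / of_nat ?p) ^ (m - k) / fact (m - k))" by (simp add: W)
  qed
  finally show ?thesis .
qed

text \<open>For \<open>a < p\<close> the powers of \<open>p\<close> in numerator and denominator
  cancel, so the values are units and can be interpolated in \<open>m\<close>.\<close>

definition dwork_quot :: "nat \<Rightarrow> nat \<Rightarrow> 'p::prime_card padic" where
  "dwork_quot a m = (- of_nat CARD('p)) ^ m * fact m / fact (a + CARD('p) * m)"

text \<open>Multiplying the expansion of \<open>1 / fact (a + p m)\<close> by
  \<open>(- p) ^ m * fact m\<close> gives a Newton series in \<open>m\<close>, since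
  \<open>fact m / fact (m - k)\<close> is a binomial coefficient times
  \<open>fact k\<close>.\<close>

lemma dwork_quot_eq_sum:
  assumes a: "a < CARD('p)"
  shows "dwork_quot a m = (\<Sum>k\<le>m. of_nat (m choose k) *
    ((- of_nat CARD('p)) ^ k * fact k * dwork_coeff (a + CARD('p) * k)) :: 'p::prime_card padic)"
proof -
  let ?q = "- of_nat CARD('p) :: 'p padic"
  have "dwork_quot a m = ?q ^ m * fact m * (1 / fact (a + CARD('p) * m))"
    by (simp add: dwork_quot_def)
  also have "\<dots> = (\<Sum>k\<le>m. ?q ^ m * fact m * (dwork_coeff (a + CARD('p) * k) *
    ((- 1 / of_nat CARD('p)) ^ (m - k) / fact (m - k))))"
    by (subst inverse_fact_eq_dwork_sum[OF a]) (rule sum_distrib_left)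
  also have "\<dots> = (\<Sum>k\<le>m. of_nat (m choose k) * (?q ^ k * fact k * dwork_coeff (a + CARD('p) * k)))"
  proof (rule sum.cong[OF refl])
    fix k assume "k \<in> {..m}"
    then have k: "k \<le> m" by simp
    have "(- 1 / of_nat CARD('p) :: 'p padic) = 1 / ?q" by simp
    then have "?q ^ m * (- 1 / of_nat CARD('p)) ^ (m - k) = ?q ^ k * (?q ^ (m - k) * (1 / ?q) ^ (m - k))"
      using k by (simp only: power_add[symmetric] mult.assoc[symmetric]) simp
    also have "?q ^ (m - k) * (1 / ?q) ^ (m - k) = 1"
      by (simp only: power_mult_distrib[symmetric]) simp
    finally have 1: "?q ^ m * (- 1 / of_nat CARD('p)) ^ (m - k) = ?q ^ k" by simp
    have 2: "(of_nat (m choose k) * fact k :: 'p padic) = fact m / fact (m - k)"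
      using binomial_fact[OF k, where 'a="'p padic"] by simp
    have "?q ^ m * fact m * (dwork_coeff (a + CARD('p) * k) * ((- 1 / of_nat CARD('p)) ^ (m - k) / fact (m - k)))
      = (?q ^ m * (- 1 / of_nat CARD('p)) ^ (m - k)) * (fact m / fact (m - k)) * dwork_coeff (a + CARD('p) * k)"
      by (simp only: times_divide_eq_left times_divide_eq_right mult_ac)
    also have "\<dots> = ?q ^ k * (of_nat (m choose k) * fact k) * dwork_coeff (a + CARD('p) * k)"
      by (simp only: 1 2)
    finally show "?q ^ m * fact m * (dwork_coeff (a + CARD('p) * k) * ((- 1 / of_nat CARD('p)) ^ (m - k) / fact (m - k)))
      = of_nat (m choose k) * (?q ^ k * fact k * dwork_coeff (a + CARD('p) * k))"
      by (simp only: mult_ac)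
  qed
  finally show ?thesis .
qed

text \<open>As \<open>(a + p m) div p = m\<close>, the factorization of the factorial cancels
  \<open>p ^ m * fact m\<close>. For odd \<open>p\<close> the signs leave only the parity of
  \<open>a + 1\<close>.\<close>

lemma dwork_quot_eq_gamma:
  assumes "odd CARD('p)" "a < CARD('p)"
  shows "dwork_quot a m = ((- 1) ^ Suc a / of_int (padic_gamma_nat CARD('p) (Suc (a + CARD('p) * m))) :: 'p::prime_card padic)"
proof -
  let ?p = "CARD('p)"
  let ?n = "a + ?p * m"
  let ?g = "padic_gamma_nat ?p (Suc ?n)"
  have div: "?n div ?p = m" using assms(2) by simp
  have g0: "(of_int ?g :: 'p padic) \<noteq> 0"
    using padic_gamma_nat_coprime[OF prime_card[where 'a='p], of "Suc ?n"] prime_card_int[where 'a='p]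
    by (auto simp: prime_int_iff)
  have "(of_int (fact ?n) :: 'p padic) = of_int ((- 1) ^ Suc ?n * int ?p ^ m * fact m * ?g)"
    by (subst fact_eq_padic_gamma_nat[of ?p]) (simp_all only: div zero_less_card_finite)
  then have fact: "(fact ?n :: 'p padic) = (- 1) ^ Suc ?n * of_nat ?p ^ m * fact m * of_int ?g" by simp
  have sgn: "((- 1) ^ Suc ?n :: 'p padic) = (- 1) ^ Suc a * (- 1) ^ m"
    using assms(1) by (auto simp: minus_one_power_iff)
  show ?thesis
    unfolding dwork_quot_def fact sgn using g0
    by (cases "even a"; cases "even m") (simp_all add: power_minus[of "of_nat ?p"])
qed

text \<open>
  Consecutive values of \<open>dwork_quot a\<close> have a quotient \<open>R(m)\<close> that is \<open>1\<close> modulo \<open>p\<close> by Wilson's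
  theorem and is a polynomial in \<open>pm\<close>. Hence each difference gains a factor \<open>p\<close> on average every
  other step.
\<close>

lemma val_ge_fdiff_dwork_quot:
  assumes odd: "odd CARD('p)" and a: "a < CARD('p)"
  shows "val_ge (real k / 2) (fdiff k (dwork_quot a) m :: 'p::prime_card padic)"
proof (induction k arbitrary: m rule: less_induct)
  case (less k)
  let ?p = "CARD('p)"
  let ?f = "dwork_quot a :: nat \<Rightarrow> 'p padic"
  define u where "u = (\<lambda>i m. - (if ?p dvd Suc (a + ?p * m) + i then 1 else int (Suc (a + ?p * m) + i)))"
  define R where "R = (\<lambda>m. \<Prod>i<?p. of_int (u i m) :: 'p padic)"
  let ?g = "\<lambda>m. padic_gamma_nat ?p (Suc (a + ?p * m))"
  have gR: "?g (Suc m) = ?g m * (\<Prod>i<?p. u i m)" for m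
    using padic_gamma_nat_add[of ?p "Suc (a + ?p * m)" ?p] by (simp add: u_def algebra_simps)
  have g0: "(of_int (?g m) :: 'p padic) \<noteq> 0" for m
    using padic_gamma_nat_coprime[OF prime_card[where 'a='p], of "Suc (a + ?p * m)"] prime_card_int[where 'a='p]
    by (auto simp: prime_int_iff)
  have R: "of_int (?g (Suc m)) = of_int (?g m) * R m" for m
    unfolding gR R_def by simp
  have fR: "?f m = ?f (Suc m) * R m" for m
    using g0[of "Suc m"] unfolding dwork_quot_eq_gamma[OF odd a] R by simp
  have R1: "val_ge 1 (R m - 1)" for m
  proof -
    have "[?g (Suc m) = ?g m] (mod int ?p ^ 1)"
    proof (rule padic_gamma_nat_cong[OF prime_card odd])
      have "Suc (a + ?p * Suc m) = Suc (a + ?p * m) + ?p" by simp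
      then show "[Suc (a + ?p * Suc m) = Suc (a + ?p * m)] (mod ?p ^ 1)"
        by (simp only: cong_def power_one_right mod_add_self2)
    qed
    then have "int ?p dvd ?g m * ((\<Prod>i<?p. u i m) - 1)"
      unfolding cong_iff_dvd_diff gR right_diff_distrib by simp
    moreover have "coprime (int ?p) (?g m)"
      using padic_gamma_nat_coprime[OF prime_card[where 'a='p]] by (simp add: coprime_commute)
    ultimately have "int ?p dvd (\<Prod>i<?p. u i m) - 1"
      by (simp only: coprime_dvd_mult_right_iff)
    then obtain w where "(\<Prod>i<?p. u i m) - 1 = int ?p * w" by (auto simp: dvd_def)
    from arg_cong[OF this, of "of_int :: int \<Rightarrow> 'p padic"] have "R m - 1 = of_nat ?p * of_int w"
      unfolding R_def by simp
    then show ?thesis by (simp add: val_ge_mult_int val_ge_prime)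
  qed
  have Rk: "val_ge (real j) (fdiff j R m)" for j m
    unfolding R_def
  proof (rule val_ge_fdiff_prod)
    fix i j m
    have dvd: "?p dvd Suc (a + ?p * m) + i \<longleftrightarrow> ?p dvd Suc (a + i)" for m
    proof -
      have "Suc (a + ?p * m) + i = ?p * m + Suc (a + i)" by simp
      then show ?thesis by (simp only: dvd_add_right_iff[OF dvd_triv_left])
    qed
    have ui: "u i m = - (if ?p dvd Suc (a + i) then 1 else int (Suc (a + ?p * m) + i))" for m
      unfolding u_def dvd ..
    show "val_ge (real j) (fdiff j (\<lambda>m. of_int (u i m) :: 'p padic) m)"
    proof (cases "j = 0 \<or> ?p dvd Suc (a + i)")
      case True
      then show ?thesis by (cases "j = 0") (auto simp: ui fdiff_const)
    next
      case False
      then obtain l where j: "j = Suc l" by (cases j) auto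
      have eq: "(\<lambda>m. of_int (u i (Suc m)) - of_int (u i m) :: 'p padic) = (\<lambda>_. - of_nat ?p)"
        using False by (auto simp: ui fun_eq_iff)
      show ?thesis
        by (cases "l = 0") (simp_all add: j eq fdiff_const val_ge_prime)
    qed
  qed
  show ?case
  proof (cases k)
    case 0
    have "val_ge 0 (1 / of_int (?g m) :: 'p padic)"
      using val_ge_inverse_of_unit[OF padic_gamma_nat_unit[where 'p='p]] by simp
    then have "val_ge 0 ((- 1) ^ Suc a * (1 / of_int (?g m)) :: 'p padic)"
      using val_ge_power[of 0 "- 1 :: 'p padic" "Suc a"] by (intro val_ge_int_mult) simp_all
    then show ?thesis using 0 by (simp add: dwork_quot_eq_gamma[OF odd a])
  next
    case (Suc l)
    have eq: "(\<lambda>m. ?f (Suc m) - ?f m) = (\<lambda>m. - (?f (Suc m) * (R m + - 1)))"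
      by (rule ext, subst (2) fR) (simp add: algebra_simps)
    have "val_ge (real k / 2) (fdiff l (\<lambda>m. ?f (Suc m) * (R m + - 1)) m)"
    proof (rule val_ge_fdiff_mult)
      show "val_ge (real j / 2) (fdiff j (\<lambda>m. ?f (Suc m)) m)" if "j \<le> l" for j m
        unfolding fdiff_shift by (rule less.IH) (use that Suc in simp)
      \<comment> \<open>Order 0 gains one factor \<open>p\<close> because \<open>R\<close> is 1
        modulo \<open>p\<close>, order \<open>j > 0\<close> gains \<open>j\<close> factors; either
        way the half needed for the extra difference is covered.\<close>
      show "val_ge (max 1 (real j)) (fdiff j (\<lambda>m. R m + - 1) m)" for j m
      proof (cases "j = 0")
        case True
        then show ?thesis using R1[of m] by simp
      next
        case False
        then have "max 1 (real j) = real j" by simp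
        moreover have "fdiff j (\<lambda>m. R m + - 1) m = fdiff j R m"
          using fdiff_add[of j R "\<lambda>_. - 1" m] fdiff_const[of j "- 1 :: 'p padic" m] False by simp
        ultimately show ?thesis using Rk[of j m] by (simp only:)
      qed
      show "real k / 2 \<le> real j / 2 + max 1 (real (l - j))" if "j \<le> l" for j
        using that Suc by (cases "j = l") (auto simp: of_nat_diff)
    qed
    then show ?thesis unfolding Suc fdiff.simps eq fdiff_minus val_ge_minus .
  qed
qed

text \<open>The rate at which the valuations of Dwork's coefficients may decrease. Direct expansion
  of the exponential gives only \<open>1 / (p - 1)\<close>; the saving \<open>1 / (2 p)\<close>
  makes the terms of the trace series tend to 0.\<close>

definition dwork_slope :: "nat \<Rightarrow> real" where
  "dwork_slope p = 1 / (real p - 1) - 1 / (2 * real p)"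

lemma val_ge_dwork_coeff_fact:
  assumes odd: "odd CARD('p)" and a: "a < CARD('p)"
  shows "val_ge (real k / 2) ((- of_nat CARD('p)) ^ k * fact k * dwork_coeff (a + CARD('p) * k) :: 'p::prime_card padic)"
proof -
  have "dwork_quot a = (\<lambda>m. \<Sum>i\<le>m. of_nat (m choose i) *
    ((- of_nat CARD('p)) ^ i * fact i * dwork_coeff (a + CARD('p) * i) :: 'p padic))"
    by (rule ext) (rule dwork_quot_eq_sum[OF a])
  then have "fdiff k (dwork_quot a) 0 = ((- of_nat CARD('p)) ^ k * fact k * dwork_coeff (a + CARD('p) * k) :: 'p padic)"
    by (simp only: fdiff_newton)
  then show ?thesis using val_ge_fdiff_dwork_quot[OF odd a, of k 0] by simp
qed

lemma val_ge_inverse_fact':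
  "val_ge (- real k / (real CARD('p) - 1)) (1 / fact k :: 'p::prime_card padic)"
proof (cases "k = 0")
  case False
  have "- real k / (real CARD('p) - 1) \<le> - (real k - 1) / (real CARD('p) - 1)"
    using nontriv[where 'a='p] by (intro divide_right_mono) auto
  with val_ge_inverse_fact[of k, where 'p='p] False show ?thesis
    using val_ge_mono by blast
qed simp

text \<open>Dividing by \<open>(- p) ^ k\<close> and \<open>fact k\<close>, with
  \<open>k = n div p\<close>, costs at most \<open>k + k / (p - 1)\<close>, that is
  \<open>p k / (p - 1)\<close>, against a gain of \<open>k / 2\<close>. The final 1 absorbs the
  remainder \<open>a < p\<close>.\<close>

lemma val_ge_dwork_coeff:
  assumes odd: "odd CARD('p)"
  shows "val_ge (- dwork_slope CARD('p) * real n - 1) (dwork_coeff n :: 'p::prime_card padic)"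
proof -
  let ?p = "CARD('p)"
  define q where "q = real ?p"
  have q: "q > 1" using nontriv[where 'a='p] by (simp add: q_def)
  define a k where "a = n mod ?p" and "k = n div ?p"
  have a: "a < ?p" by (simp add: a_def)
  have n: "n = a + ?p * k" by (simp add: a_def k_def)
  let ?x = "(- of_nat ?p) ^ k * fact k * dwork_coeff n :: 'p padic"
  have x: "val_ge (real k / 2) ?x" using val_ge_dwork_coeff_fact[OF odd a, of k] by (simp add: n)
  have f: "val_ge (- real k / (q - 1)) (1 / fact k :: 'p padic)"
  unfolding q_def by (rule val_ge_inverse_fact')
  have s: "val_ge (- real k) (1 / (- of_nat ?p) ^ k :: 'p padic)"
    using val_ge_inverse_prime_power[of k, where 'p='p] by (cases "even k") simp_all
  have "val_ge (- real k + (- real k / (q - 1) + real k / 2)) (1 / (- of_nat ?p) ^ k * (1 / fact k * ?x))"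
    by (intro val_ge_mult s f x)
  also have "1 / (- of_nat ?p) ^ k * (1 / fact k * ?x) = dwork_coeff n" by simp
  finally have v: "val_ge (- real k + (- real k / (q - 1) + real k / 2)) (dwork_coeff n :: 'p padic)" .
  have rn: "real n = real a + q * real k" by (simp add: n q_def)
  have 1: "real a / (2 * q) \<le> 1" using a q by (simp add: q_def divide_le_eq)
  have "- (1 / (q - 1) - 1 / (2 * q)) * real n - 1 = - real n / (q - 1) + real n / (2 * q) - 1"
    by (simp add: algebra_simps)
  also have "real n / (2 * q) = real a / (2 * q) + real k / 2" unfolding rn using q by (simp add: field_simps)
  also have "- real n / (q - 1) \<le> - (q * real k) / (q - 1)" unfolding rn using q by (intro divide_right_mono) auto
  also have "- (q * real k) / (q - 1) = - real k - real k / (q - 1)" using q by (simp add: field_simps)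
  finally have "- (1 / (q - 1) - 1 / (2 * q)) * real n - 1 \<le> - real k + (- real k / (q - 1) + real k / 2)"
    using 1 by linarith
  then show ?thesis using v val_ge_mono unfolding q_def dwork_slope_def by blast
qed

lemma dwork_slope_bounds:
  assumes "p \<ge> 3"
  shows "0 \<le> dwork_slope p" "dwork_slope p \<le> 1 / real p" "dwork_slope p * (real p - 1) = 1 - (real p - 1) / (2 * real p)"
proof -
  have p: "real p \<ge> 3" using assms by simp
  then have *: "0 < real p - 1" "0 < real p" by auto
  show "0 \<le> dwork_slope p" using p unfolding dwork_slope_def by (simp add: field_simps)
  have "1 / (real p - 1) \<le> 3 / (2 * real p)"
    using p by (simp add: divide_le_eq le_divide_eq field_simps)
  then show "dwork_slope p \<le> 1 / real p" unfolding dwork_slope_def by simp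
  show "dwork_slope p * (real p - 1) = 1 - (real p - 1) / (2 * real p)"
    using * unfolding dwork_slope_def by (simp add: left_diff_distrib)
qed

lemma card_ge_3: "odd CARD('p::prime_card) \<Longrightarrow> CARD('p) \<ge> 3"
  using nontriv[where 'a='p] by (cases "CARD('p) = 2") auto

section \<open>Valuations of rising and ordinary factorials\<close>

lemma pochhammer_dvd_diff:
  fixes x y :: "'a::comm_ring_1"
  assumes "a dvd x - y"
  shows "a dvd pochhammer x k - pochhammer y k"
proof (induction k)
  case (Suc k)
  have "pochhammer x (Suc k) - pochhammer y (Suc k) =
    pochhammer x k * (x - y) + (pochhammer x k - pochhammer y k) * (y + of_nat k)"
    by (simp add: pochhammer_Suc algebra_simps)
  then show ?case using assms Suc by simp
qed simp

lemma to_fract_pochhammer: "to_fract (pochhammer z k) = pochhammer (to_fract z) k"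
  by (induction k) (simp_all add: pochhammer_Suc)

text \<open>At a positive integer \<open>m\<close> this is the binomial coefficient
  \<open>(m + k - 1) choose k\<close>. A congruence modulo \<open>p ^ k\<close> transfers
  integrality to \<open>z\<close>, since \<open>fact k\<close> has valuation at most
  \<open>k / (p - 1)\<close>.\<close>

lemma val_ge_pochhammer_div_fact:
  fixes z :: "'p::prime_card padic_int"
  shows "val_ge 0 (pochhammer (to_fract z) k / fact k)"
proof -
  let ?P = "\<lambda>z :: 'p padic_int. pochhammer (to_fract z) k :: 'p padic"
  obtain m where m: "of_nat CARD('p) ^ k dvd z - of_nat m" "m > 0" using padic_int_approx_nat by blast
  have "val_ge (real k) (to_fract (pochhammer z k - pochhammer (of_nat m) k))"
    unfolding val_ge_to_fract_iff by (rule pochhammer_dvd_diff[OF m(1)])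
  then have "val_ge (real k) (?P z - ?P (of_nat m))" by (simp only: to_fract_diff to_fract_pochhammer)
  from val_ge_mult[OF this val_ge_inverse_fact'[of k]]
  have "val_ge (real k + - real k / (real CARD('p) - 1)) ((?P z - ?P (of_nat m)) * (1 / fact k))" .
  moreover have "0 \<le> real k + - real k / (real CARD('p) - 1)"
  proof -
    have "real k / (real CARD('p) - 1) \<le> real k / 1"
      using nontriv[where 'a='p] by (intro divide_left_mono) auto
    then show ?thesis by simp
  qed
  ultimately have "val_ge 0 ((?P z - ?P (of_nat m)) * (1 / fact k))" by (rule val_ge_mono)
  moreover have "?P (of_nat m) / fact k = of_nat ((m + k - 1) choose k)"
  proof -
    have "?P (of_nat m) / fact k = (of_nat m + of_nat k - 1) gchoose k"
      by (simp add: gbinomial_pochhammer')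
    also have "of_nat m + of_nat k - 1 = (of_nat (m + k - 1) :: 'p padic)"
      using m(2) by (simp add: of_nat_diff)
    finally show ?thesis by (simp only: binomial_gbinomial)
  qed
  ultimately have "val_ge 0 ((?P z - ?P (of_nat m)) * (1 / fact k) + ?P (of_nat m) / fact k)"
    by (intro val_ge_add) simp_all
  then show ?thesis by (simp add: diff_divide_distrib)
qed

lemma val_ge_fact: "val_ge (real n / real CARD('p) - 1) (fact n :: 'p::prime_card padic)"
proof -
  let ?p = "CARD('p)"
  have "(of_int (fact n) :: 'p padic) = of_int (int ?p ^ (n div ?p) *
    ((- 1) ^ Suc n * fact (n div ?p) * padic_gamma_nat ?p (Suc n)))"
    by (subst fact_eq_padic_gamma_nat[of ?p]) simp_all
  then have "(fact n :: 'p padic) = of_nat ?p ^ (n div ?p) *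
    of_int ((- 1) ^ Suc n * fact (n div ?p) * padic_gamma_nat ?p (Suc n))"
    by (simp only: of_int_mult of_int_power of_int_of_nat_eq of_int_fact)
  then have "val_ge (real (n div ?p)) (fact n :: 'p padic)"
    using val_ge_mult_int[OF val_ge_prime_power val_ge_of_int] by metis
  moreover have "real n / real ?p - 1 \<le> real (n div ?p)"
  proof -
    have "n \<le> ?p * (n div ?p + 1)"
      using dividend_less_div_times[of ?p n] by (simp add: algebra_simps)
    then have "real n \<le> real (?p * (n div ?p + 1))" by (simp only: of_nat_le_iff)
    then have "real n \<le> (real (n div ?p) + 1) * real ?p"
      by (simp only: of_nat_mult of_nat_add of_nat_1 mult.commute)
    then have "real n / real ?p \<le> real (n div ?p) + 1" by (subst pos_divide_le_eq) simp_all
    then show ?thesis by simp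
  qed
  ultimately show ?thesis by (rule val_ge_mono)
qed

section \<open>The gamma function as a Dwork sum\<close>

definition dwork_term :: "nat \<Rightarrow> 'p::prime_card padic \<Rightarrow> nat \<Rightarrow> 'p padic" where
  "dwork_term a y k = of_nat CARD('p) ^ k * dwork_coeff (a + CARD('p) * k) * pochhammer y k"

lemma val_ge_dwork_term:
  fixes z :: "'p::prime_card padic_int"
  assumes "odd CARD('p)" "a < CARD('p)"
  shows "val_ge (real k / 2) (dwork_term a (to_fract z) k)"
proof -
  have "dwork_term a (to_fract z) k = (- 1) ^ k *
    (((- of_nat CARD('p)) ^ k * fact k * dwork_coeff (a + CARD('p) * k)) * (pochhammer (to_fract z) k / fact k))"
    unfolding dwork_term_def by (cases "even k") simp_all
  moreover have "val_ge 0 ((- 1) ^ k :: 'p padic)" by (cases "even k") simp_all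
  ultimately show ?thesis
    by (metis val_ge_int_mult val_ge_mult_int val_ge_dwork_coeff_fact[OF assms] val_ge_pochhammer_div_fact)
qed

text \<open>As \<open>p \<ge> 3\<close>, the gain \<open>k / 2\<close> outweighs the loss
  \<open>k / (p - 1)\<close> from dividing by \<open>fact k\<close>. This controls how a summand
  changes when \<open>y\<close> moves.\<close>

lemma val_ge_prime_power_dwork_coeff:
  assumes "odd CARD('p)" "a < CARD('p)"
  shows "val_ge 0 (of_nat CARD('p) ^ k * dwork_coeff (a + CARD('p) * k) :: 'p::prime_card padic)"
proof -
  let ?x = "(- of_nat CARD('p)) ^ k * fact k * dwork_coeff (a + CARD('p) * k) :: 'p padic"
  have eq: "of_nat CARD('p) ^ k * dwork_coeff (a + CARD('p) * k) = (- 1) ^ k * (?x * (1 / fact k))"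
    by (cases "even k") simp_all
  have x: "val_ge (real k / 2 + - real k / (real CARD('p) - 1)) (?x * (1 / fact k))"
    by (intro val_ge_mult val_ge_dwork_coeff_fact assms val_ge_inverse_fact')
  have "0 \<le> real k / 2 + - real k / (real CARD('p) - 1)"
  proof -
    have "real k / (real CARD('p) - 1) \<le> real k / 2"
      using card_ge_3[OF assms(1)] by (intro divide_left_mono) auto
    then show ?thesis by simp
  qed
  with x have "val_ge 0 (?x * (1 / fact k))" by (rule val_ge_mono)
  moreover have "val_ge 0 ((- 1) ^ k :: 'p padic)" by (cases "even k") simp_all
  ultimately show ?thesis unfolding eq by (rule val_ge_int_mult[rotated])
qed

text \<open>At \<open>y = - m\<close> the rising factorial vanishes for \<open>k > m\<close>, so the
  series terminates and agrees with the Newton series.\<close>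

lemma dwork_quot_eq_dwork_sum:
  assumes a: "a < CARD('p)" and "m \<le> N"
  shows "(dwork_quot a m :: 'p::prime_card padic) = (\<Sum>k\<le>N. dwork_term a (- of_nat m) k)"
proof -
  have eq: "dwork_term a (- of_nat m) k = of_nat (m choose k) *
    ((- of_nat CARD('p)) ^ k * fact k * dwork_coeff (a + CARD('p) * k) :: 'p padic)" for k
  proof -
    have "pochhammer (- of_nat m) k = ((- 1) ^ k * fact k * of_nat (m choose k) :: 'p padic)"
      unfolding binomial_gbinomial gbinomial_pochhammer by (cases "even k") simp_all
    then show ?thesis
      unfolding dwork_term_def by (cases "even k") simp_all
  qed
  have "dwork_quot a m = (\<Sum>k\<le>m. dwork_term a (- of_nat m) k :: 'p padic)"
    unfolding eq by (rule dwork_quot_eq_sum[OF a])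
  also have "\<dots> = (\<Sum>k\<le>N. dwork_term a (- of_nat m) k)"
    by (rule sum.mono_neutral_left) (use assms(2) in \<open>auto simp: eq binomial_eq_0\<close>)
  finally show ?thesis .
qed

text \<open>The expansion \<open>a / (p - 1) = - a (1 + p + p ^ 2 + ...)\<close>, where
  \<open>K n\<close> is \<open>a\<close> times the sum of the first \<open>n\<close> powers of
  \<open>p\<close>.\<close>

lemma padic_int_digit_approx:
  fixes z :: "'p::prime_card padic_int"
  assumes z: "of_nat (CARD('p) - 1) * z = of_nat a"
  obtains K :: "nat \<Rightarrow> nat" where "\<And>n. K (Suc n) = a + CARD('p) * K n"
    and "\<And>n. K (Suc n) - K n = a * CARD('p) ^ n"
    and "\<And>n. of_nat CARD('p) ^ n dvd z + of_nat (K n)"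
proof
  let ?p = "CARD('p)"
  define K where "K = (\<lambda>n. a * (\<Sum>i<n. ?p ^ i))"
  have geo: "(?p - 1) * (\<Sum>i<n. ?p ^ i) + 1 = ?p ^ n" for n
  proof -
    define q where "q = ?p - 1"
    have p: "?p = Suc q" by (simp add: q_def)
    show ?thesis unfolding q_def[symmetric] p
    proof (induction n)
      case (Suc n)
      show ?case using Suc.IH by (simp add: distrib_left)
    qed simp
  qed
  have K: "(?p - 1) * K n + a = a * ?p ^ n" for n
    unfolding K_def geo[of n, symmetric] by (simp add: algebra_simps)
  show K_Suc: "K (Suc n) = a + ?p * K n" for n
  proof -
    have "(\<Sum>i<Suc n. ?p ^ i) = 1 + ?p * (\<Sum>i<n. ?p ^ i)"
      by (subst sum.lessThan_Suc_shift) (simp add: sum_distrib_left)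
    then show ?thesis unfolding K_def by (simp only: distrib_left mult.left_commute mult_1_right)
  qed
  show "K (Suc n) - K n = a * ?p ^ n" for n
    using K[of n] K_Suc[of n] by (simp add: algebra_simps)
  have "of_nat (?p - 1) * (z + of_nat (K n)) = of_nat ?p ^ n * of_nat a" for n
  proof -
    have "of_nat (?p - 1) * of_nat (K n) + of_nat a = (of_nat a * of_nat ?p ^ n :: 'p padic_int)"
      using arg_cong[OF K[of n], of "of_nat :: nat \<Rightarrow> 'p padic_int"]
      by (simp only: of_nat_add of_nat_mult of_nat_power)
    moreover have "of_nat (?p - 1) * (z + of_nat (K n)) = of_nat a + of_nat (?p - 1) * of_nat (K n)"
      unfolding distrib_left z ..
    ultimately show ?thesis by (simp only: mult.commute add.commute)
  qed
  moreover have "(of_nat (?p - 1) :: 'p padic_int) dvd 1"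
  proof (rule padic_unitI)
    have "\<not> ?p dvd ?p - 1" using nontriv[where 'a='p] by (auto dest: dvd_imp_le)
    then show "\<not> of_nat ?p dvd (of_nat (?p - 1) :: 'p padic_int)"
      using prime_dvd_padic_of_nat_iff by blast
  qed
  ultimately show "of_nat ?p ^ n dvd z + of_nat (K n)" for n
    by (metis dvd_mult_unit_iff dvd_triv_left mult.commute)
qed

text \<open>Here \<open>K' div p = K\<close>, so the reflection exponent is
  \<open>Suc (K' - K)\<close>, and \<open>a * p ^ n\<close> has the parity of
  \<open>a\<close>.\<close>

lemma padic_gamma_reflection_digit:
  assumes odd: "odd CARD('p::prime_card)" and K: "K' = a + CARD('p) * K" "K' - K = a * CARD('p) ^ n"
    and a: "a < CARD('p)"
  shows "padic_gamma (- of_nat K') * padic_gamma (of_nat K' + 1) = (- 1 :: 'p padic_int) ^ Suc a"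
proof -
  have "K' div CARD('p) = K" using a by (simp add: K(1))
  moreover have "((- 1) ^ Suc (K' - K) :: 'p padic_int) = (- 1) ^ Suc a"
    unfolding K(2) using odd by (auto simp: minus_one_power_iff)
  ultimately show ?thesis using padic_gamma_reflection_nat[OF odd, of K'] by simp
qed

text \<open>The truncated sum at \<open>z\<close> is compared with the terminating one at
  \<open>- K M\<close>. Three errors remain, each of valuation at least \<open>M / 2\<close>: moving
  \<open>y\<close>, the summands beyond \<open>M\<close>, and the variation of the gamma
  function.\<close>

lemma padic_lim_dwork_sum:
  fixes z :: "'p::prime_card padic_int"
  assumes odd: "odd CARD('p)" and a: "a < CARD('p)"
    and z: "of_nat (CARD('p) - 1) * z = of_nat a"
  shows "padic_lim (\<lambda>M. \<Sum>k\<le>M. dwork_term a (to_fract z) k) (to_fract (padic_gamma z))"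
proof -
  let ?p = "CARD('p)"
  obtain K :: "nat \<Rightarrow> nat" where K_Suc: "\<And>n. K (Suc n) = a + ?p * K n"
    and K_diff: "\<And>n. K (Suc n) - K n = a * ?p ^ n"
    and approx: "\<And>n. of_nat ?p ^ n dvd z + of_nat (K n)"
    using padic_int_digit_approx[OF z] by blast
  \<comment> \<open>Reflection turns the reciprocal of the gamma value at
    \<open>K (Suc n) + 1\<close> into the gamma value at \<open>- K (Suc n)\<close>.\<close>
  have quot: "dwork_quot a (K n) = to_fract (padic_gamma (- of_nat (K (Suc n))) :: 'p padic_int)" for n
  proof -
    define g :: "'p padic_int" where "g = of_int (padic_gamma_nat ?p (Suc (K (Suc n))))"
    have g: "g = padic_gamma (of_nat (K (Suc n)) + 1)"
      using padic_gamma_of_nat[OF odd, of "Suc (K (Suc n))"] by (simp add: g_def add.commute)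
    have "g \<noteq> 0" using padic_gamma_unit[OF odd, of "of_nat (K (Suc n)) + 1"] by (auto simp: g)
    have "padic_gamma (- of_nat (K (Suc n))) * g = (- 1) ^ Suc a"
      unfolding g by (rule padic_gamma_reflection_digit[OF odd K_Suc K_diff a])
    then have "to_fract (padic_gamma (- of_nat (K (Suc n)))) * to_fract g = to_fract ((- 1) ^ Suc a)"
      unfolding to_fract_mult[symmetric] by (simp only:)
    then have "to_fract (padic_gamma (- of_nat (K (Suc n)))) * to_fract g = (- 1) ^ Suc a"
      by simp
    moreover have "dwork_quot a (K n) = (- 1) ^ Suc a / to_fract g"
      unfolding dwork_quot_eq_gamma[OF odd a] K_Suc[symmetric] g_def by simp
    ultimately have "dwork_quot a (K n) = to_fract (padic_gamma (- of_nat (K (Suc n)))) * to_fract g / to_fract g"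
      by (simp only:)
    then show ?thesis using \<open>g \<noteq> 0\<close> by simp
  qed
  have "padic_lim (\<lambda>M. (\<Sum>k\<le>M. dwork_term a (to_fract z) k) - to_fract (padic_gamma z)) 0"
  proof (rule padic_lim_0I)
    show "filterlim (\<lambda>M. real M / 2) at_top sequentially"
      using filterlim_real_sequentially by (rule filterlim_at_top_mult_tendsto_pos[where f = "\<lambda>_. 1/2" and c = "1/2", simplified])
    fix M
    define m where "m = K M"
    \<comment> \<open>\<open>N \<ge> m\<close> makes the sum at \<open>- m\<close> complete, and
      \<open>N \<ge> M\<close> allows it to be cut at \<open>M\<close>.\<close>
    define N where "N = max m M"
    let ?t = "\<lambda>k. dwork_term a (- of_nat m :: 'p padic) k"
    have y: "(- of_nat m :: 'p padic) = to_fract (- of_nat m)" by simp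
    have 1: "val_ge (real M / 2) (\<Sum>k\<le>M. dwork_term a (to_fract z) k - ?t k)"
    proof (rule val_ge_sum)
      fix k
      have "of_nat ?p ^ M dvd pochhammer z k - pochhammer (- of_nat m) k"
        by (rule pochhammer_dvd_diff) (use approx[of M] in \<open>simp add: m_def\<close>)
      then have "val_ge (real M) (pochhammer (to_fract z) k - pochhammer (- of_nat m) k)"
        unfolding y to_fract_pochhammer[symmetric] to_fract_diff[symmetric] val_ge_to_fract_iff .
      then have "val_ge (real M) (of_nat ?p ^ k * dwork_coeff (a + ?p * k) *
          (pochhammer (to_fract z) k - pochhammer (- of_nat m) k))"
        by (rule val_ge_int_mult[OF val_ge_prime_power_dwork_coeff[OF odd a]])
      then have "val_ge (real M) (dwork_term a (to_fract z) k - ?t k)"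
        unfolding dwork_term_def by (simp add: algebra_simps)
      then show "val_ge (real M / 2) (dwork_term a (to_fract z) k - ?t k)" by (rule val_ge_mono) simp
    qed
    have 2: "val_ge (real M / 2) (\<Sum>k\<in>{M<..N}. ?t k)"
    proof (rule val_ge_sum)
      fix k assume "k \<in> {M<..N}"
      then show "val_ge (real M / 2) (?t k)"
        using val_ge_mono[OF val_ge_dwork_term[OF odd a, of k "- of_nat m"], of "real M / 2"] by simp
    qed
    have 3: "val_ge (real M / 2) (to_fract (padic_gamma (- of_nat (K (Suc M))) - padic_gamma z))"
    proof -
      have "of_nat ?p ^ Suc M dvd padic_gamma (- of_nat (K (Suc M))) - padic_gamma z"
        by (rule padic_gamma_dvd_diff[OF odd])
          (use approx[of "Suc M"] in \<open>metis add.commute dvd_minus_iff minus_add_distrib minus_diff_eq uminus_add_conv_diff diff_minus_eq_add\<close>)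
      then have "val_ge (real (Suc M)) (to_fract (padic_gamma (- of_nat (K (Suc M))) - padic_gamma z))"
        unfolding val_ge_to_fract_iff .
      then show ?thesis by (rule val_ge_mono) simp
    qed
    have "{..N} = {..M} \<union> {M<..N}" by (auto simp: N_def)
    then have "(\<Sum>k\<le>N. ?t k) = (\<Sum>k\<le>M. ?t k) + (\<Sum>k\<in>{M<..N}. ?t k)"
      by (simp add: sum.union_disjoint ivl_disj_int)
    moreover have "(\<Sum>k\<le>N. ?t k) = to_fract (padic_gamma (- of_nat (K (Suc M))))"
      using quot[of M] dwork_quot_eq_dwork_sum[OF a, of m N] by (simp add: m_def N_def)
    ultimately have eq: "(\<Sum>k\<le>M. dwork_term a (to_fract z) k) - to_fract (padic_gamma z) =
      (\<Sum>k\<le>M. dwork_term a (to_fract z) k - ?t k) - (\<Sum>k\<in>{M<..N}. ?t k) +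
        to_fract (padic_gamma (- of_nat (K (Suc M))) - padic_gamma z)"
      by (simp add: sum_subtractf)
    show "val_ge (real M / 2) ((\<Sum>k\<le>M. dwork_term a (to_fract z) k) - to_fract (padic_gamma z))"
      unfolding eq by (rule val_ge_add[OF val_ge_diff[OF 1 2] 3])
  qed
  from padic_lim_add[OF this padic_lim_const[of "to_fract (padic_gamma z)"]] show ?thesis by simp
qed

section \<open>Dwork traces\<close>

text \<open>On the monomials \<open>Y ^ (x + m)\<close> with \<open>x = a / (p - 1)\<close>, the
  diagonal entries of Dwork's operator are, up to a common factor, \<open>(- p) ^ m\<close> times
  the coefficient of degree \<open>(p - 1) (x + m)\<close>.\<close>

definition dwork_trace :: "nat \<Rightarrow> nat \<Rightarrow> 'p::prime_card padic" where
  "dwork_trace a M = (\<Sum>m\<le>M. (- of_nat CARD('p)) ^ m * dwork_coeff (a + (CARD('p) - 1) * m))"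

lemma dwork_trace_Suc:
  "dwork_trace a (Suc M) = dwork_trace a M +
    (- of_nat CARD('p)) ^ Suc M * (dwork_coeff (a + (CARD('p) - 1) * Suc M) :: 'p::prime_card padic)"
  by (simp add: dwork_trace_def)

text \<open>The solution of \<open>W m = - (m + x) W (m + 1)\<close> with \<open>W M = 1\<close>,
  which makes the recurrence of the coefficients telescope. At \<open>m = 0\<close> it is
  \<open>pochhammer x M\<close> up to sign.\<close>

definition dwork_weight :: "'p::prime_card padic \<Rightarrow> nat \<Rightarrow> nat \<Rightarrow> 'p padic" where
  "dwork_weight x M m = (\<Prod>i=m..<M. - (of_nat i + x))"

definition dwork_error :: "nat \<Rightarrow> 'p::prime_card padic \<Rightarrow> nat \<Rightarrow> 'p padic" where
  "dwork_error a x M = (\<Sum>m<M. (- of_nat CARD('p)) ^ M * (of_nat CARD('p) * (of_nat M + x)) *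
    (dwork_coeff (a + CARD('p) * M - m) * dwork_weight x M (Suc m)))"

text \<open>
  \<open>dwork_error\<close> is what truncation at degree \<open>M\<close> adds to the equality of the trace of \<open>\<alpha>\<close> with the
  sum of its traces on the cokernel and on the image of \<open>D\<close>. It telescopes by the
  recurrence \<open>n b\<^sub>n = b\<^bsub>n-1\<^esub> + b\<^bsub>n-p\<^esub>\<close>, rewritten as \<open>p(M + x) b\<^sub>n = (m + x) b\<^sub>n + b\<^bsub>n-1\<^esub> + b\<^bsub>n-p\<^esub>\<close> for
  \<open>n = a + pM - m\<close>.
\<close>

lemma dwork_error_Suc:
  fixes x :: "'p::prime_card padic"
  assumes x: "of_nat (CARD('p) - 1) * x = of_nat a"
  shows "dwork_error a x (Suc N) = dwork_error a x N +
    (- of_nat CARD('p)) ^ Suc N * dwork_coeff (a + (CARD('p) - 1) * Suc N) -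
    dwork_term a x (Suc N) -
    of_nat CARD('p) * ((- of_nat CARD('p)) ^ N * dwork_coeff (a + (CARD('p) - 1) * N))"
proof -
  let ?p = "CARD('p)"
  let ?P = "of_nat ?p :: 'p padic"
  define M where "M = Suc N"
  define b where "b = (dwork_coeff :: nat \<Rightarrow> 'p padic)"
  define n where "n = (\<lambda>m. a + ?p * M - m)"
  define W where "W = dwork_weight x M"
  have p1: "(of_nat (?p - 1) :: 'p padic) = ?P - 1" by (simp add: of_nat_diff Suc_leI)
  have px: "?P * x = of_nat a + x" using x unfolding p1 by (simp add: algebra_simps)
  have ge: "?p \<le> n m" "m < a + ?p * M" "n m - 1 = n (Suc m)" "n m - ?p = a + ?p * N - m" if "m < M" for m
  proof -
    have "m \<le> N" "1 \<le> ?p" using that by (auto simp: M_def Suc_leI)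
    then have mN: "m \<le> ?p * N" using mult_le_mono[of 1 ?p m N] by simp
    then show "?p \<le> n m" "n m - ?p = a + ?p * N - m" by (auto simp: n_def M_def)
    show "m < a + ?p * M" using mN zero_less_card_finite[where 'a='p] by (simp add: M_def del: zero_less_card_finite)
    then show "n m - 1 = n (Suc m)" by (simp add: n_def)
  qed
  have rec: "?P * (of_nat M + x) * b (n m) = (of_nat m + x) * b (n m) + b (n (Suc m)) + b (a + ?p * N - m)" if "m < M" for m
  proof -
    have "of_nat (n m) = (of_nat a + ?P * of_nat M - of_nat m :: 'p padic)"
      unfolding n_def using ge(2)[OF that] by (simp add: of_nat_diff)
    moreover have "?P * (of_nat M + x) = ?P * of_nat M + (of_nat a + x)" by (simp add: distrib_left px)
    ultimately have "?P * (of_nat M + x) - (of_nat m + x) = of_nat (n m)" by simp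
    then have "(?P * (of_nat M + x) - (of_nat m + x)) * b (n m) = of_nat (n m) * b (n m)" by simp
    also have "\<dots> = b (n (Suc m)) + b (a + ?p * N - m)"
      using dwork_coeff_rec[OF ge(1)[OF that]] ge(3,4)[OF that] by (simp only: b_def)
    finally show ?thesis by (simp add: algebra_simps)
  qed
  have WM: "W M = 1" by (simp add: W_def dwork_weight_def)
  have Wm: "W m = - (of_nat m + x) * W (Suc m)" if "m < M" for m
    using that by (simp add: W_def dwork_weight_def prod.atLeast_Suc_lessThan)
  have "dwork_error a x M = (- ?P) ^ M * (\<Sum>m<M. ?P * (of_nat M + x) * b (n m) * W (Suc m))"
    by (simp add: dwork_error_def b_def n_def W_def sum_distrib_left mult.assoc)
  also have "(\<Sum>m<M. ?P * (of_nat M + x) * b (n m) * W (Suc m)) =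
    (\<Sum>m<M. (b (n (Suc m)) * W (Suc m) - b (n m) * W m) + b (a + ?p * N - m) * W (Suc m))"
  proof (rule sum.cong[OF refl])
    fix m assume "m \<in> {..<M}"
    then have m: "m < M" by simp
    show "?P * (of_nat M + x) * b (n m) * W (Suc m) =
      (b (n (Suc m)) * W (Suc m) - b (n m) * W m) + b (a + ?p * N - m) * W (Suc m)"
      unfolding rec[OF m] Wm[OF m] by (simp add: algebra_simps)
  qed
  also have "\<dots> = (\<Sum>m<M. b (n (Suc m)) * W (Suc m) - b (n m) * W m) + (\<Sum>m<M. b (a + ?p * N - m) * W (Suc m))"
    by (rule sum.distrib)
  also have "(\<Sum>m<M. b (n (Suc m)) * W (Suc m) - b (n m) * W m) = b (n M) * W M - b (n 0) * W 0"
    by (rule sum_lessThan_telescope)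
  finally have err: "dwork_error a x M = (- ?P) ^ M * b (n M) - (- ?P) ^ M * (b (n 0) * W 0) +
    (- ?P) ^ M * (\<Sum>m<M. b (a + ?p * N - m) * W (Suc m))"
    by (simp add: WM algebra_simps)
  have sub: "a + ?p * k - k = a + (?p - 1) * k" for k
    by (simp add: diff_mult_distrib Suc_leI)
  have 1: "(- ?P) ^ M * b (n M) = (- ?P) ^ M * b (a + (?p - 1) * M)"
    by (simp only: n_def sub)
  have "W 0 = (- 1) ^ M * pochhammer x M"
  proof -
    have "W 0 = (\<Prod>i = 0..<M. (- 1) * (x + of_nat i))"
      unfolding W_def dwork_weight_def by (intro prod.cong) simp_all
    then show ?thesis by (simp only: prod.distrib pochhammer_prod) simp
  qed
  then have 2: "(- ?P) ^ M * (b (n 0) * W 0) = dwork_term a x M"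
    unfolding dwork_term_def n_def b_def by (cases "even M") simp_all
  \<comment> \<open>The last summand has weight 1 and gives the trace term of index
    \<open>N\<close>; every other weight carries an extra factor \<open>- (N + x)\<close>, which
    rebuilds the error of index \<open>N\<close>.\<close>
  have "(\<Sum>m<M. b (a + ?p * N - m) * W (Suc m)) =
    (\<Sum>m<N. b (a + ?p * N - m) * W (Suc m)) + b (a + ?p * N - N)"
    using WM by (simp add: M_def)
  also have "(\<Sum>m<N. b (a + ?p * N - m) * W (Suc m)) =
    - (\<Sum>m<N. (of_nat N + x) * (b (a + ?p * N - m) * dwork_weight x N (Suc m)))"
    unfolding sum_negf[symmetric]
  proof (rule sum.cong[OF refl])
    fix m assume "m \<in> {..<N}"
    then have "W (Suc m) = dwork_weight x N (Suc m) * - (of_nat N + x)"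
      by (simp add: W_def dwork_weight_def M_def prod.atLeastLessThan_Suc)
    then show "b (a + ?p * N - m) * W (Suc m) =
      - ((of_nat N + x) * (b (a + ?p * N - m) * dwork_weight x N (Suc m)))"
      by (simp only: mult_minus_left mult_minus_right mult_ac)
  qed
  also have "(- ?P) ^ M * (- (\<Sum>m<N. (of_nat N + x) * (b (a + ?p * N - m) * dwork_weight x N (Suc m))) + b (a + ?p * N - N)) =
    dwork_error a x N - ?P * ((- ?P) ^ N * b (a + (?p - 1) * N))"
  proof -
    define T where "T = (\<Sum>m<N. (of_nat N + x) * (b (a + ?p * N - m) * dwork_weight x N (Suc m)))"
    have "dwork_error a x N = (- ?P) ^ N * ?P * T"
      unfolding dwork_error_def T_def sum_distrib_left b_def
      by (rule sum.cong[OF refl]) (simp only: mult.assoc)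
    then show ?thesis unfolding sub T_def[symmetric] M_def by (simp add: algebra_simps)
  qed
  finally have 3: "(- ?P) ^ M * (\<Sum>m<M. b (a + ?p * N - m) * W (Suc m)) =
    dwork_error a x N - ?P * ((- ?P) ^ N * b (a + (?p - 1) * N))" .
  show ?thesis using err unfolding 1 2 3 by (simp add: M_def b_def)
qed

text \<open>The recursion summed up. Once the error is known to vanish in the limit,
  \<open>1 - p\<close> times the trace is the Dwork sum.\<close>

lemma dwork_error_eq:
  fixes x :: "'p::prime_card padic"
  assumes x: "of_nat (CARD('p) - 1) * x = of_nat a"
  shows "dwork_error a x (Suc M) =
    dwork_trace a (Suc M) - (\<Sum>k\<le>Suc M. dwork_term a x k) - of_nat CARD('p) * dwork_trace a M"
proof (induction M)
  case 0
  show ?case unfolding dwork_error_Suc[OF x, of 0]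
    by (simp add: dwork_trace_Suc, simp add: dwork_trace_def dwork_error_def dwork_term_def)
next
  case (Suc M)
  show ?case unfolding dwork_error_Suc[OF x, of "Suc M"] Suc.IH
    by (simp add: dwork_trace_Suc algebra_simps)
qed

text \<open>The weight is a rising factorial of length \<open>M - m - 1\<close>, with valuation at
  least about \<open>(M - m) / p\<close>. As the slope \<open>s\<close> is at most
  \<open>1 / p\<close>, the total bound is smallest for \<open>m\<close> near \<open>M\<close>,
  where \<open>M - s (p - 1) M\<close> remains. The 4 collects the bounded losses.\<close>

lemma val_ge_dwork_error:
  fixes z :: "'p::prime_card padic_int"
  assumes odd: "odd CARD('p)" and a: "a < CARD('p)"
  shows "val_ge ((real CARD('p) - 1) / (2 * real CARD('p)) * real M - 4) (dwork_error a (to_fract z) M)"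
  unfolding dwork_error_def
proof (rule val_ge_sum)
  fix m assume "m \<in> {..<M}"
  then have m: "m < M" by simp
  let ?p = "CARD('p)" and ?x = "to_fract z"
  define q where "q = real ?p"
  define s where "s = dwork_slope ?p"
  have q: "q \<ge> 3" using card_ge_3[OF odd] by (simp add: q_def)
  have s: "0 \<le> s" "s \<le> 1 / q" "s * (q - 1) = 1 - (q - 1) / (2 * q)"
    using dwork_slope_bounds[OF card_ge_3[OF odd]] by (simp_all add: s_def q_def)
  define l where "l = M - Suc m"
  have "dwork_weight ?x M (Suc m) = (- 1) ^ l * pochhammer (?x + of_nat (Suc m)) l"
  proof -
    have "dwork_weight ?x M (Suc m) = (\<Prod>i<l. - (of_nat (Suc m + i) + ?x))"
      unfolding dwork_weight_def
      by (rule prod.reindex_bij_witness[of _ "\<lambda>i. Suc m + i" "\<lambda>i. i - Suc m"]) (auto simp: l_def)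
    also have "\<dots> = (\<Prod>i<l. (- 1) * (?x + of_nat (Suc m) + of_nat i))"
      by (intro prod.cong) simp_all
    finally show ?thesis by (simp only: prod.distrib pochhammer_prod atLeast0LessThan) simp
  qed
  also have "\<dots> = (- 1) ^ l * (fact l * (pochhammer (to_fract (z + of_nat (Suc m))) l / fact l))"
    by simp
  finally have w: "val_ge (real l / q - 1) (dwork_weight ?x M (Suc m))"
    unfolding q_def
    by (simp only:, intro val_ge_int_mult val_ge_mult_int val_ge_fact val_ge_pochhammer_div_fact)
       (cases "even l"; simp)
  have c: "val_ge (- s * real (a + ?p * M - m) - 1) (dwork_coeff (a + ?p * M - m) :: 'p padic)"
    unfolding s_def by (rule val_ge_dwork_coeff[OF odd])
  have "of_nat ?p * (of_nat M + ?x) = to_fract (of_nat ?p * (of_nat M + z))" by simp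
  then have i: "val_ge 0 (of_nat ?p * (of_nat M + ?x))" by (metis val_ge_to_fract)
  have "val_ge (real M + 0 + ((- s * real (a + ?p * M - m) - 1) + (real l / q - 1)))
    ((- of_nat ?p) ^ M * (of_nat ?p * (of_nat M + ?x)) *
      (dwork_coeff (a + ?p * M - m) * dwork_weight ?x M (Suc m)))"
    by (intro val_ge_mult val_ge_minus_prime_power i c w)
  moreover have "(q - 1) / (2 * q) * real M - 4 \<le> real M + 0 + ((- s * real (a + ?p * M - m) - 1) + (real l / q - 1))"
  proof -
    have le: "m \<le> a + ?p * M" using m mult_le_mono[of 1 ?p m M] by (simp add: Suc_leI)
    define c where "c = (q - 1) / (2 * q)"
    have n: "real (a + ?p * M - m) = real a + q * real M - real m"
      using le by (simp add: of_nat_diff q_def)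
    have l: "real l = real M - real m - 1" using m by (simp add: l_def of_nat_diff)
    have "- s * real (a + ?p * M - m) = - (s * real a) - s * (q - 1) * real M - s * real M + s * real m"
      unfolding n by (simp add: algebra_simps)
    moreover have "s * real a \<le> 1"
      using mult_mono[OF s(2), of "real a" q] s q a by (simp add: q_def)
    moreover have "s * real M - real M / q \<le> s * real m - real m / q"
    proof -
      have "(s - 1 / q) * real M \<le> (s - 1 / q) * real m"
        using s m by (intro mult_left_mono_neg) auto
      then show ?thesis by (simp add: left_diff_distrib)
    qed
    moreover have "1 / q \<le> 1" using q by simp
    moreover have "c * real M = real M - s * (q - 1) * real M"
      unfolding s(3) c_def by (simp add: left_diff_distrib)
    moreover have "real l / q = real M / q - real m / q - 1 / q" unfolding l by (simp add: diff_divide_distrib)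
    ultimately show ?thesis unfolding c_def[symmetric] by linarith
  qed
  ultimately show "val_ge ((real ?p - 1) / (2 * real ?p) * real M - 4)
    ((- of_nat ?p) ^ M * (of_nat ?p * (of_nat M + ?x)) *
      (dwork_coeff (a + ?p * M - m) * dwork_weight ?x M (Suc m)))"
    unfolding q_def by (rule val_ge_mono)
qed

lemma val_ge_dwork_trace_term:
  assumes odd: "odd CARD('p)" and a: "a < CARD('p)"
  shows "val_ge ((real CARD('p) - 1) / (2 * real CARD('p)) * real M - 4)
    ((- of_nat CARD('p)) ^ M * dwork_coeff (a + (CARD('p) - 1) * M) :: 'p::prime_card padic)"
proof -
  let ?p = "CARD('p)"
  define q where "q = real ?p"
  define s where "s = dwork_slope ?p"
  have q: "q \<ge> 3" using card_ge_3[OF odd] by (simp add: q_def)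
  have s: "0 \<le> s" "s \<le> 1 / q" "s * (q - 1) = 1 - (q - 1) / (2 * q)"
    using dwork_slope_bounds[OF card_ge_3[OF odd]] by (simp_all add: s_def q_def)
  define c where "c = (q - 1) / (2 * q)"
  have n: "real (a + (?p - 1) * M) = real a + (q - 1) * real M" by (simp add: q_def of_nat_diff Suc_leI)
  have "- s * real (a + (?p - 1) * M) = - (s * real a) - s * (q - 1) * real M"
    unfolding n by (simp add: algebra_simps)
  moreover have "val_ge (real M + (- s * real (a + (?p - 1) * M) - 1))
    ((- of_nat ?p) ^ M * dwork_coeff (a + (?p - 1) * M) :: 'p padic)"
    unfolding s_def by (intro val_ge_mult val_ge_minus_prime_power val_ge_dwork_coeff[OF odd])
  moreover have "s * real a \<le> 1"
    using mult_mono[OF s(2), of "real a" q] s q a by (simp add: q_def)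
  moreover have "c * real M = real M - s * (q - 1) * real M"
    unfolding s(3) c_def by (simp add: left_diff_distrib)
  ultimately show ?thesis unfolding q_def[symmetric] c_def[symmetric]
    by (elim val_ge_mono) linarith
qed

lemma filterlim_dwork_rate:
  assumes "odd CARD('p::prime_card)"
  shows "filterlim (\<lambda>M. (real CARD('p) - 1) / (2 * real CARD('p)) * real M - C) at_top sequentially"
proof -
  define c where "c = (real CARD('p) - 1) / (2 * real CARD('p))"
  have c: "c > 0" using card_ge_3[OF assms] by (simp add: c_def)
  have "filterlim (\<lambda>M. c * real M) at_top sequentially"
    by (rule filterlim_tendsto_pos_mult_at_top[OF tendsto_const c filterlim_real_sequentially])
  from filterlim_tendsto_add_at_top[OF tendsto_const[of "- C"] this]
  show ?thesis by (simp add: c_def algebra_simps)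
qed

text \<open>In \<open>dwork_error_eq\<close> the error and the last trace term tend to 0, and the
  Dwork sum tends to the gamma value.\<close>

lemma padic_lim_dwork_trace:
  fixes z :: "'p::prime_card padic_int"
  assumes odd: "odd CARD('p)" and a: "a < CARD('p)"
    and z: "of_nat (CARD('p) - 1) * z = of_nat a"
  shows "padic_lim (\<lambda>M. (1 - of_nat CARD('p)) * dwork_trace a M) (to_fract (padic_gamma z))"
proof -
  let ?p = "of_nat CARD('p) :: 'p padic"
  have x: "of_nat (CARD('p) - 1) * to_fract z = of_nat a"
    using arg_cong[OF z, of to_fract] by simp
  let ?t = "\<lambda>M. (- ?p) ^ M * dwork_coeff (a + (CARD('p) - 1) * M)"
  have t: "padic_lim ?t 0"
    by (rule padic_lim_0I[OF val_ge_dwork_trace_term[OF odd a] filterlim_dwork_rate[OF odd]])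
  have e: "padic_lim (dwork_error a (to_fract z)) 0"
    by (rule padic_lim_0I[OF val_ge_dwork_error[OF odd a] filterlim_dwork_rate[OF odd]])
  have "padic_lim (\<lambda>M. dwork_error a (to_fract z) (Suc M) + (\<Sum>k\<le>Suc M. dwork_term a (to_fract z) k) - ?t (Suc M))
    (0 + to_fract (padic_gamma z) - 0)"
    by (intro padic_lim_diff padic_lim_add padic_lim_Suc[OF e] padic_lim_Suc[OF t]
        padic_lim_Suc[OF padic_lim_dwork_sum[OF odd a z]])
  moreover have "dwork_error a (to_fract z) (Suc M) + (\<Sum>k\<le>Suc M. dwork_term a (to_fract z) k) - ?t (Suc M) =
    (1 - ?p) * dwork_trace a M" for M
    unfolding dwork_error_eq[OF x] dwork_trace_Suc by (simp add: algebra_simps)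
  ultimately show ?thesis by simp
qed

section \<open>Dependence of the trace on the exponent\<close>

definition dwork_functional :: "'p::prime_card padic fps \<Rightarrow> nat \<Rightarrow> nat \<Rightarrow> 'p padic" where
  "dwork_functional F c M = (\<Sum>m\<le>M. (- of_nat CARD('p)) ^ m * fps_nth F (c + (CARD('p) - 1) * m))"

lemma dwork_functional_diff: "dwork_functional (F - G) c M = dwork_functional F c M - dwork_functional G c M"
  by (simp add: dwork_functional_def algebra_simps sum_subtractf)

text \<open>
  With \<open>\<pi>\<^sup>p\<^sup>-\<^sup>1 = -p\<close>, the functional is \<open>\<pi>\<^sup>-\<^sup>c\<close> times an average of \<open>\<omega>(t)\<^sup>-\<^sup>c F(\<pi> \<omega>(t))\<close> over \<open>t\<close>, and
  \<open>Y + Y\<^sup>p/p\<close> vanishes at each \<open>\<pi> \<omega>(t)\<close>: only a boundary term is left.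
\<close>

lemma dwork_functional_arg_mult:
  fixes F :: "'p::prime_card padic fps"
  assumes "0 < c" "c < CARD('p)"
  shows "dwork_functional (dwork_arg * F) c M =
    (- of_nat CARD('p)) ^ M * fps_nth F (c + (CARD('p) - 1) * M - 1)"
proof (induction M)
  case 0
  show ?case using assms by (simp add: dwork_functional_def dwork_arg_mult_nth)
next
  case (Suc M)
  let ?p = "CARD('p)"
  let ?n = "c + (?p - 1) * Suc M"
  obtain q where q: "?p = Suc q" using zero_less_card_finite[where 'a='p] by (cases "?p") auto
  have n: "\<not> ?n < ?p" "?n - ?p = c + (?p - 1) * M - 1" "?n \<noteq> 0"
    using assms(1) by (auto simp: q)
  have "dwork_functional (dwork_arg * F) c (Suc M) = dwork_functional (dwork_arg * F) c M +
      (- of_nat ?p) ^ Suc M * fps_nth (dwork_arg * F) ?n"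
    by (simp add: dwork_functional_def)
  also have "fps_nth (dwork_arg * F) ?n =
      fps_nth F (?n - 1) + fps_nth F (c + (?p - 1) * M - 1) / of_nat ?p"
    unfolding dwork_arg_mult_nth n(2) using n(1,3) by (simp only: if_False)
  finally show ?case unfolding Suc.IH by (simp add: distrib_left del: mult_Suc_right)
qed

text \<open>By the binomial theorem the power consists of integral multiples of
  \<open>Y ^ (r + (p - 1) j) / p ^ j\<close> with \<open>j \<le> r\<close>; so
  \<open>j = (n - r) / (p - 1)\<close>, and the degree is at most \<open>p r\<close>.\<close>

lemma val_ge_dwork_arg_power:
  "val_ge ((real r - real n) / (real CARD('p) - 1)) (fps_nth (dwork_arg ^ r) n :: 'p::prime_card padic) \<and>
    (n > CARD('p) * r \<longrightarrow> fps_nth (dwork_arg ^ r :: 'p padic fps) n = 0)"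
proof (induction r arbitrary: n)
  case 0
  then show ?case by (cases "n = 0") simp_all
next
  case (Suc r)
  note IH = Suc
  let ?p = "CARD('p)"
  let ?F = "dwork_arg ^ r :: 'p padic fps"
  let ?v = "(real (Suc r) - real n) / (real ?p - 1)"
  have p: "real ?p - 1 > 0" using nontriv[where 'a='p] by simp
  have eq: "fps_nth (dwork_arg ^ Suc r :: 'p padic fps) n = (if n = 0 then 0 else fps_nth ?F (n - 1)) +
    (if n < ?p then 0 else fps_nth ?F (n - ?p) / of_nat ?p)"
    by (simp add: dwork_arg_mult_nth)
  have "val_ge ?v (if n = 0 then 0 else fps_nth ?F (n - 1))"
  proof (cases n)
    case (Suc k)
    then show ?thesis using IH[of k] by simp
  qed simp
  moreover have "val_ge ?v (if n < ?p then 0 else fps_nth ?F (n - ?p) / of_nat ?p)"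
  proof (cases "n < ?p")
    case False
    have "val_ge ((real r - real (n - ?p)) / (real ?p - 1) + - real 1) (fps_nth ?F (n - ?p) * (1 / of_nat ?p ^ 1))"
      using IH[of "n - ?p"] by (intro val_ge_mult val_ge_inverse_prime_power) simp
    also have "(real r - real (n - ?p)) / (real ?p - 1) + - real 1 = ?v"
      using False p by (simp add: of_nat_diff field_simps)
    finally show ?thesis using False by simp
  qed simp
  ultimately have "val_ge ?v (fps_nth (dwork_arg ^ Suc r :: 'p padic fps) n)"
    unfolding eq by (rule val_ge_add)
  moreover have "fps_nth (dwork_arg ^ Suc r :: 'p padic fps) n = 0" if "n > ?p * Suc r"
  proof -
    have "n - 1 > ?p * r" "n - ?p > ?p * r"
      using that zero_less_card_finite[where 'a='p] by (auto simp del: zero_less_card_finite)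
    then show ?thesis unfolding eq using IH[of "n - 1"] IH[of "n - ?p"] by simp
  qed
  ultimately show ?case by blast
qed

text \<open>The quotient of \<open>dwork_exp h - 1\<close> by \<open>dwork_arg\<close>, isolated
  because the functional sends multiples of \<open>dwork_arg\<close> to a boundary term.\<close>

definition dwork_exp_tail :: "'p::prime_card padic \<Rightarrow> 'p padic fps" where
  "dwork_exp_tail h = Abs_fps (\<lambda>r. h ^ Suc r / fact (Suc r)) oo dwork_arg"

lemma dwork_exp_eq_tail: "dwork_exp h = 1 + dwork_arg * dwork_exp_tail h"
proof -
  have "fps_exp h = 1 + fps_X * Abs_fps (\<lambda>r. h ^ Suc r / fact (Suc r))"
  proof (rule fps_ext)
    fix n
    show "fps_nth (fps_exp h) n = fps_nth (1 + fps_X * Abs_fps (\<lambda>r. h ^ Suc r / fact (Suc r))) n"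
      by (cases n) (simp_all del: fact_Suc power_Suc)
  qed
  then have "dwork_exp h = (1 + fps_X * Abs_fps (\<lambda>r. h ^ Suc r / fact (Suc r))) oo dwork_arg"
    by (simp only: dwork_exp_def)
  also have "\<dots> = 1 + dwork_arg * dwork_exp_tail h"
    unfolding dwork_exp_tail_def fps_compose_add_distrib
    by (subst fps_compose_mult_distrib) simp_all
  finally show ?thesis .
qed

text \<open>Each power of \<open>h\<close> contributes a factor \<open>p\<close>, so the summand of
  index \<open>r\<close> has valuation at least \<open>r + 1 - n / (p - 1)\<close>; it vanishes
  unless \<open>r \<ge> n / p\<close>.\<close>

lemma val_ge_dwork_exp_tail:
  fixes h :: "'p::prime_card padic"
  assumes h: "val_ge 1 h"
  shows "val_ge (- dwork_slope CARD('p) * real n) (fps_nth (dwork_exp_tail h) n)"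
  unfolding dwork_exp_tail_def fps_compose_nth
proof (rule val_ge_sum)
  fix r assume "r \<in> {0..n}"
  let ?p = "CARD('p)"
  define q where "q = real ?p"
  have q: "q > 1" using nontriv[where 'a='p] by (simp add: q_def)
  show "val_ge (- dwork_slope ?p * real n)
    (fps_nth (Abs_fps (\<lambda>r. h ^ Suc r / fact (Suc r))) r * fps_nth (dwork_arg ^ r) n)"
  proof (cases "n > ?p * r")
    case True
    then show ?thesis using val_ge_dwork_arg_power[of r n, where 'p='p] by simp
  next
    case False
    have "real n \<le> real (?p * r)" using False by (simp only: of_nat_le_iff not_less)
    then have nr: "real n \<le> q * real r" by (simp add: q_def)
    have "val_ge (real (Suc r) * 1 + - (real (Suc r) - 1) / (real ?p - 1)) (h ^ Suc r * (1 / fact (Suc r)))"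
      by (intro val_ge_mult val_ge_power h val_ge_inverse_fact) simp
    from val_ge_mult[OF this conjunct1[OF val_ge_dwork_arg_power[of r n]]]
    have "val_ge ((real (Suc r) * 1 + - (real (Suc r) - 1) / (q - 1)) + (real r - real n) / (q - 1))
      (h ^ Suc r * (1 / fact (Suc r)) * fps_nth (dwork_arg ^ r) n)"
      unfolding q_def .
    moreover have "- dwork_slope ?p * real n \<le>
      (real (Suc r) * 1 + - (real (Suc r) - 1) / (q - 1)) + (real r - real n) / (q - 1)"
    proof -
      have "- dwork_slope ?p * real n = - real n / (q - 1) + real n / (2 * q)"
        by (simp add: dwork_slope_def q_def[symmetric] algebra_simps)
      moreover have "real n / (2 * q) \<le> real r"
      proof -
        have "real n / (2 * q) \<le> q * real r / (2 * q)" using nr q by (intro divide_right_mono) auto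
        also have "\<dots> = real r / 2" using q by simp
        finally show ?thesis by simp
      qed
      moreover have "- (real (Suc r) - 1) / (q - 1) + (real r - real n) / (q - 1) = - real n / (q - 1)"
        by (simp add: diff_divide_distrib)
      ultimately show ?thesis by simp
    qed
    ultimately have "val_ge (- dwork_slope ?p * real n) (h ^ Suc r * (1 / fact (Suc r)) * fps_nth (dwork_arg ^ r) n)"
      by (rule val_ge_mono)
    then show ?thesis by simp
  qed
qed

lemma val_ge_dwork_exp_root_of_unity:
  assumes odd: "odd CARD('p)" and w: "w ^ CARD('p) = w" "val_ge 0 (w :: 'p::prime_card padic)"
  shows "val_ge (- dwork_slope CARD('p) * real n - 1) (fps_nth (dwork_exp w) n)"
  unfolding dwork_exp_nth_root_of_unity[OF w(1)]
  using val_ge_power[OF w(2), of n] by (intro val_ge_int_mult val_ge_dwork_coeff[OF odd]) simp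

text \<open>The case \<open>w = 0\<close> is included, so \<open>w ^ (p - 1)\<close> cannot be
  replaced by 1; one factor of \<open>w ^ c\<close> absorbs it.\<close>

lemma power_root_of_unity:
  fixes w :: "'a::comm_ring_1"
  assumes "w ^ p = w" "p > 0" "c > 0"
  shows "w ^ (c + (p - 1) * m) = w ^ c"
proof (induction m)
  case (Suc m)
  have "w ^ (c + (p - 1) * Suc m) = w ^ (c + (p - 1) * m) * w ^ (p - 1)"
  proof -
    have "c + (p - 1) * Suc m = c + (p - 1) * m + (p - 1)" by simp
    then show ?thesis by (simp only: power_add)
  qed
  also have "\<dots> = w ^ (c - 1) * (w * w ^ (p - 1))"
    unfolding Suc using assms(3) by (cases c) (simp_all add: mult_ac)
  also have "w * w ^ (p - 1) = w" using assms(1,2) by (cases p) simp_all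
  finally show ?case using assms(3) by (cases c) (simp_all add: mult_ac)
qed simp

text \<open>Local constancy in the exponent: \<open>dwork_exp (w + h)\<close> and
  \<open>dwork_exp w\<close> differ by a multiple of \<open>dwork_arg\<close>, whose functional is a
  boundary term tending to 0. At \<open>w\<close> itself homogeneity gives \<open>w ^ c\<close>
  times the trace.\<close>

lemma padic_lim_dwork_functional:
  fixes w h :: "'p::prime_card padic"
  assumes odd: "odd CARD('p)" and c: "0 < c" "c < CARD('p)"
    and w: "w ^ CARD('p) = w" "val_ge 0 w" and h: "val_ge 1 h"
    and lim: "padic_lim (dwork_trace c) L"
  shows "padic_lim (dwork_functional (dwork_exp (w + h)) c) (w ^ c * L)"
proof -
  let ?p = "CARD('p)"
  define s where "s = dwork_slope ?p"
  define q where "q = real ?p"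
  have q: "q \<ge> 3" using card_ge_3[OF odd] by (simp add: q_def)
  have s: "0 \<le> s" "s \<le> 1 / q" "s * (q - 1) = 1 - (q - 1) / (2 * q)"
    using dwork_slope_bounds[OF card_ge_3[OF odd]] by (simp_all add: s_def q_def)
  have w_eq: "dwork_functional (dwork_exp w) c M = w ^ c * dwork_trace c M" for M
    unfolding dwork_functional_def dwork_trace_def sum_distrib_left
      dwork_exp_nth_root_of_unity[OF w(1)] power_root_of_unity[OF w(1) zero_less_card_finite c(1)]
    by (simp only: mult_ac)
  let ?F = "dwork_exp w * dwork_exp_tail h"
  have F: "val_ge (- s * real n - 1) (fps_nth ?F n)" for n
    unfolding fps_mult_nth
  proof (rule val_ge_sum)
    fix i assume i: "i \<in> {0..n}"
    have "val_ge ((- s * real i - 1) + - s * real (n - i)) (fps_nth (dwork_exp w) i * fps_nth (dwork_exp_tail h) (n - i))"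
      unfolding s_def by (intro val_ge_mult val_ge_dwork_exp_root_of_unity odd w val_ge_dwork_exp_tail h)
    also have "(- s * real i - 1) + - s * real (n - i) = - s * real n - 1"
      using i by (simp add: of_nat_diff algebra_simps)
    finally show "val_ge (- s * real n - 1) (fps_nth (dwork_exp w) i * fps_nth (dwork_exp_tail h) (n - i))" .
  qed
  have diff: "dwork_functional (dwork_exp (w + h)) c M - dwork_functional (dwork_exp w) c M =
      (- of_nat ?p) ^ M * fps_nth ?F (c + (?p - 1) * M - 1)" for M
  proof -
    have "dwork_exp (w + h) - dwork_exp w = dwork_arg * ?F"
      unfolding dwork_exp_add dwork_exp_eq_tail[of h] by (simp add: algebra_simps)
    then show ?thesis
      unfolding dwork_functional_diff[symmetric] by (simp only: dwork_functional_arg_mult[OF c])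
  qed
  have "padic_lim (\<lambda>M. dwork_functional (dwork_exp (w + h)) c M - dwork_functional (dwork_exp w) c M) 0"
  proof (rule padic_lim_0I[OF _ filterlim_dwork_rate[OF odd, of 4]])
    fix M
    define n where "n = c + (?p - 1) * M - 1"
    define r where "r = (q - 1) / (2 * q)"
    have n: "real n = real c + (q - 1) * real M - 1"
      using c by (simp add: n_def q_def of_nat_diff Suc_leI)
    have "- s * real n = - (s * real c) - s * (q - 1) * real M + s"
      unfolding n by (simp add: algebra_simps)
    moreover have "s * real c \<le> 1"
      using mult_mono[OF s(2), of "real c" q] s q c by (simp add: q_def)
    moreover have "r * real M = real M - s * (q - 1) * real M"
      unfolding s(3) r_def by (simp add: left_diff_distrib)
    ultimately have "r * real M - 4 \<le> real M + (- s * real n - 1)" using s(1) by linarith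
    moreover have "val_ge (real M + (- s * real n - 1)) ((- of_nat ?p) ^ M * fps_nth ?F n)"
      by (intro val_ge_mult val_ge_minus_prime_power F)
    ultimately have "val_ge (r * real M - 4) ((- of_nat ?p) ^ M * fps_nth ?F n)"
      by (rule val_ge_mono[rotated])
    then show "val_ge ((real ?p - 1) / (2 * real ?p) * real M - 4)
      (dwork_functional (dwork_exp (w + h)) c M - dwork_functional (dwork_exp w) c M)"
      unfolding diff n_def[symmetric] r_def q_def .
  qed
  from padic_lim_add[OF this padic_lim_cmult[OF lim, of "w ^ c"]]
  show ?thesis unfolding w_eq by simp
qed

text \<open>The square of partial sums exceeds the triangle only by products with
  \<open>k + l > M\<close>, whose valuation is at least \<open>\<rho> M - 2 C\<close>.\<close>

lemma padic_lim_cauchy_product: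
  fixes f g :: "nat \<Rightarrow> 'p::prime_card padic"
  assumes "\<rho> > 0" and f: "\<And>k. val_ge (\<rho> * real k - C) (f k)" and g: "\<And>k. val_ge (\<rho> * real k - C) (g k)"
    and limf: "padic_lim (\<lambda>M. \<Sum>k\<le>M. f k) A" and limg: "padic_lim (\<lambda>M. \<Sum>k\<le>M. g k) B"
  shows "padic_lim (\<lambda>M. \<Sum>m\<le>M. \<Sum>l\<le>m. f l * g (m - l)) (A * B)"
proof (rule padic_lim_transform[OF padic_lim_mult[OF limf limg]], rule padic_lim_0I)
  have "filterlim (\<lambda>M. \<rho> * real M) at_top sequentially"
    by (rule filterlim_tendsto_pos_mult_at_top[OF tendsto_const assms(1) filterlim_real_sequentially])
  from filterlim_tendsto_add_at_top[OF tendsto_const[of "- (2 * C)"] this]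
  show "filterlim (\<lambda>M. - (2 * C) + \<rho> * real M) at_top sequentially" .
  fix M :: nat
  let ?h = "\<lambda>(k, l). f k * g l"
  let ?T = "{(k, l). k + l \<le> M}"
  have sub: "?T \<subseteq> {..M} \<times> {..M}" by auto
  have "(\<Sum>k\<le>M. f k) * (\<Sum>l\<le>M. g l) = sum ?h ({..M} \<times> {..M})"
    by (simp add: sum_product sum.cartesian_product)
  moreover have "(\<Sum>m\<le>M. \<Sum>l\<le>m. f l * g (m - l)) = sum ?h ?T"
    by (rule sum.triangle_reindex_eq[symmetric])
  ultimately have "(\<Sum>k\<le>M. f k) * (\<Sum>l\<le>M. g l) - (\<Sum>m\<le>M. \<Sum>l\<le>m. f l * g (m - l)) =
    sum ?h ({..M} \<times> {..M} - ?T)"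
    using sub by (simp add: sum_diff)
  also have "val_ge (- (2 * C) + \<rho> * real M) \<dots>"
  proof (rule val_ge_sum)
    fix x assume "x \<in> {..M} \<times> {..M} - ?T"
    then obtain k l where x: "x = (k, l)" "M \<le> k + l" by (cases x) auto
    have "\<rho> * real M \<le> \<rho> * real (k + l)" using x assms(1) by (intro mult_left_mono) auto
    then have "- (2 * C) + \<rho> * real M \<le> (\<rho> * real k - C) + (\<rho> * real l - C)"
      by (simp add: algebra_simps)
    then show "val_ge (- (2 * C) + \<rho> * real M) (?h x)"
      using val_ge_mono[OF val_ge_mult[OF f g]] by (simp add: x)
  qed
  finally show "val_ge (- (2 * C) + \<rho> * real M)
    ((\<Sum>k\<le>M. f k) * (\<Sum>l\<le>M. g l) - (\<Sum>m\<le>M. \<Sum>l\<le>m. f l * g (m - l)))" .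
qed

text \<open>By continuity from the reflection formula at the integers \<open>- K (Suc n)\<close>,
  which approach \<open>z\<close>.\<close>

lemma padic_gamma_reflection:
  fixes z :: "'p::prime_card padic_int"
  assumes odd: "odd CARD('p)" and a: "a < CARD('p)"
    and z: "of_nat (CARD('p) - 1) * z = of_nat a"
  shows "padic_gamma z * padic_gamma (1 - z) = (- 1) ^ Suc a"
proof (rule padic_int_eqI)
  fix n
  let ?P = "of_nat CARD('p) :: 'p padic_int"
  obtain K :: "nat \<Rightarrow> nat" where K: "\<And>n. K (Suc n) = a + CARD('p) * K n"
      "\<And>n. K (Suc n) - K n = a * CARD('p) ^ n" "\<And>n. ?P ^ n dvd z + of_nat (K n)"
    using padic_int_digit_approx[OF z] by blast
  define k where "k = K (Suc n)"
  have k: "?P ^ n dvd z + of_nat k" using K(3)[of "Suc n"] unfolding k_def by (metis dvd_mult_right power_Suc)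
  have "?P ^ n dvd padic_gamma z - padic_gamma (- of_nat k)"
    by (rule padic_gamma_dvd_diff[OF odd]) (use k in simp)
  then have 1: "?P ^ n dvd (padic_gamma z - padic_gamma (- of_nat k)) * padic_gamma (1 - z)" by (rule dvd_mult2)
  have "?P ^ n dvd (1 - z) - (of_nat k + 1)" by (subst dvd_diff_swap) (use k in \<open>simp add: algebra_simps\<close>)
  then have "?P ^ n dvd padic_gamma (1 - z) - padic_gamma (of_nat k + 1)" by (rule padic_gamma_dvd_diff[OF odd])
  then have 2: "?P ^ n dvd padic_gamma (- of_nat k) * (padic_gamma (1 - z) - padic_gamma (of_nat k + 1))" by (rule dvd_mult)
  have "padic_gamma (- of_nat k) * padic_gamma (of_nat k + 1) = (- 1 :: 'p padic_int) ^ Suc a"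
    unfolding k_def by (rule padic_gamma_reflection_digit[OF odd K(1,2) a])
  then have "padic_gamma z * padic_gamma (1 - z) - (- 1) ^ Suc a =
    (padic_gamma z - padic_gamma (- of_nat k)) * padic_gamma (1 - z) +
    padic_gamma (- of_nat k) * (padic_gamma (1 - z) - padic_gamma (of_nat k + 1))"
    by (simp add: algebra_simps)
  then show "?P ^ n dvd padic_gamma z * padic_gamma (1 - z) - (- 1) ^ Suc a"
    using dvd_add[OF 1 2] by (simp only:)
qed

section \<open>Jacobi sums\<close>

text \<open>No root of unity reduces to 0, so \<open>teichmuller 0\<close> carries no information
  and the value 0 is set by hand.\<close>

definition teich :: "'p::prime_card mod_ring \<Rightarrow> 'p padic" where
  "teich t = (if t = 0 then 0 else to_fract (teichmuller t))"

lemma teich_0 [simp]: "teich 0 = 0" and teich_1 [simp]: "teich 1 = 1"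
  by (simp_all add: teich_def)

lemma teich_mult: "teich (s * t) = teich s * teich t"
  by (simp add: teich_def teichmuller_mult)

lemma teich_power: "teich (t ^ n) = teich t ^ n"
  by (induction n) (simp_all add: teich_mult)

lemma teich_minus: "odd CARD('p) \<Longrightarrow> teich (- t :: 'p::prime_card mod_ring) = - teich t"
  by (simp add: teich_def teichmuller_minus)

lemma teich_lift:
  obtains z where "teich t = to_fract z" "padic_reduce z = t"
proof (cases "t = 0")
  case True
  then show ?thesis using that[of 0] by (simp add: teich_def)
next
  case False
  then show ?thesis using that[of "teichmuller t"] padic_reduce_teichmuller[of t] by (simp add: teich_def)
qed

lemma teich_eq_0_iff [simp]: "teich t = 0 \<longleftrightarrow> t = 0"
  by (metis padic_reduce_0 teich_0 teich_lift to_fract_eq_0_iff)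

lemma teich_inject: "teich s = teich t \<longleftrightarrow> s = t"
  by (metis teich_lift to_fract_eq_iff)

lemma teich_inverse: "teich (inverse t) = inverse (teich t)"
proof (cases "t = 0")
  case False
  then have "teich (inverse t) * teich t = 1" by (simp flip: teich_mult)
  then show ?thesis by (metis inverse_unique mult.commute)
qed simp

lemma val_ge_teich [simp]: "val_ge 0 (teich t)"
  by (metis teich_lift val_ge_to_fract)

lemma teich_power_card_minus_1: "t \<noteq> 0 \<Longrightarrow> teich (t :: 'p::prime_card mod_ring) ^ (CARD('p) - 1) = 1"
  unfolding teich_power[symmetric] by (subst mod_ring_fermat) simp_all

lemma teich_power_card: "teich (t :: 'p::prime_card mod_ring) ^ CARD('p) = teich t"
proof (cases "t = 0")
  case False
  have "teich t ^ CARD('p) = teich t * teich t ^ (CARD('p) - 1)"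
    by (simp flip: power_Suc)
  then show ?thesis by (simp only: teich_power_card_minus_1[OF False] mult_1_right)
qed simp

text \<open>Both \<open>1 + teich t\<close> and \<open>teich (1 + t)\<close> reduce to
  \<open>1 + t\<close>, also for \<open>t = - 1\<close>. Their difference is the perturbation
  \<open>h\<close> to which local constancy applies.\<close>

lemma val_ge_teich_1_plus: "val_ge 1 (1 + teich t - teich (1 + t))"
proof -
  obtain y z where y: "teich t = to_fract y" "padic_reduce y = t"
    and z: "teich (1 + t) = to_fract z" "padic_reduce z = 1 + t"
    by (metis teich_lift)
  have "padic_reduce (1 + y) = padic_reduce z" using y z by simp
  then have "val_ge (real 1) (to_fract (1 + y - z))"
    unfolding val_ge_to_fract_iff padic_reduce_eq_iff by simp
  then show ?thesis by (simp add: y z)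
qed

text \<open>Orthogonality. If \<open>p - 1\<close> does not divide \<open>k\<close>, some nonzero
  \<open>s\<close> has \<open>s ^ k \<noteq> 1\<close>, because \<open>X ^ r - 1\<close> with
  \<open>r = k mod (p - 1)\<close> has fewer than \<open>p - 1\<close> roots; replacing
  \<open>t\<close> by \<open>s t\<close> then forces the sum to vanish.\<close>

lemma sum_teich_power:
  "(\<Sum>t\<in>UNIV - {0 :: 'p::prime_card mod_ring}. teich t ^ k) =
    (if CARD('p) - 1 dvd k then of_nat (CARD('p) - 1) else 0)"
proof (cases "CARD('p) - 1 dvd k")
  case True
  then obtain l where l: "k = (CARD('p) - 1) * l" by (auto simp: dvd_def)
  have "(\<Sum>t\<in>UNIV - {0 :: 'p mod_ring}. teich t ^ k) = (\<Sum>t\<in>UNIV - {0 :: 'p mod_ring}. 1)"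
  proof (rule sum.cong[OF refl])
    fix t :: "'p mod_ring" assume "t \<in> UNIV - {0}"
    then have "t \<noteq> 0" by simp
    from teich_power_card_minus_1[OF this] show "teich t ^ k = 1" by (simp only: l power_mult power_one)
  qed
  then show ?thesis using True by (simp add: card_Diff_singleton)
next
  case False
  let ?q = "CARD('p) - 1"
  define r where "r = k mod ?q"
  have r: "0 < r" "r < ?q" using False nontriv[where 'a='p] by (auto simp: r_def mod_eq_0_iff_dvd intro: Nat.gr0I)
  have "\<exists>s :: 'p mod_ring. s \<noteq> 0 \<and> s ^ k \<noteq> 1"
  proof (rule ccontr)
    assume "\<not> ?thesis"
    then have all: "s ^ k = 1" if "s \<noteq> 0" for s :: "'p mod_ring" using that by blast
    have "s ^ r = 1" if "s \<noteq> 0" for s :: "'p mod_ring"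
    proof -
      have "s ^ k = s ^ (?q * (k div ?q) + r)" by (simp only: r_def mult_div_mod_eq)
      also have "\<dots> = s ^ r" by (simp only: power_add power_mult mod_ring_fermat[OF that] power_one mult_1_left)
      finally show ?thesis using all[OF that] by simp
    qed
    then have sub: "UNIV - {0} \<subseteq> {s :: 'p mod_ring. poly (Polynomial.monom 1 r - 1) s = 0}"
      by (auto simp: Polynomial.poly_monom)
    have deg: "Polynomial.degree (Polynomial.monom 1 r - 1 :: 'p mod_ring poly) \<le> r"
      by (intro degree_diff_le) (simp_all add: Polynomial.degree_monom_le)
    have "Polynomial.coeff (Polynomial.monom 1 r - 1 :: 'p mod_ring poly) r = 1" using r by simp
    then have nz: "Polynomial.monom 1 r - 1 \<noteq> (0 :: 'p mod_ring poly)"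
      by (metis Polynomial.coeff_0 zero_neq_one)
    have "card (UNIV - {0 :: 'p mod_ring}) \<le> card {s :: 'p mod_ring. poly (Polynomial.monom 1 r - 1) s = 0}"
      by (rule card_mono[OF _ sub]) simp
    also have "\<dots> \<le> r" using poly_roots_degree[OF nz] deg by simp
    finally show False using r by (simp add: card_Diff_singleton)
  qed
  then obtain s :: "'p mod_ring" where s: "s \<noteq> 0" "s ^ k \<noteq> 1" by blast
  let ?S = "\<Sum>t\<in>UNIV - {0 :: 'p mod_ring}. teich t ^ k"
  have "?S = (\<Sum>t\<in>UNIV - {0}. teich (s * t) ^ k)"
    by (rule sum.reindex_bij_witness[of _ "\<lambda>t. s * t" "\<lambda>t. inverse s * t"]) (use s in \<open>auto simp: mult.assoc[symmetric]\<close>)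
  also have "\<dots> = teich s ^ k * ?S"
    by (simp add: teich_mult power_mult_distrib sum_distrib_left)
  finally have "(teich s ^ k - 1) * ?S = 0" by (simp add: algebra_simps)
  moreover have "teich s ^ k \<noteq> 1"
    using s(2) by (metis teich_1 teich_inject teich_power)
  ultimately show ?thesis using False by simp
qed

text \<open>In the product \<open>dwork_exp (teich u) * dwork_exp 1\<close> the variable
  \<open>u\<close> enters through \<open>teich u ^ j\<close>; orthogonality keeps the
  \<open>j\<close> congruent to \<open>- k\<close> modulo \<open>p - 1\<close>.\<close>

lemma sum_teich_dwork_exp_nth:
  fixes b n :: nat
  shows "(\<Sum>u\<in>UNIV - {0 :: 'p::prime_card mod_ring}. teich u ^ k * fps_nth (dwork_exp (1 + teich u)) n) =
    of_nat (CARD('p) - 1) * (\<Sum>j | j \<le> n \<and> CARD('p) - 1 dvd k + j. dwork_coeff j * dwork_coeff (n - j))"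
proof -
  let ?T = "UNIV - {0 :: 'p mod_ring}"
  have "fps_nth (dwork_exp (1 + teich u)) n =
    (\<Sum>j = 0..n. teich u ^ j * (dwork_coeff j * dwork_coeff (n - j)))" for u :: "'p mod_ring"
    unfolding add.commute[of 1] dwork_exp_add fps_mult_nth dwork_exp_nth_root_of_unity[OF teich_power_card]
    by (simp only: mult.assoc)
  then have "(\<Sum>u\<in>?T. teich u ^ k * fps_nth (dwork_exp (1 + teich u)) n) =
    (\<Sum>u\<in>?T. \<Sum>j = 0..n. teich u ^ (k + j) * (dwork_coeff j * dwork_coeff (n - j)))"
    by (simp only: sum_distrib_left power_add mult.assoc)
  also have "\<dots> = (\<Sum>j = 0..n. (\<Sum>u\<in>?T. teich u ^ (k + j)) * (dwork_coeff j * dwork_coeff (n - j)))"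
    by (subst sum.swap) (simp only: sum_distrib_right)
  also have "\<dots> = (\<Sum>j = 0..n. if CARD('p) - 1 dvd k + j
      then of_nat (CARD('p) - 1) * (dwork_coeff j * dwork_coeff (n - j)) else 0)"
    unfolding sum_teich_power by (intro sum.cong) auto
  also have "\<dots> = (\<Sum>j \<in> {j \<in> {0..n}. CARD('p) - 1 dvd k + j}.
      of_nat (CARD('p) - 1) * (dwork_coeff j * dwork_coeff (n - j)))"
    by (rule sum.inter_filter[symmetric]) simp
  also have "{j \<in> {0..n}. CARD('p) - 1 dvd k + j} = {j. j \<le> n \<and> CARD('p) - 1 dvd k + j}" by auto
  finally show ?thesis by (simp only: sum_distrib_left)
qed

text \<open>The condition means \<open>j\<close> congruent to \<open>b\<close> modulo
  \<open>q\<close>; as \<open>a < q\<close>, the upper bound allows exactly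
  \<open>l \<le> m\<close>.\<close>

lemma residue_class_atMost:
  fixes q :: nat
  assumes "a < q" "b < q"
  shows "{j. j \<le> a + b + q * m \<and> q dvd (q - b) + j} = (\<lambda>l. b + q * l) ` {..m}"
proof (intro equalityI subsetI)
  fix j assume "j \<in> {j. j \<le> a + b + q * m \<and> q dvd (q - b) + j}"
  then obtain s where s: "(q - b) + j = q * s" and j: "j \<le> a + b + q * m" by (auto simp: dvd_def)
  have "s \<noteq> 0" using s assms by (cases s) auto
  then obtain l where l: "s = Suc l" by (cases s) auto
  have jl: "j = b + q * l" using s assms by (simp add: l)
  have "l \<le> m"
  proof (rule ccontr)
    assume "\<not> l \<le> m"
    then have "q * Suc m \<le> q * l" by (intro mult_le_mono2) simp
    then show False using j jl assms by simp
  qed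
  then show "j \<in> (\<lambda>l. b + q * l) ` {..m}" using jl by auto
next
  fix j assume "j \<in> (\<lambda>l. b + q * l) ` {..m}"
  then obtain l where l: "l \<le> m" "j = b + q * l" by auto
  have "(q - b) + j = q * Suc l" using assms l by simp
  then have "q dvd (q - b) + j" by (simp only: dvd_triv_left)
  moreover have "j \<le> a + b + q * m" unfolding l(2) using mult_le_mono2[OF l(1), of q] by linarith
  ultimately show "j \<in> {j. j \<le> a + b + q * m \<and> q dvd (q - b) + j}" by blast
qed

lemma dwork_coeff_convolution:
  assumes "a < CARD('p) - 1" "b < CARD('p) - 1"
  shows "(- of_nat CARD('p)) ^ m * (\<Sum>j | j \<le> a + b + (CARD('p) - 1) * m \<and> CARD('p) - 1 dvd (CARD('p) - 1 - b) + j.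
      dwork_coeff j * dwork_coeff (a + b + (CARD('p) - 1) * m - j)) =
    (\<Sum>l\<le>m. (- of_nat CARD('p)) ^ l * dwork_coeff (b + (CARD('p) - 1) * l) *
      ((- of_nat CARD('p)) ^ (m - l) * dwork_coeff (a + (CARD('p) - 1) * (m - l))) :: 'p::prime_card padic)"
proof -
  define q where "q = CARD('p) - 1"
  let ?P = "- of_nat CARD('p) :: 'p padic"
  have inj: "inj_on (\<lambda>l. b + q * l) {..m}" using assms by (auto simp: inj_on_def q_def)
  have "?P ^ m * (\<Sum>j | j \<le> a + b + q * m \<and> q dvd (q - b) + j. dwork_coeff j * dwork_coeff (a + b + q * m - j)) =
    (\<Sum>l\<le>m. ?P ^ m * (dwork_coeff (b + q * l) * dwork_coeff (a + b + q * m - (b + q * l))))"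
    unfolding residue_class_atMost[OF assms[folded q_def]] sum.reindex[OF inj] comp_def sum_distrib_left ..
  also have "\<dots> = (\<Sum>l\<le>m. ?P ^ l * dwork_coeff (b + q * l) * (?P ^ (m - l) * dwork_coeff (a + q * (m - l))))"
  proof (rule sum.cong[OF refl])
    fix l assume "l \<in> {..m}"
    then have l: "l \<le> m" by simp
    have "a + b + q * m - (b + q * l) = a + q * (m - l)"
      using l mult_le_mono2[OF l, of q] by (simp add: diff_mult_distrib2)
    moreover have "?P ^ m = ?P ^ l * ?P ^ (m - l)" using l by (simp flip: power_add)
    ultimately show "?P ^ m * (dwork_coeff (b + q * l) * dwork_coeff (a + b + q * m - (b + q * l))) =
      ?P ^ l * dwork_coeff (b + q * l) * (?P ^ (m - l) * dwork_coeff (a + q * (m - l)))"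
      by (simp only: mult_ac)
  qed
  finally show ?thesis unfolding q_def .
qed

lemma padic_lim_shift: "padic_lim X L \<Longrightarrow> padic_lim (\<lambda>n. X (n + k)) L"
  unfolding padic_lim_def by (auto intro!: eventually_sequentially_seg[THEN iffD2])

text \<open>The sum \<open>X\<close> of functionals is evaluated twice: local constancy gives a
  Jacobi sum times \<open>Lc\<close>, and orthogonality gives the Cauchy product of two trace
  series. The carry \<open>e\<close> in \<open>a + b\<close> shifts the index, hence the factor
  \<open>(- p) ^ e\<close>.\<close>

lemma sum_teich_eq_trace_limits:
  fixes La Lb Lc :: "'p::prime_card padic"
  assumes odd: "odd CARD('p)" and a: "a < CARD('p) - 1" and b: "b < CARD('p) - 1"
    and c: "0 < c" "c < CARD('p) - 1" and e: "e \<le> 1" and abc: "a + b = c + (CARD('p) - 1) * e"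
    and La: "padic_lim (dwork_trace a) La" and Lb: "padic_lim (dwork_trace b) Lb"
    and Lc: "padic_lim (dwork_trace c) Lc"
  shows "(\<Sum>u\<in>UNIV - {0 :: 'p mod_ring}. teich u ^ (CARD('p) - 1 - b) * teich (1 + u) ^ c) * Lc =
    of_nat (CARD('p) - 1) * (- of_nat CARD('p)) ^ e * (Lb * La)"
proof -
  define q where "q = CARD('p) - 1"
  let ?P = "- of_nat CARD('p) :: 'p padic"
  let ?T = "UNIV - {0 :: 'p mod_ring}"
  define X where "X = (\<lambda>M. \<Sum>u\<in>?T. teich u ^ (q - b) * dwork_functional (dwork_exp (1 + teich u)) c M)"
  have "padic_lim X (\<Sum>u\<in>?T. teich u ^ (q - b) * (teich (1 + u) ^ c * Lc))"
    unfolding X_def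
  proof (rule padic_lim_sum, rule padic_lim_cmult)
    fix u :: "'p mod_ring"
    have "padic_lim (dwork_functional (dwork_exp (teich (1 + u) + (1 + teich u - teich (1 + u)))) c) (teich (1 + u) ^ c * Lc)"
      using c by (intro padic_lim_dwork_functional odd teich_power_card val_ge_teich val_ge_teich_1_plus Lc) auto
    then show "padic_lim (dwork_functional (dwork_exp (1 + teich u)) c) (teich (1 + u) ^ c * Lc)"
      by simp
  qed
  then have lim1: "padic_lim (\<lambda>M. X (M + e)) ((\<Sum>u\<in>?T. teich u ^ (q - b) * teich (1 + u) ^ c) * Lc)"
    by (intro padic_lim_shift) (simp add: sum_distrib_right mult.assoc)
  define C where "C = (\<lambda>n. \<Sum>j | j \<le> n \<and> q dvd (q - b) + j. dwork_coeff j * dwork_coeff (n - j) :: 'p padic)"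
  define f where "f = (\<lambda>l. ?P ^ l * dwork_coeff (b + q * l))"
  define g where "g = (\<lambda>l. ?P ^ l * dwork_coeff (a + q * l))"
  define Q where "Q = (\<lambda>M. \<Sum>m\<le>M. \<Sum>l\<le>m. f l * g (m - l))"
  have "X M = (\<Sum>m\<le>M. ?P ^ m * (\<Sum>u\<in>?T. teich u ^ (q - b) * fps_nth (dwork_exp (1 + teich u)) (c + q * m)))" for M
    unfolding X_def dwork_functional_def q_def[symmetric] sum_distrib_left
    by (subst sum.swap) (simp only: mult.left_commute)
  then have X: "X M = of_nat q * (\<Sum>m\<le>M. ?P ^ m * C (c + q * m))" for M
    unfolding q_def sum_teich_dwork_exp_nth C_def by (simp only: sum_distrib_left mult.left_commute)
  have C: "?P ^ m * C (a + b + q * m) = (\<Sum>l\<le>m. f l * g (m - l))" for m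
    using dwork_coeff_convolution[OF a b, of m] unfolding C_def f_def g_def q_def .
  have XQ: "X (M + e) = of_nat q * ?P ^ e * Q M" for M
  proof (cases "e = 0")
    case True
    then have "c + q * m = a + b + q * m" for m using abc by simp
    then show ?thesis unfolding X Q_def C[symmetric] using True by simp
  next
    case False
    then have e1: "e = 1" using e by simp
    then have ab: "a + b = c + q" using abc by (simp add: q_def)
    \<comment> \<open>A carry makes \<open>c < b\<close>, so no degree up to \<open>c\<close> is
      congruent to \<open>b\<close>: the summand of index 0 vanishes and the index moves by
      one.\<close>
    have "C c = 0"
    proof -
      have "{j. j \<le> c \<and> q dvd (q - b) + j} = {}"
      proof (intro equals0I)
        fix j assume "j \<in> {j. j \<le> c \<and> q dvd (q - b) + j}"
        then have "q \<le> (q - b) + j" "j \<le> c" using b by (auto simp: q_def dest: dvd_imp_le)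
        then show False using ab a b by (simp add: q_def)
      qed
      then show ?thesis unfolding C_def by (simp only: sum.empty)
    qed
    moreover have "c + q * Suc m = a + b + q * m" for m using ab by simp
    ultimately have "(\<Sum>m\<le>Suc M. ?P ^ m * C (c + q * m)) = (\<Sum>m\<le>M. ?P * (?P ^ m * C (a + b + q * m)))"
      by (subst sum.atMost_Suc_shift) (simp del: mult_Suc_right add: mult.assoc)
    also have "\<dots> = ?P * Q M" unfolding C Q_def sum_distrib_left ..
    finally show ?thesis unfolding X e1 by simp
  qed
  define \<rho> where "\<rho> = (real CARD('p) - 1) / (2 * real CARD('p))"
  have "padic_lim Q (Lb * La)" unfolding Q_def
  proof (rule padic_lim_cauchy_product[of \<rho> 4])
    show "\<rho> > 0" using nontriv[where 'a='p] by (simp add: \<rho>_def)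
    show "val_ge (\<rho> * real k - 4) (f k)" "val_ge (\<rho> * real k - 4) (g k)" for k
      unfolding f_def g_def \<rho>_def q_def
      by (rule val_ge_dwork_trace_term[OF odd]; use a b in simp)+
    show "padic_lim (\<lambda>M. \<Sum>k\<le>M. f k) Lb" using Lb unfolding f_def q_def dwork_trace_def by simp
    show "padic_lim (\<lambda>M. \<Sum>k\<le>M. g k) La" using La unfolding g_def q_def dwork_trace_def by simp
  qed
  then have "padic_lim (\<lambda>M. of_nat q * ?P ^ e * Q M) (of_nat q * ?P ^ e * (Lb * La))"
    by (rule padic_lim_cmult)
  then show ?thesis using padic_lim_unique[OF lim1] unfolding XQ q_def by blast
qed

section \<open>Gamma values at a / (p - 1)\<close>

lemma padic_int_of_rat_digit:
  "of_nat (CARD('p) - 1) * padic_int_of_rat (of_nat a / of_nat (CARD('p) - 1)) = (of_nat a :: 'p::prime_card padic_int)"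
proof -
  let ?q = "CARD('p) - 1"
  have q: "?q > 0" using nontriv[where 'a='p] by simp
  have "\<not> CARD('p) dvd ?q" using q by (auto dest: dvd_imp_le)
  then have "(of_nat ?q :: 'p padic_int) dvd 1"
    using prime_dvd_padic_of_nat_iff padic_unitI by blast
  then obtain w where "1 = of_nat ?q * (w :: 'p padic_int)" by (rule dvdE)
  then have z: "of_nat ?q * (w * of_nat a) = (of_nat a :: 'p padic_int)"
    by (simp flip: mult.assoc)
  have "padic_int_of_rat (of_nat a / of_nat ?q) = w * of_nat a"
    by (rule padic_int_of_rat_eqI[of "int ?q" _ "int a"]) (use q z in auto)
  then show ?thesis using z by simp
qed

definition gamma_digit :: "nat \<Rightarrow> 'p::prime_card padic" where
  "gamma_digit a = padic_gamma_rat (of_nat a / of_nat (CARD('p) - 1))"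

lemma gamma_digit_nonzero:
  assumes "odd CARD('p)"
  shows "gamma_digit a \<noteq> (0 :: 'p::prime_card padic)"
  using padic_gamma_unit[OF assms, of "padic_int_of_rat (of_nat a / of_nat (CARD('p) - 1))"]
  by (auto simp: gamma_digit_def padic_gamma_rat_def)

lemma gamma_digit_0 [simp]:
  assumes "odd CARD('p)"
  shows "gamma_digit 0 = (1 :: 'p::prime_card padic)"
proof -
  have "padic_int_of_rat 0 = (0 :: 'p padic_int)" by (rule padic_int_of_rat_eqI[of 1 0 0]) auto
  then show ?thesis using assms by (simp add: gamma_digit_def padic_gamma_rat_def)
qed

lemma gamma_digit_reflection:
  assumes odd: "odd CARD('p)" and a: "a \<le> CARD('p) - 1"
  shows "gamma_digit a * gamma_digit (CARD('p) - 1 - a) = ((- 1) ^ Suc a :: 'p::prime_card padic)"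
proof -
  let ?q = "CARD('p) - 1"
  let ?z = "\<lambda>a. padic_int_of_rat (of_nat a / of_nat ?q) :: 'p padic_int"
  have "(of_nat ?q :: 'p padic_int) * ?z (?q - a) = of_nat ?q * (1 - ?z a)"
    unfolding padic_int_of_rat_digit right_diff_distrib by (simp only: of_nat_diff[OF a] mult_1_right)
  moreover have "(of_nat ?q :: 'p padic_int) \<noteq> 0" using nontriv[where 'a='p] by (simp only: of_nat_eq_0_iff)
  ultimately have "?z (?q - a) = 1 - ?z a" by simp
  moreover have "padic_gamma (?z a) * padic_gamma (1 - ?z a) = (- 1) ^ Suc a"
    using a zero_less_card_finite[where 'a='p]
    by (intro padic_gamma_reflection odd padic_int_of_rat_digit) linarith
  ultimately have "to_fract (padic_gamma (?z a) * padic_gamma (?z (?q - a))) = to_fract ((- 1) ^ Suc a)"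
    by (simp only:)
  then show ?thesis by (simp add: gamma_digit_def padic_gamma_rat_def)
qed

lemma padic_lim_dwork_trace_gamma_digit:
  assumes odd: "odd CARD('p)" and a: "a < CARD('p)"
  shows "padic_lim (dwork_trace a) (gamma_digit a / (1 - of_nat CARD('p)) :: 'p::prime_card padic)"
proof -
  have nz: "(1 - of_nat CARD('p) :: 'p padic) \<noteq> 0"
    using nontriv[where 'a='p] by (metis eq_iff_diff_eq_0 less_irrefl of_nat_1 of_nat_eq_iff)
  have "padic_lim (\<lambda>M. 1 / (1 - of_nat CARD('p)) * ((1 - of_nat CARD('p)) * dwork_trace a M))
    (1 / (1 - of_nat CARD('p)) * (gamma_digit a :: 'p padic))"
    unfolding gamma_digit_def padic_gamma_rat_def
    by (intro padic_lim_cmult padic_lim_dwork_trace odd a padic_int_of_rat_digit)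
  then show ?thesis using nz by simp
qed

text \<open>
  The substitution \<open>u = (1 - t)/t\<close> turns this sum into \<open>\<Sum>\<^sub>t \<omega>(t)\<^sup>-\<^sup>a \<omega>(1 - t)\<^sup>-\<^sup>b\<close>, so this is the
  Gross--Koblitz formula for Jacobi sums.
\<close>

lemma sum_teich_eq_gamma_digit:
  assumes odd: "odd CARD('p::prime_card)" and a: "a < CARD('p) - 1" and b: "b < CARD('p) - 1"
    and c: "0 < c" "c < CARD('p) - 1" and e: "e \<le> 1" and abc: "a + b = c + (CARD('p) - 1) * e"
  shows "(\<Sum>u\<in>UNIV - {0 :: 'p mod_ring}. teich u ^ (CARD('p) - 1 - b) * teich (1 + u) ^ c) * gamma_digit c =
    - ((- of_nat CARD('p)) ^ e * (gamma_digit a * gamma_digit b))"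
proof -
  define r where "r = (1 - of_nat CARD('p) :: 'p padic)"
  have r: "r \<noteq> 0"
    using nontriv[where 'a='p] unfolding r_def by (metis eq_iff_diff_eq_0 less_irrefl of_nat_1 of_nat_eq_iff)
  have q: "of_nat (CARD('p) - 1) = - r" by (simp add: r_def of_nat_diff Suc_leI)
  note lim = padic_lim_dwork_trace_gamma_digit[OF odd, folded r_def]
  let ?S = "\<Sum>u\<in>UNIV - {0 :: 'p mod_ring}. teich u ^ (CARD('p) - 1 - b) * teich (1 + u) ^ c"
  have "?S * (gamma_digit c / r) = - r * (- of_nat CARD('p)) ^ e * ((gamma_digit b / r) * (gamma_digit a / r))"
    unfolding q[symmetric] by (rule sum_teich_eq_trace_limits[OF odd a b c e abc lim lim lim]) (use a b c in auto)
  then show ?thesis using r by (simp add: field_simps)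
qed

text \<open>Euler's criterion gives the congruence modulo \<open>p\<close>. Both sides are 0, 1 or
  -1, which are distinct modulo an odd prime.\<close>

lemma quadratic_char_eq_teich:
  fixes t :: "'p::prime_card mod_ring"
  assumes odd: "odd CARD('p)"
  shows "of_int (quadratic_char t) = teich t ^ ((CARD('p) - 1) div 2)"
proof (cases "t = 0")
  case True
  have "CARD('p) - 1 \<ge> 2" using card_ge_3[OF odd] by simp
  then have "(CARD('p) - 1) div 2 > 0" by simp
  moreover have "to_int_mod_ring (0 :: 'p mod_ring) = 0" by transfer simp
  ultimately show ?thesis using True by (simp add: quadratic_char_def Legendre_def cong_def power_0_left)
next
  case False
  define h where "h = (CARD('p) - 1) div 2"
  define k where "k = to_int_mod_ring t"
  have hh: "h * 2 = CARD('p) - 1" using odd by (simp add: h_def)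
  have tk: "of_int k = t" by (simp add: k_def of_int_of_int_mod_ring)
  have "[Legendre k (int CARD('p)) = k ^ h] (mod int CARD('p))"
    unfolding h_def using prime_card[where 'a='p] card_ge_3[OF odd] by (intro euler_criterion) auto
  then have "(of_int (Legendre k (int CARD('p))) :: 'p mod_ring) = of_int (k ^ h)"
    unfolding cong_def by (metis of_int_mod_card)
  then have leg: "of_int (quadratic_char t) = t ^ h" by (simp add: quadratic_char_def k_def[symmetric] tk)
  have "(teich t ^ h) ^ 2 = 1"
    unfolding power_mult[symmetric] hh by (rule teich_power_card_minus_1[OF False])
  then have pm: "teich t ^ h = 1 \<or> teich t ^ h = - 1" by (simp only: power2_eq_1_iff)
  have eq1: "teich t ^ h = 1 \<longleftrightarrow> t ^ h = 1"
    by (metis teich_1 teich_inject teich_power)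
  have eqm1: "teich t ^ h = - 1 \<longleftrightarrow> t ^ h = - 1"
    using teich_minus[OF odd, of 1] by (metis teich_1 teich_inject teich_power)
  have ne: "(1 :: 'p mod_ring) \<noteq> - 1"
  proof
    assume "(1 :: 'p mod_ring) = - 1"
    then have "teich (1 :: 'p mod_ring) = teich (- 1)" by (rule arg_cong)
    then have "(1 :: 'p padic) = - 1" by (simp only: teich_minus[OF odd] teich_1)
    then show False by simp
  qed
  have th0: "t ^ h \<noteq> 0" using False by simp
  have "quadratic_char t \<in> {0, 1, - 1}" by (auto simp: quadratic_char_def Legendre_def)
  then have "quadratic_char t = 0 \<or> quadratic_char t = 1 \<or> quadratic_char t = - 1" by blast
  then have "of_int (quadratic_char t) = teich t ^ h"
  proof (elim disjE)
    assume "quadratic_char t = 0"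
    then show ?thesis using leg th0 by simp
  next
    assume q: "quadratic_char t = 1"
    then have "t ^ h = 1" using leg by simp
    then show ?thesis using q eq1 by simp
  next
    assume q: "quadratic_char t = - 1"
    then have "t ^ h = - 1" using leg by simp
    then show ?thesis using q eqm1 by simp
  qed
  then show ?thesis by (simp only: h_def)
qed

definition quadratic_jacobi :: "nat \<Rightarrow> 'p::prime_card itself \<Rightarrow> 'p padic" where
  "quadratic_jacobi j _ = (\<Sum>t\<in>(UNIV :: 'p mod_ring set). of_int (quadratic_char (1 - t)) * inv_teichmuller_power j t)"

text \<open>Substitute \<open>t = 1 / (1 + u)\<close>. As \<open>1 - t = u / (1 + u)\<close>, the
  exponent of \<open>1 + u\<close> is \<open>j - h\<close> with \<open>h = (p - 1) / 2\<close>;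
  \<open>c\<close> is a positive number in its class modulo \<open>p - 1\<close>, so the term at
  \<open>u = - 1\<close> vanishes.\<close>

lemma quadratic_jacobi_eq:
  assumes odd: "odd CARD('p::prime_card)" and c: "c > 0"
    and cj: "(CARD('p) - 1) div 2 + c = j + (CARD('p) - 1) * k"
  shows "quadratic_jacobi j TYPE('p) =
    (\<Sum>u\<in>UNIV - {0 :: 'p mod_ring}. teich u ^ ((CARD('p) - 1) div 2) * teich (1 + u) ^ c)"
proof -
  define h where "h = (CARD('p) - 1) div 2"
  have h: "h > 0" using card_ge_3[OF odd] by (simp add: h_def)
  have "quadratic_jacobi j TYPE('p) =
    (\<Sum>t\<in>UNIV - {0, 1 :: 'p mod_ring}. teich (1 - t) ^ h * inverse (teich t) ^ j)"
    unfolding quadratic_jacobi_def quadratic_char_eq_teich[OF odd] h_def[symmetric]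
  proof (rule sum.mono_neutral_cong_right)
    show "\<forall>t\<in>UNIV - (UNIV - {0, 1}). teich (1 - t) ^ h * inv_teichmuller_power j t = 0"
      using h by (auto simp: inv_teichmuller_power_def)
  qed (auto simp: inv_teichmuller_power_def teich_def)
  also have "\<dots> = (\<Sum>u\<in>UNIV - {0, - 1 :: 'p mod_ring}. teich u ^ h * teich (1 + u) ^ c)"
  proof (rule sum.reindex_bij_witness[of _ "\<lambda>u. inverse (1 + u)" "\<lambda>t. (1 - t) / t"])
    fix t :: "'p mod_ring" assume "t \<in> UNIV - {0, 1}"
    then have t: "t \<noteq> 0" "t \<noteq> 1" by auto
    have u: "1 + (1 - t) / t = inverse t" using t by (simp add: field_simps)
    show "inverse (1 + (1 - t) / t) = t" unfolding u by simp
    have "(1 - t) / t \<noteq> - 1" using u t by (metis add.right_inverse inverse_zero_imp_zero)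
    then show "(1 - t) / t \<in> UNIV - {0, - 1}" using t by auto
    have "teich ((1 - t) / t) ^ h * teich (1 + (1 - t) / t) ^ c = teich (1 - t) ^ h * inverse (teich t) ^ (h + c)"
      unfolding u by (simp add: divide_inverse teich_mult teich_inverse power_mult_distrib power_add mult.assoc)
    also have "inverse (teich t) ^ (h + c) = inverse (teich t) ^ j * inverse (teich t ^ (CARD('p) - 1)) ^ k"
      unfolding cj[folded h_def] by (simp add: power_add power_mult power_inverse)
    also have "\<dots> = inverse (teich t) ^ j" by (simp only: teich_power_card_minus_1[OF t(1)]) simp
    finally show "teich ((1 - t) / t) ^ h * teich (1 + (1 - t) / t) ^ c = teich (1 - t) ^ h * inverse (teich t) ^ j" .
  next
    fix u :: "'p mod_ring" assume "u \<in> UNIV - {0, - 1}"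
    then have u: "u \<noteq> 0" "1 + u \<noteq> 0" by (auto simp: eq_neg_iff_add_eq_0 add.commute)
    then show "(1 - inverse (1 + u)) / inverse (1 + u) = u" by (simp add: field_simps)
    show "inverse (1 + u) \<in> UNIV - {0, 1}" using u by (auto simp: inverse_eq_1_iff)
  qed
  also have "\<dots> = (\<Sum>u\<in>UNIV - {0 :: 'p mod_ring}. teich u ^ h * teich (1 + u) ^ c)"
    by (rule sum.mono_neutral_left) (use c in auto)
  finally show ?thesis unfolding h_def .
qed

text \<open>Here the exponent of \<open>1 + u\<close> is a multiple of \<open>p - 1\<close>, outside
  the range of \<open>sum_teich_eq_gamma_digit\<close>. That factor only removes
  \<open>u = - 1\<close>, and the full sum is 0 by orthogonality.\<close>

lemma quadratic_jacobi_middle: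
  assumes odd: "odd CARD('p::prime_card)" and j: "j = (CARD('p) - 1) div 2"
  shows "quadratic_jacobi j TYPE('p) = - ((- 1) ^ j)"
proof -
  define q where "q = CARD('p) - 1"
  have "2 * (q div 2) = q" using odd by (simp add: q_def)
  then have q: "q > 0" "j + j = q" using card_ge_3[OF odd] by (auto simp: q_def j)
  have j0: "0 < j" "j < q" using card_ge_3[OF odd] by (auto simp: j q_def)
  have "quadratic_jacobi j TYPE('p) = (\<Sum>u\<in>UNIV - {0 :: 'p mod_ring}. teich u ^ j * teich (1 + u) ^ q)"
    using quadratic_jacobi_eq[OF odd q(1), of j 1] by (simp add: j q_def)
  also have "\<dots> = (\<Sum>u\<in>UNIV - {0 :: 'p mod_ring}. teich u ^ j - (if u = - 1 then (- 1) ^ j else 0))"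
  proof (rule sum.cong[OF refl])
    fix u :: "'p mod_ring"
    show "teich u ^ j * teich (1 + u) ^ q = teich u ^ j - (if u = - 1 then (- 1) ^ j else 0)"
    proof (cases "u = - 1")
      case True
      then show ?thesis using q(1) teich_minus[OF odd, of 1] by simp
    next
      case False
      then have "1 + u \<noteq> 0" by (metis add_eq_0_iff)
      from teich_power_card_minus_1[OF this] show ?thesis using False by (simp add: q_def)
    qed
  qed
  also have "\<dots> = - ((- 1) ^ j)"
  proof -
    have "\<not> q dvd j" using j0 by (auto dest: dvd_imp_le)
    then show ?thesis unfolding sum_subtractf sum_teich_power by (simp add: q_def sum.delta')
  qed
  finally show ?thesis .
qed

section \<open>McCarthy series\<close>

text \<open>The exponent of \<open>- p\<close> is a sum of one part from each parameter, so every
  factor of the series splits and the two parameter lists can be treated separately.\<close>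

definition mccarthy_upper :: "nat \<Rightarrow> rat \<Rightarrow> 'p::prime_card padic" where
  "mccarthy_upper j a = (let u = of_nat j / of_nat (CARD('p) - 1) in
    (- of_nat CARD('p)) powi (- \<lfloor>frac a - u\<rfloor>) * (padic_gamma_rat (frac (a - u)) / padic_gamma_rat (frac a)))"

definition mccarthy_lower :: "nat \<Rightarrow> rat \<Rightarrow> 'p::prime_card padic" where
  "mccarthy_lower j b = (let u = of_nat j / of_nat (CARD('p) - 1) in
    (- of_nat CARD('p)) powi (- \<lfloor>frac (- b) + u\<rfloor>) * (padic_gamma_rat (frac (- b + u)) / padic_gamma_rat (frac (- b))))"

lemma mccarthy_G_eq:
  assumes "length as = length bs"
  shows "mccarthy_G as bs (t :: 'p::prime_card mod_ring) = (- 1) / of_nat (CARD('p) - 1) *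
    (\<Sum>j = 0..CARD('p) - 2. (- 1) ^ (j * length as) * inv_teichmuller_power j t *
      (prod_list (map (mccarthy_upper j) as) * prod_list (map (mccarthy_lower j) bs)))"
proof -
  have nz: "(- of_nat CARD('p) :: 'p padic) \<noteq> 0" by simp
  have fac: "(- of_nat CARD('p)) powi (- \<lfloor>frac a - u\<rfloor> - \<lfloor>frac (- b) + u\<rfloor>)
      * (padic_gamma_rat (frac (a - u)) / padic_gamma_rat (frac a))
      * (padic_gamma_rat (frac (- b + u)) / padic_gamma_rat (frac (- b))) =
    (mccarthy_upper j a * mccarthy_lower j b :: 'p padic)" if "u = of_nat j / of_nat (CARD('p) - 1)" for a b u j
    unfolding mccarthy_upper_def mccarthy_lower_def that[symmetric] Let_def diff_conv_add_uminus[of "- \<lfloor>frac a - u\<rfloor>"]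
      power_int_add[OF disjI1[OF nz]]
    by (simp only: mult_ac)
  have "(\<Prod>i<length as. mccarthy_upper j (as ! i) * mccarthy_lower j (bs ! i)) =
    (prod_list (map (mccarthy_upper j) as) * prod_list (map (mccarthy_lower j) bs) :: 'p padic)" for j
    using assms by (simp add: prod.distrib prod.list_conv_set_nth atLeast0LessThan)
  then show ?thesis unfolding mccarthy_G_def Let_def by (simp only: fac[OF refl])
qed

lemma prod_list_map_remove:
  fixes f :: "'a \<Rightarrow> 'b::comm_monoid_mult"
  assumes "distinct xs" "x \<in> set xs"
  shows "prod_list (map f xs) = f x * prod_list (map f (filter (\<lambda>y. y \<noteq> x) xs))"
proof -
  have "prod_list (map f xs) = prod f (set xs)" using assms by (simp add: prod.distinct_set_conv_list)
  also have "\<dots> = f x * prod f (set xs - {x})" using assms by (intro prod.remove) auto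
  also have "set xs - {x} = set (filter (\<lambda>y. y \<noteq> x) xs)" by auto
  also have "prod f \<dots> = prod_list (map f (filter (\<lambda>y. y \<noteq> x) xs))"
    using assms by (intro prod.distinct_set_conv_list) simp
  finally show ?thesis .
qed

text \<open>The cases follow the sign of \<open>1 / 2 - j / (p - 1)\<close>. Below the middle
  \<open>c = j + h\<close>, without carry; above it \<open>c = j - h\<close>, and the factor
  \<open>- p\<close> of the carry matches the floor -1. Reflection then moves
  \<open>gamma_digit c\<close> to the other side.\<close>

lemma quadratic_jacobi_eq_mccarthy:
  assumes odd: "odd CARD('p::prime_card)" and j: "j \<le> CARD('p) - 2"
  shows "quadratic_jacobi j TYPE('p) = - ((- 1) ^ j * (mccarthy_upper j (1 / 2) * mccarthy_lower j 0))"
proof -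
  define q where "q = CARD('p) - 1"
  define h where "h = q div 2"
  let ?g = "gamma_digit :: nat \<Rightarrow> 'p padic"
  have p: "CARD('p) \<ge> 3" by (rule card_ge_3[OF odd])
  have "2 * (q div 2) = q" using odd by (simp add: q_def)
  then have q: "q = h + h" "h > 0" using p by (auto simp: h_def q_def)
  have jq: "j < q" using j p by (simp add: q_def)
  define u :: rat where "u = of_nat j / of_nat q"
  have q0: "(of_nat q :: rat) > 0" using q by simp
  have u: "0 \<le> u" "u < 1" using jq q0 by (auto simp: u_def)
  have half: "(1 / 2 :: rat) = of_nat h / of_nat q" using q by simp
  have g_half: "padic_gamma_rat (1 / 2) = ?g h" unfolding half gamma_digit_def q_def ..
  have g_u: "padic_gamma_rat u = ?g j" by (simp add: gamma_digit_def u_def q_def)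
  have frac_half: "frac (1 / 2 :: rat) = 1 / 2" by (simp add: frac_eq)
  have frac_u: "frac u = u" using u by (simp add: frac_eq)
  have g_0: "padic_gamma_rat 0 = (1 :: 'p padic)" using gamma_digit_0[OF odd] by (simp add: gamma_digit_def)
  have "\<lfloor>u\<rfloor> = 0" using u by (simp add: floor_eq_iff)
  then have lower: "mccarthy_lower j 0 = ?g j"
    unfolding mccarthy_lower_def Let_def q_def[symmetric] u_def[symmetric] by (simp add: frac_u g_u g_0)
  have upper: "mccarthy_upper j (1 / 2) = (- of_nat CARD('p)) powi (- \<lfloor>1 / 2 - u\<rfloor>) * (padic_gamma_rat (frac (1 / 2 - u)) / ?g h)"
    unfolding mccarthy_upper_def Let_def q_def[symmetric] u_def[symmetric] frac_half g_half ..
  have nz: "?g a \<noteq> 0" for a by (rule gamma_digit_nonzero[OF odd])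
  \<comment> \<open>The argument 1/2 is its own reflection partner, so the square is a sign and a
    factor \<open>?g h\<close> can be traded for its reciprocal.\<close>
  have hh: "?g h * ?g h = (- 1) ^ Suc h"
  proof -
    have "h \<le> q" "q - h = h" using q by simp_all
    then show ?thesis using gamma_digit_reflection[OF odd, of h] unfolding q_def[symmetric] by simp
  qed
  have qh: "q - h = h" using q by simp
  note gk = sum_teich_eq_gamma_digit[OF odd, folded q_def]
  note jac = quadratic_jacobi_eq[OF odd, folded q_def, folded h_def]
  consider "j < h" | "j = h" | "h < j" by linarith
  then show ?thesis
  proof cases
    case 1
    define c where "c = j + h"
    have c: "0 < c" "c < q" using 1 q by (auto simp: c_def)
    have "1 / 2 - u = of_nat (h - j) / of_nat q"
      unfolding half u_def using 1 by (simp add: of_nat_diff diff_divide_distrib)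
    then have g: "padic_gamma_rat (1 / 2 - u) = ?g (h - j)" by (simp add: gamma_digit_def q_def)
    have "1 / 2 - u < 1" using u by simp
    moreover have "0 \<le> 1 / 2 - u" unfolding half u_def using 1 q0 by (simp add: divide_right_mono)
    ultimately have "frac (1 / 2 - u) = 1 / 2 - u" "\<lfloor>1 / 2 - u\<rfloor> = 0" by (simp_all add: frac_eq floor_eq_iff)
    then have up: "mccarthy_upper j (1 / 2) = ?g (h - j) / ?g h" unfolding upper using g by simp
    have refl: "?g c * ?g (h - j) = (- 1) ^ Suc c"
    proof -
      have "c \<le> q" "q - c = h - j" using c q by (simp_all add: c_def)
      then show ?thesis using gamma_digit_reflection[OF odd, of c] unfolding q_def[symmetric] by simp
    qed
    have "quadratic_jacobi j TYPE('p) = (\<Sum>u\<in>UNIV - {0 :: 'p mod_ring}. teich u ^ (q - h) * teich (1 + u) ^ c)"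
      unfolding qh by (rule jac[OF c(1), of j 1]) (use q in \<open>simp add: c_def\<close>)
    moreover have "\<dots> * ?g c = - ((- of_nat CARD('p)) ^ 0 * (?g j * ?g h))"
      by (rule gk) (use 1 c jq q in \<open>auto simp: c_def\<close>)
    ultimately have "quadratic_jacobi j TYPE('p) * ?g c = - (?g j * ?g h)" by simp
    also have "?g j * ?g h = (- 1) ^ j * (?g (h - j) / ?g h * ?g j) * ?g c"
    proof -
      have "(- 1) ^ j * (?g (h - j) * ?g j) * ?g c = (- 1) ^ j * ?g j * (?g c * ?g (h - j))" by (simp only: mult_ac)
      also have "\<dots> = ?g j * ((- 1) ^ j * (- 1) ^ Suc c)" unfolding refl by (simp only: mult_ac)
      also have "(- 1) ^ j * (- 1) ^ Suc c = ((- 1) ^ Suc h :: 'p padic)" by (simp add: c_def power_add)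
      finally have "?g j * ?g h * ?g h = (- 1) ^ j * (?g (h - j) * ?g j) * ?g c" unfolding hh[symmetric] by (simp only: mult_ac)
      then show ?thesis using nz[of h] by (simp add: field_simps)
    qed
    finally have "quadratic_jacobi j TYPE('p) * ?g c = - ((- 1) ^ j * (?g (h - j) / ?g h * ?g j)) * ?g c"
      by (simp only: mult_minus_left)
    then show ?thesis unfolding up lower using nz[of c] mult_right_cancel by blast
  next
    case 2
    then have "1 / 2 - u = 0" unfolding u_def half by simp
    then have up: "mccarthy_upper j (1 / 2) = 1 / ?g j" unfolding upper by (simp only:) (simp add: g_0 2)
    have "quadratic_jacobi j TYPE('p) = - ((- 1) ^ j)"
      by (rule quadratic_jacobi_middle[OF odd]) (simp only: 2 h_def q_def)
    then show ?thesis unfolding up lower using nz[of j] by simp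
  next
    case 3
    define c where "c = j - h"
    have c: "0 < c" "c < q" using 3 jq q by (auto simp: c_def)
    have "3 / 2 - u = of_nat (q - c) / of_nat q"
      unfolding half u_def using 3 q jq by (simp add: c_def of_nat_diff field_simps)
    then have g3: "padic_gamma_rat (3 / 2 - u) = ?g (q - c)" by (simp add: gamma_digit_def q_def)
    have "1 / 2 - u < 0" unfolding half u_def using 3 q0 by (simp add: divide_strict_right_mono)
    moreover have "- 1 \<le> 1 / 2 - u" using u by simp
    ultimately have fl: "\<lfloor>1 / 2 - u\<rfloor> = - 1" by (simp add: floor_eq_iff)
    then have "frac (1 / 2 - u) = 3 / 2 - u" by (simp add: frac_def)
    then have up: "mccarthy_upper j (1 / 2) = - of_nat CARD('p) * (?g (q - c) / ?g h)"
      unfolding upper fl using g3 by simp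
    have refl: "?g c * ?g (q - c) = (- 1) ^ Suc c"
      using gamma_digit_reflection[OF odd, of c] c unfolding q_def[symmetric] by simp
    have "quadratic_jacobi j TYPE('p) = (\<Sum>u\<in>UNIV - {0 :: 'p mod_ring}. teich u ^ (q - h) * teich (1 + u) ^ c)"
      unfolding qh by (rule jac[OF c(1), of j 0]) (use 3 in \<open>simp add: c_def\<close>)
    moreover have "\<dots> * ?g c = - ((- of_nat CARD('p)) ^ 1 * (?g j * ?g h))"
      by (rule gk) (use 3 c jq q in \<open>auto simp: c_def\<close>)
    ultimately have "quadratic_jacobi j TYPE('p) * ?g c = - (- of_nat CARD('p) * (?g j * ?g h))" by simp
    also have "?g j * ?g h = (- 1) ^ j * (?g (q - c) / ?g h * ?g j) * ?g c"
    proof -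
      have "(- 1) ^ j * (?g (q - c) * ?g j) * ?g c = (- 1) ^ j * ?g j * (?g c * ?g (q - c))" by (simp only: mult_ac)
      also have "\<dots> = ?g j * ((- 1) ^ j * (- 1) ^ Suc c)" unfolding refl by (simp only: mult_ac)
      also have "(- 1) ^ j * (- 1) ^ Suc c = ((- 1) ^ Suc h :: 'p padic)"
      proof -
        have "j = c + h" using 3 by (simp add: c_def)
        then show ?thesis by (cases "even c") (simp_all add: power_add)
      qed
      finally have "?g j * ?g h * ?g h = (- 1) ^ j * (?g (q - c) * ?g j) * ?g c" unfolding hh[symmetric] by (simp only: mult_ac)
      then show ?thesis using nz[of h] by (simp add: field_simps)
    qed
    finally have "quadratic_jacobi j TYPE('p) * ?g c =
        - ((- 1) ^ j * (- of_nat CARD('p) * (?g (q - c) / ?g h) * ?g j)) * ?g c"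
      by (simp only: mult_minus_left mult_minus_right mult_ac)
    then show ?thesis unfolding up lower using nz[of c] mult_right_cancel by blast
  qed
qed

text \<open>Interchanging the sums over \<open>t\<close> and \<open>j\<close> leaves a Jacobi sum in
  each term, which supplies the factors of the upper parameter 1/2 and the lower parameter 0 missing
  on the left. As \<open>d\<close> is even, the sign \<open>(- 1) ^ (j n)\<close> is 1 for
  \<open>n = d - 2\<close> and \<open>(- 1) ^ j\<close> for \<open>n = d - 1\<close>.\<close>

theorem theorem1p3:
  fixes d :: nat and x :: "'p::prime_card mod_ring"
  assumes "d > 2" and "even d"
    and "odd CARD('p)" and "\<not> CARD('p) dvd d * (d - 1)"
    and "x \<noteq> 0"
  shows "(\<Sum>t\<in>(UNIV :: 'p mod_ring set). of_int (quadratic_char (1 - t)) *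
            mccarthy_G (map (\<lambda>h. of_nat h / of_nat d) (filter (\<lambda>h. h \<noteq> d div 2) [1..<d]))
                       (map (\<lambda>h. of_nat h / of_nat (d - 1)) [1..<d - 1]) (x * t))
         = - mccarthy_G (map (\<lambda>h. of_nat h / of_nat d) [1..<d])
                        (map (\<lambda>h. of_nat h / of_nat (d - 1)) [0..<d - 1]) x"
proof -
  let ?as = "map (\<lambda>h. of_nat h / of_nat d :: rat) [1..<d]"
  let ?as' = "map (\<lambda>h. of_nat h / of_nat d :: rat) (filter (\<lambda>h. h \<noteq> d div 2) [1..<d])"
  let ?bs = "map (\<lambda>h. of_nat h / of_nat (d - 1) :: rat) [0..<d - 1]"
  let ?bs' = "map (\<lambda>h. of_nat h / of_nat (d - 1) :: rat) [1..<d - 1]"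
  let ?r = "(- 1) / of_nat (CARD('p) - 1) :: 'p padic"
  define P where "P = (\<lambda>j. prod_list (map (mccarthy_upper j) ?as') * prod_list (map (mccarthy_lower j) ?bs') :: 'p padic)"
  have mid: "d div 2 \<in> set [1..<d]" using assms(1) by auto
  have "length (filter (\<lambda>h. h \<noteq> d div 2) [1..<d]) = card (set [1..<d] - {d div 2})"
    by (subst distinct_card[symmetric]) (auto intro!: arg_cong[where f = card])
  then have len': "length ?as' = d - 2" using mid by (simp add: card_Diff_singleton)
  have even: "even (d - 2)" "odd (d - 1)" using assms(1,2) by auto
  have half: "of_nat (d div 2) / of_nat d = (1 / 2 :: rat)" using assms(1,2) by (auto elim!: evenE)
  have upper: "prod_list (map (mccarthy_upper j) ?as) = mccarthy_upper j (1 / 2) * prod_list (map (mccarthy_upper j) ?as')" for j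
    using prod_list_map_remove[OF distinct_upt mid, of "\<lambda>h. mccarthy_upper j (of_nat h / of_nat d)"] half by (simp add: comp_def)
  have "[0..<d - 1] = 0 # [1..<d - 1]" using assms(1) by (simp add: upt_conv_Cons)
  then have lower: "prod_list (map (mccarthy_lower j) ?bs) = mccarthy_lower j 0 * prod_list (map (mccarthy_lower j) ?bs')" for j
    by simp
  have rhs: "prod_list (map (mccarthy_upper j) ?as) * prod_list (map (mccarthy_lower j) ?bs) =
    (mccarthy_upper j (1 / 2) * mccarthy_lower j 0) * P j" for j
    unfolding upper lower P_def by (simp only: mult_ac)
  have inv: "inv_teichmuller_power j (x * t) = inv_teichmuller_power j x * inv_teichmuller_power j t" for j t
    using assms(5) by (simp add: inv_teichmuller_power_def teichmuller_mult power_mult_distrib)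
  have "mccarthy_G ?as' ?bs' (x * t) = ?r * (\<Sum>j = 0..CARD('p) - 2. inv_teichmuller_power j x * P j * inv_teichmuller_power j t)" for t
  proof -
    have len: "length ?as' = length ?bs'" using len' by simp
    have sgn: "((- 1) ^ (j * (d - 2)) :: 'p padic) = 1" for j
      using even(1) by (simp add: minus_one_power_iff)
    have Pj: "prod_list (map (mccarthy_upper j) ?as') * prod_list (map (mccarthy_lower j) ?bs') = P j" for j
      by (simp only: P_def)
    show ?thesis unfolding mccarthy_G_eq[OF len] len' inv sgn Pj mult_1_left by (simp only: mult_ac)
  qed
  then have "(\<Sum>t\<in>UNIV. of_int (quadratic_char (1 - t)) * mccarthy_G ?as' ?bs' (x * t)) =
    (\<Sum>t\<in>UNIV. \<Sum>j = 0..CARD('p) - 2. ?r * (inv_teichmuller_power j x * P j *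
      (of_int (quadratic_char (1 - t)) * inv_teichmuller_power j t)))"
    by (simp only: sum_distrib_left mult_ac)
  also have "\<dots> = ?r * (\<Sum>j = 0..CARD('p) - 2. inv_teichmuller_power j x * P j * quadratic_jacobi j TYPE('p))"
    unfolding quadratic_jacobi_def by (subst sum.swap) (simp only: sum_distrib_left)
  also have "(\<Sum>j = 0..CARD('p) - 2. inv_teichmuller_power j x * P j * quadratic_jacobi j TYPE('p)) =
    (\<Sum>j = 0..CARD('p) - 2. - ((- 1) ^ (j * length ?as) * inv_teichmuller_power j x *
      (prod_list (map (mccarthy_upper j) ?as) * prod_list (map (mccarthy_lower j) ?bs))))"
  proof (rule sum.cong[OF refl])
    fix j assume "j \<in> {0..CARD('p) - 2}"
    then have "quadratic_jacobi j TYPE('p) = - ((- 1) ^ j * (mccarthy_upper j (1 / 2) * mccarthy_lower j 0))"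
      by (intro quadratic_jacobi_eq_mccarthy assms) simp
    moreover have "((- 1) ^ (j * length ?as) :: 'p padic) = (- 1) ^ j"
      using even(2) by (simp add: minus_one_power_iff)
    ultimately show "inv_teichmuller_power j x * P j * quadratic_jacobi j TYPE('p) =
      - ((- 1) ^ (j * length ?as) * inv_teichmuller_power j x *
        (prod_list (map (mccarthy_upper j) ?as) * prod_list (map (mccarthy_lower j) ?bs)))"
      unfolding rhs by (simp only: mult_minus_right mult_ac)
  qed
  also have "?r * \<dots> = - mccarthy_G ?as ?bs x"
    by (subst mccarthy_G_eq) (simp_all add: sum_negf)
  finally show ?thesis .
qed

end
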